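(* Let $m>n+2$, $n\ge1$, $\mathfrak g=\mathfrak{osp}(2m|2n)$ with the data below, and let $\Lambda\in\hat{\mathfrak h}^*$ have level $k\ne0$ and satisfy $(\Lambda|T)=0$ (resp. $(\Lambda|T')=0$). Then $L(\Lambda)$ is integrable if and only if $\Lambda=k\Lambda_0-\sum_{i=1}^nk_i\beta_i+\sum_{i=n+1}^mk_i\epsilon_i+c\delta$ (resp. the same expression with $\beta_1$ replaced by $\beta_1'$) for some $c\in\mathbb{C}$ and numbers $k_i$ with $k\in\mathbb{Z}_{>0}$, $k_1\in\frac12\mathbb{Z}$, $k_i-k_1\in\mathbb{Z}$ ($2\le i\le m$), $k_m\ge\dots\ge k_2\ge|k_1|$, $k\ge k_m+k_{m-1}$, and such that $k_2=-k_1$ implies $k_1=k_2=0$.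
   Context: Affine setting: $\mathfrak g$ is a basic Lie superalgebra with nondegenerate invariant supersymmetric form $(\cdot|\cdot)$ and Cartan subalgebra $\mathfrak h\subset\mathfrak g_{\bar0}$, identified with $\mathfrak h^*$. $\hat{\mathfrak g}=\mathfrak g[t,t^{-1}]\oplus\mathbb{C}K\oplus\mathbb{C}d$, $[at^r,bt^s]=[a,b]t^{r+s}+r\delta_{r,-s}(a|b)K$, $K$ central, $[d,at^r]=rat^r$; $\hat{\mathfrak h}=\mathfrak h\oplus\mathbb{C}K\oplus\mathbb{C}d$, form extended by $(\mathfrak h|\mathbb{C}K+\mathbb{C}d)=0$, $(K|K)=(d|d)=0$, $(K|d)=1$; $\delta,\Lambda_0$ correspond to $K,d$. With simple roots $\Pi$, highest root $\theta$ of $\mathfrak g$, positive roots of $\hat{\mathfrak g}$: positive roots of $\mathfrak g$ and $\alpha+r\delta$ ($\alpha$ a root or 0, $r>0$); simple roots $\{\delta-\theta\}\cup\Pi$. $L(\Lambda)$ is the irreducible highest weight module, level $\Lambda(K)$. $L(\Lambda)$ is $\gamma$-integrable if $\hat{\mathfrak g}_{-\gamma}$ acts locally nilpotently; integrable if $\gamma$-integrable for all positive $\gamma\in\Delta^\#_{\bar0}$ and all $\alpha+r\delta$, $\alpha\in\Delta^\#_{\bar0}$, $r\in\mathbb{Z}_{>0}$, $\Delta^\#_{\bar0}$ the root set of $\mathfrak g^\#_{\bar0}$. Data: orthogonal basis $\epsilon_1,\dots,\epsilon_m,\delta_1,\dots,\delta_n$ of $\mathfrak h^*$, $(\epsilon_i|\epsilon_i)=1$,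 $(\delta_j|\delta_j)=-1$. Even roots $\epsilon_i-\epsilon_j,\pm(\epsilon_i+\epsilon_j)$ ($i\ne j$), $\delta_i-\delta_j,\pm(\delta_i+\delta_j),\pm2\delta_i$; odd roots $\pm(\epsilon_i\pm\delta_j)$. $\mathfrak g^\#_{\bar0}=\mathfrak{so}(2m)$ (roots in the $\epsilon$'s). Simple roots: $\epsilon_{m-i+1}-\epsilon_{m-i}$ ($1\le i\le m-n-1$), then $\epsilon_{n+1}-\delta_n,\ \delta_n-\epsilon_n,\ \epsilon_n-\delta_{n-1},\ \delta_{n-1}-\epsilon_{n-1},\dots,\ \epsilon_2-\delta_1,\ \delta_1-\epsilon_1,\ \delta_1+\epsilon_1$; $\theta=\epsilon_m+\epsilon_{m-1}$. $T=\{\beta_i=\delta_i-\epsilon_i: 1\le i\le n\}$. $\sigma_0$ is the linear map with $\sigma_0(\epsilon_1)=-\epsilon_1$, $\sigma_0(\epsilon_{n+1})=-\epsilon_{n+1}$, fixing the other $\epsilon_i$, all $\delta_j$, $\delta$ and $\Lambda_0$; $T'=\sigma_0(T)$, so $\beta_1'=\sigma_0(\beta_1)=\delta_1+\epsilon_1$ and $\beta'_i=\beta_i$ for $i\ge2$. *)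

theory Defs
  imports Complex_Main
begin

type_synonym mat = "nat \<Rightarrow> nat \<Rightarrow> complex"

definition matdim :: "nat \<Rightarrow> nat \<Rightarrow> nat" where
  "matdim m n = 2*m + 2*n"

definition ipar :: "nat \<Rightarrow> nat \<Rightarrow> nat" where
  "ipar m i = (if i < 2*m then 0 else 1)"

definition ev_part :: "nat \<Rightarrow> mat \<Rightarrow> mat" where
  "ev_part m X = (\<lambda>i j. if ipar m i = ipar m j then X i j else 0)"

definition od_part :: "nat \<Rightarrow> mat \<Rightarrow> mat" where
  "od_part m X = (\<lambda>i j. if ipar m i = ipar m j then 0 else X i j)"

definition mmul :: "nat \<Rightarrow> mat \<Rightarrow> mat \<Rightarrow> mat" where
  "mmul N X Y = (\<lambda>i j. \<Sum>c<N. X i c * Y c j)"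

text \<open>Supercommutator, extended bilinearly: [X,Y] = XY - YX + 2 Y1 X1.\<close>
definition sbr :: "nat \<Rightarrow> nat \<Rightarrow> mat \<Rightarrow> mat \<Rightarrow> mat" where
  "sbr m n X Y = (\<lambda>i j. mmul (matdim m n) X Y i j - mmul (matdim m n) Y X i j
      + 2 * mmul (matdim m n) (od_part m Y) (od_part m X) i j)"

text \<open>Gram matrix of the even supersymmetric form: symmetric on the even part,
  skew-symmetric on the odd part.\<close>
definition Jf :: "nat \<Rightarrow> nat \<Rightarrow> mat" where
  "Jf m n a b =
    (if a < m \<and> b = a + m then 1
     else if m \<le> a \<and> a < 2*m \<and> b + m = a then 1
     else if 2*m \<le> a \<and> a < 2*m + n \<and> b = a + n then 1
     else if 2*m + n \<le> a \<and> a < 2*m + 2*n \<and> b + n = a then -1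
     else 0)"

text \<open>B(X e_a, e_b) + (-1)^(s * |a|) B(e_a, X e_b) = 0 for X homogeneous of parity s.\<close>
definition osp_cond :: "nat \<Rightarrow> nat \<Rightarrow> nat \<Rightarrow> mat \<Rightarrow> bool" where
  "osp_cond m n s X = (\<forall>a < matdim m n. \<forall>b < matdim m n.
      (\<Sum>c<matdim m n. X c a * Jf m n c b)
      + (-1) ^ (s * ipar m a) * (\<Sum>c<matdim m n. Jf m n a c * X c b) = 0)"

definition in_range :: "nat \<Rightarrow> mat \<Rightarrow> bool" where
  "in_range N X = (\<forall>i j. (N \<le> i \<or> N \<le> j) \<longrightarrow> X i j = 0)"

definition osp :: "nat \<Rightarrow> nat \<Rightarrow> mat set" where
  "osp m n = {X. in_range (matdim m n) X \<and> osp_cond m n 0 (ev_part m X)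
                 \<and> osp_cond m n 1 (od_part m X)}"

definition cartan :: "nat \<Rightarrow> nat \<Rightarrow> mat set" where
  "cartan m n = {X \<in> osp m n. \<forall>i j. i \<noteq> j \<longrightarrow> X i j = 0}"

definition mzero :: mat where "mzero = (\<lambda>_ _. 0)"

text \<open>The invariant form (X|Y) = str(XY)/2; on the Cartan subalgebra this gives
  (eps_i|eps_i) = 1, (delta_j|delta_j) = -1.\<close>
definition strf :: "nat \<Rightarrow> nat \<Rightarrow> mat \<Rightarrow> complex" where
  "strf m n Z = (\<Sum>i<matdim m n. (if ipar m i = 0 then 1 else -1) * Z i i)"

definition mform :: "nat \<Rightarrow> nat \<Rightarrow> mat \<Rightarrow> mat \<Rightarrow> complex" where
  "mform m n X Y = strf m n (mmul (matdim m n) X Y) / 2"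

text \<open>(L, s, t) stands for  sum_r L(r) t^r + s K + t d.\<close>
type_synonym ghat = "(int \<Rightarrow> mat) \<times> complex \<times> complex"

definition ghat :: "nat \<Rightarrow> nat \<Rightarrow> ghat set" where
  "ghat m n = {(L, s, t). finite {r. L r \<noteq> mzero} \<and> (\<forall>r. L r \<in> osp m n)}"

definition gzero :: ghat where "gzero = (\<lambda>_. mzero, 0, 0)"

definition gadd :: "ghat \<Rightarrow> ghat \<Rightarrow> ghat" where
  "gadd x y = (case x of (L, s, t) \<Rightarrow> case y of (L', s', t') \<Rightarrow>
      (\<lambda>r i j. L r i j + L' r i j, s + s', t + t'))"

definition gsc :: "complex \<Rightarrow> ghat \<Rightarrow> ghat" where
  "gsc c x = (case x of (L, s, t) \<Rightarrow> (\<lambda>r i j. c * L r i j, c * s, c * t))"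

definition gbr :: "nat \<Rightarrow> nat \<Rightarrow> ghat \<Rightarrow> ghat \<Rightarrow> ghat" where
  "gbr m n x y = (case x of (L, s, t) \<Rightarrow> case y of (L', s', t') \<Rightarrow>
      (\<lambda>r i j. (\<Sum>p\<in>{p. L p \<noteq> mzero}. sbr m n (L p) (L' (r - p)) i j)
               + t * of_int r * L' r i j - t' * of_int r * L r i j,
       \<Sum>p\<in>{p. L p \<noteq> mzero}. of_int p * mform m n (L p) (L' (- p)),
       0))"

definition gev :: "nat \<Rightarrow> ghat \<Rightarrow> ghat" where
  "gev m x = (case x of (L, s, t) \<Rightarrow> (\<lambda>r. ev_part m (L r), s, t))"

definition god :: "nat \<Rightarrow> ghat \<Rightarrow> ghat" where
  "god m x = (case x of (L, s, t) \<Rightarrow> (\<lambda>r. od_part m (L r), 0, 0))"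

definition ghom :: "nat \<Rightarrow> nat \<Rightarrow> nat \<Rightarrow> ghat \<Rightarrow> bool" where
  "ghom m n a x = (x \<in> ghat m n \<and>
      ((a = 0 \<and> god m x = gzero) \<or> (a = 1 \<and> gev m x = gzero)))"

definition hhat :: "nat \<Rightarrow> nat \<Rightarrow> ghat set" where
  "hhat m n = {(L, s, t). L 0 \<in> cartan m n \<and> (\<forall>r. r \<noteq> 0 \<longrightarrow> L r = mzero)}"

section \<open>Weights: elements of h-hat^* in the basis eps_i, delta_j, Lambda_0, delta\<close>

record hw =
  heps :: "nat \<Rightarrow> complex"
  hdel :: "nat \<Rightarrow> complex"
  hLam0 :: complex
  hdelta :: complex

text \<open>Evaluation of a weight on h-hat: eps_i(h) and delta_j(h) are the diagonal
  entries, Lambda_0(K) = 1, Lambda_0(d) = 0, delta(K) = 0, delta(d) = 1.\<close>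
definition hw_ev :: "nat \<Rightarrow> nat \<Rightarrow> hw \<Rightarrow> ghat \<Rightarrow> complex" where
  "hw_ev m n \<mu> x = (case x of (L, s, t) \<Rightarrow>
      (\<Sum>i\<in>{1..m}. heps \<mu> i * L 0 (i - 1) (i - 1))
    + (\<Sum>j\<in>{1..n}. hdel \<mu> j * L 0 (2*m + j - 1) (2*m + j - 1))
    + hLam0 \<mu> * s + hdelta \<mu> * t)"

definition hw_eq :: "nat \<Rightarrow> nat \<Rightarrow> hw \<Rightarrow> hw \<Rightarrow> bool" where
  "hw_eq m n \<mu> \<nu> = (\<forall>h \<in> hhat m n. hw_ev m n \<mu> h = hw_ev m n \<nu> h)"

definition hw_form :: "nat \<Rightarrow> nat \<Rightarrow> hw \<Rightarrow> hw \<Rightarrow> complex" where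
  "hw_form m n \<mu> \<nu> = (\<Sum>i\<in>{1..m}. heps \<mu> i * heps \<nu> i)
      - (\<Sum>j\<in>{1..n}. hdel \<mu> j * hdel \<nu> j)
      + hLam0 \<mu> * hdelta \<nu> + hdelta \<mu> * hLam0 \<nu>"

definition hw_zero :: hw where
  "hw_zero = \<lparr>heps = (\<lambda>_. 0), hdel = (\<lambda>_. 0), hLam0 = 0, hdelta = 0\<rparr>"

definition hw_add :: "hw \<Rightarrow> hw \<Rightarrow> hw" where
  "hw_add \<mu> \<nu> = \<lparr>heps = (\<lambda>i. heps \<mu> i + heps \<nu> i), hdel = (\<lambda>j. hdel \<mu> j + hdel \<nu> j),
      hLam0 = hLam0 \<mu> + hLam0 \<nu>, hdelta = hdelta \<mu> + hdelta \<nu>\<rparr>"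

definition hw_sc :: "complex \<Rightarrow> hw \<Rightarrow> hw" where
  "hw_sc c \<mu> = \<lparr>heps = (\<lambda>i. c * heps \<mu> i), hdel = (\<lambda>j. c * hdel \<mu> j),
      hLam0 = c * hLam0 \<mu>, hdelta = c * hdelta \<mu>\<rparr>"

definition epsw :: "nat \<Rightarrow> hw" where
  "epsw i = hw_zero\<lparr>heps := (\<lambda>j. if j = i then 1 else 0)\<rparr>"

definition delw :: "nat \<Rightarrow> hw" where
  "delw i = hw_zero\<lparr>hdel := (\<lambda>j. if j = i then 1 else 0)\<rparr>"

definition Lam0w :: hw where "Lam0w = hw_zero\<lparr>hLam0 := 1\<rparr>"

definition deltaw :: hw where "deltaw = hw_zero\<lparr>hdelta := 1\<rparr>"

definition hw_sub :: "hw \<Rightarrow> hw \<Rightarrow> hw" where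
  "hw_sub \<mu> \<nu> = hw_add \<mu> (hw_sc (-1) \<nu>)"

definition sroots :: "nat \<Rightarrow> nat \<Rightarrow> hw set" where
  "sroots m n =
     {hw_sub deltaw (hw_add (epsw m) (epsw (m - 1)))}
   \<union> {hw_sub (epsw (i + 1)) (epsw i) | i. n + 1 \<le> i \<and> i \<le> m - 1}
   \<union> {hw_sub (epsw (j + 1)) (delw j) | j. 1 \<le> j \<and> j \<le> n}
   \<union> {hw_sub (delw j) (epsw j) | j. 1 \<le> j \<and> j \<le> n}
   \<union> {hw_add (delw 1) (epsw 1)}"

definition qplus :: "nat \<Rightarrow> nat \<Rightarrow> hw set" where
  "qplus m n = {\<gamma>. \<exists>c :: hw \<Rightarrow> nat. \<forall>h \<in> hhat m n.
      hw_ev m n \<gamma> h = (\<Sum>\<alpha>\<in>sroots m n. of_nat (c \<alpha>) * hw_ev m n \<alpha> h)}"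

definition groot :: "nat \<Rightarrow> nat \<Rightarrow> hw \<Rightarrow> ghat set" where
  "groot m n \<gamma> = {x \<in> ghat m n. \<forall>h \<in> hhat m n. gbr m n h x = gsc (hw_ev m n \<gamma> h) x}"

definition is_rep :: "nat \<Rightarrow> nat \<Rightarrow> (complex \<Rightarrow> 'v::ab_group_add \<Rightarrow> 'v)
    \<Rightarrow> (ghat \<Rightarrow> 'v \<Rightarrow> 'v) \<Rightarrow> bool" where
  "is_rep m n sc \<rho> =
    (vector_space sc
     \<and> (\<forall>x \<in> ghat m n. \<forall>u w. \<rho> x (u + w) = \<rho> x u + \<rho> x w)
     \<and> (\<forall>x \<in> ghat m n. \<forall>c u. \<rho> x (sc c u) = sc c (\<rho> x u))
     \<and> (\<forall>x \<in> ghat m n. \<forall>y \<in> ghat m n. \<forall>u. \<rho> (gadd x y) u = \<rho> x u + \<rho> y u)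
     \<and> (\<forall>x \<in> ghat m n. \<forall>c u. \<rho> (gsc c x) u = sc c (\<rho> x u))
     \<and> (\<forall>a b x y. ghom m n a x \<longrightarrow> ghom m n b y \<longrightarrow> (\<forall>u.
          \<rho> (gbr m n x y) u =
            (if a = 1 \<and> b = 1 then \<rho> x (\<rho> y u) + \<rho> y (\<rho> x u)
             else \<rho> x (\<rho> y u) - \<rho> y (\<rho> x u)))))"

definition is_L :: "nat \<Rightarrow> nat \<Rightarrow> (complex \<Rightarrow> 'v::ab_group_add \<Rightarrow> 'v)
    \<Rightarrow> (ghat \<Rightarrow> 'v \<Rightarrow> 'v) \<Rightarrow> hw \<Rightarrow> bool" where
  "is_L m n sc \<rho> \<Lambda> =
    (is_rep m n sc \<rho>
     \<and> (\<exists>v. v \<noteq> 0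
          \<and> (\<forall>h \<in> hhat m n. \<rho> h v = sc (hw_ev m n \<Lambda> h) v)
          \<and> (\<forall>\<gamma> \<in> qplus m n. \<not> hw_eq m n \<gamma> hw_zero \<longrightarrow> (\<forall>x \<in> groot m n \<gamma>. \<rho> x v = 0)))
     \<and> (\<forall>W. 0 \<in> W \<and> (\<forall>u\<in>W. \<forall>w\<in>W. u + w \<in> W) \<and> (\<forall>c. \<forall>u\<in>W. sc c u \<in> W)
           \<and> (\<forall>x \<in> ghat m n. \<forall>u\<in>W. \<rho> x u \<in> W)
           \<longrightarrow> W = {0} \<or> W = UNIV))"

text \<open>Roots of g^#_0 = so(2m): +-eps_i +- eps_j, i ~= j.\<close>
definition D0sharp :: "nat \<Rightarrow> hw set" where
  "D0sharp m = {hw_add (hw_sc a (epsw i)) (hw_sc b (epsw j)) | i j a b.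
      i \<in> {1..m} \<and> j \<in> {1..m} \<and> i \<noteq> j \<and> a \<in> {1, -1} \<and> b \<in> {1, -1}}"

definition gamma_integrable :: "nat \<Rightarrow> nat \<Rightarrow> (ghat \<Rightarrow> 'v::zero \<Rightarrow> 'v) \<Rightarrow> hw \<Rightarrow> bool" where
  "gamma_integrable m n \<rho> \<gamma> =
    (\<forall>x \<in> groot m n (hw_sc (-1) \<gamma>). \<forall>v. \<exists>N. (\<rho> x ^^ N) v = 0)"

definition integrable :: "nat \<Rightarrow> nat \<Rightarrow> (ghat \<Rightarrow> 'v::zero \<Rightarrow> 'v) \<Rightarrow> bool" where
  "integrable m n \<rho> =
    ((\<forall>\<gamma> \<in> D0sharp m \<inter> qplus m n. gamma_integrable m n \<rho> \<gamma>)
     \<and> (\<forall>\<alpha> \<in> D0sharp m. \<forall>r::nat. r > 0 \<longrightarrow>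
          gamma_integrable m n \<rho> (hw_add \<alpha> (hw_sc (of_nat r) deltaw))))"

definition K_el :: ghat where "K_el = (\<lambda>_. mzero, 1, 0)"

definition level :: "nat \<Rightarrow> nat \<Rightarrow> hw \<Rightarrow> complex" where
  "level m n \<Lambda> = hw_ev m n \<Lambda> K_el"

definition beta :: "nat \<Rightarrow> hw" where
  "beta i = hw_sub (delw i) (epsw i)"

definition beta' :: "nat \<Rightarrow> hw" where
  "beta' i = (if i = 1 then hw_add (delw 1) (epsw 1) else beta i)"

definition kconds :: "nat \<Rightarrow> complex \<Rightarrow> (nat \<Rightarrow> real) \<Rightarrow> bool" where
  "kconds m k ks =
    ((\<exists>K::nat. K > 0 \<and> k = of_nat K)
     \<and> 2 * ks 1 \<in> \<int>
     \<and> (\<forall>i\<in>{2..m}. ks i - ks 1 \<in> \<int>)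
     \<and> (\<forall>i\<in>{2..m-1}. ks i \<le> ks (i + 1))
     \<and> \<bar>ks 1\<bar> \<le> ks 2
     \<and> ks m + ks (m - 1) \<le> Re k \<and> Im k = 0
     \<and> (ks 2 = - ks 1 \<longrightarrow> ks 1 = 0 \<and> ks 2 = 0))"

end

theory Submission
  imports Defs
begin

text \<open>
  Integrability only has to be tested on the simple roots of the affine \<open>so(2m)\<close>: if \<open>e\<close> and \<open>y\<close> act locally
  nilpotently and \<open>[e, y]\<close> commutes with both, then \<open>[e, y]\<close> acts locally nilpotently, and the
  remaining negative root vectors arise from the simple ones by such commutators.
  The roots \<open>\<delta> - \<theta>\<close> and \<open>\<epsilon>\<^sub>i\<^sub>+\<^sub>1 - \<epsilon>\<^sub>i\<close> with \<open>i > n\<close> are simple for the given base; the roots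
  \<open>\<epsilon>\<^sub>i\<^sub>+\<^sub>1 - \<epsilon>\<^sub>i\<close> with \<open>i \<le> n\<close> and \<open>\<epsilon>\<^sub>1 + \<epsilon>\<^sub>2\<close> become simple after one odd reflection, in \<open>\<delta>\<^sub>i - \<epsilon>\<^sub>i\<close>
  and in \<open>\<delta>\<^sub>1 + \<epsilon>\<^sub>1\<close> respectively. Such a reflection replaces the highest weight vector by its image
  under the odd root vector exactly when the highest weight is not orthogonal to the root.
  For a simple even root, \<open>sl(2)\<close>-theory turns local nilpotency into the condition that the highest
  weight takes a value in \<open>\<nat>\<close> on the coroot. Singular vectors of an irreducible module all have the
  same degree, which forces the vectors expected to vanish to do so.
\<close>

section \<open>The algebra in coordinates\<close>

text \<open>There is no enveloping algebra here, no Weyl group and no general theory of bases: every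
  question of positivity becomes a question about which matrix entries of a loop may be nonzero,
  measured by one integer degree. The obstacle is the fork at \<epsilon>_1. The odd roots \<delta>_1
  - \<epsilon>_1 and \<delta>_1 + \<epsilon>_1 are both simple, but a degree separates them by the
  nonzero value of 2\<epsilon>_1, so they cannot both have degree 1; two labels with the same
  positive roots are carried along, one for each reflection. Orthogonality to T makes all
  reflections in \<delta>_i - \<epsilon>_i trivial, and the remaining one, in \<delta>_1 +
  \<epsilon>_1, is trivial exactly when k_1 = 0. Otherwise it lowers the value on the coroot of
  \<epsilon>_1 + \<epsilon>_2 by 1, so that k_1 + k_2 \<ge> 1 replaces k_1 + k_2 \<ge> 0; this is
  the origin of the clause on k_2 = -k_1. For T' the sign of \<epsilon>_1 is reversed, and one sign
  \<open>s\<close> covers both cases.\<close>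

locale osp_setting =
  fixes m n :: nat
  assumes m_gt: "m > n + 2" and n_ge: "n \<ge> 1"
begin

abbreviation N :: nat where "N \<equiv> matdim m n"

text \<open>Each basis vector pairs under \<open>Jf\<close> with exactly one other, and this is the
  matching. On weights it is negation: \<epsilon>_i goes to -\<epsilon>_i and \<delta>_j to
  -\<delta>_j.\<close>

definition pr :: "nat \<Rightarrow> nat" where
  "pr a = (if a < m then a + m else if a < 2*m then a - m
     else if a < 2*m + n then a + n else a - n)"

definition eta :: "nat \<Rightarrow> complex" where
  "eta a = (if a < 2*m + n then 1 else -1)"

text \<open>The two \<open>eta\<close> factors come from moving \<open>Jf\<close> across a matrix,
  the last factor from the extra sign that \<open>osp_cond\<close> puts on odd matrices; it matters
  only at positions with odd row and even column, which belong to the odd part.\<close>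

definition sig :: "nat \<Rightarrow> nat \<Rightarrow> complex" where
  "sig a b = eta (pr a) * eta (pr b) * (if 2*m \<le> a \<and> b < 2*m then -1 else 1)"

text \<open>The Koszul sign: -1 exactly when both factors \<open>X a c\<close> and
  \<open>Y c b\<close> sit at odd positions.\<close>

definition sg :: "nat \<Rightarrow> nat \<Rightarrow> nat \<Rightarrow> complex" where
  "sg a c b = (if ipar m a \<noteq> ipar m c \<and> ipar m c \<noteq> ipar m b then -1 else 1)"

lemma pr_less [simp]: "a < N \<Longrightarrow> pr a < N"
  by (auto simp: pr_def matdim_def)

lemma pr_pr [simp]: "a < N \<Longrightarrow> pr (pr a) = a"
  by (auto simp: pr_def matdim_def)

lemma pr_neq [simp]: "a < N \<Longrightarrow> pr a \<noteq> a" "a < N \<Longrightarrow> a \<noteq> pr a"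
  using m_gt n_ge by (auto simp: pr_def matdim_def)

lemma pr_inj: "a < N \<Longrightarrow> b < N \<Longrightarrow> pr a = pr b \<longleftrightarrow> a = b"
  using pr_pr by metis

lemma pr_even [simp]: "a < N \<Longrightarrow> pr a < 2*m \<longleftrightarrow> a < 2*m"
  using m_gt n_ge by (auto simp: pr_def matdim_def)

lemma ipar_pr [simp]: "a < N \<Longrightarrow> ipar m (pr a) = ipar m a"
  by (simp add: ipar_def)

lemma pr_bij: "bij_betw pr {..<N} {..<N}"
  by (rule bij_betw_byWitness[where f' = pr]) auto

lemma eta_sq [simp]: "eta a * eta a = 1" "eta a * (eta a * z) = z"
  by (auto simp: eta_def)

lemma Jf_eq: "a < N \<Longrightarrow> Jf m n a b = (if b = pr a then eta a else 0)"
  using m_gt n_ge by (auto simp: Jf_def pr_def eta_def matdim_def)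

lemma pr_swap: "a < N \<Longrightarrow> b < N \<Longrightarrow> a = pr b \<longleftrightarrow> b = pr a"
  using pr_pr by metis

lemma osp_cond_iff:
  "osp_cond m n s X \<longleftrightarrow> (\<forall>a<N. \<forall>b<N.
     X (pr b) (pr a) * eta (pr b) + (-1) ^ (s * ipar m a) * (eta (pr a) * X a b) = 0)"
proof -
  have 1: "(\<Sum>c<N. X c a * Jf m n c b) = X (pr b) a * eta (pr b)" if "a < N" "b < N" for a b
  proof -
    have "(\<Sum>c<N. X c a * Jf m n c b) = (\<Sum>c<N. if c = pr b then X (pr b) a * eta (pr b) else 0)"
      by (rule sum.cong) (use that in \<open>auto simp: Jf_eq pr_swap\<close>)
    then show ?thesis using that by simp
  qed
  have 2: "(\<Sum>c<N. Jf m n a c * X c b) = eta a * X (pr a) b" if "a < N" "b < N" for a b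
  proof -
    have "(\<Sum>c<N. Jf m n a c * X c b) = (\<Sum>c<N. if c = pr a then eta a * X (pr a) b else 0)"
      by (rule sum.cong) (use that in \<open>auto simp: Jf_eq\<close>)
    then show ?thesis using that by simp
  qed
  have "osp_cond m n s X \<longleftrightarrow> (\<forall>a<N. \<forall>b<N.
     X (pr b) a * eta (pr b) + (-1) ^ (s * ipar m a) * (eta a * X (pr a) b) = 0)"
    unfolding osp_cond_def by (simp add: 1 2)
  also have "\<dots> \<longleftrightarrow> (\<forall>a<N. \<forall>b<N.
     X (pr b) (pr a) * eta (pr b) + (-1) ^ (s * ipar m a) * (eta (pr a) * X a b) = 0)"
    by (metis pr_less pr_pr ipar_pr)
  finally show ?thesis .
qed

lemma sig_even: "a < 2*m \<Longrightarrow> b < 2*m \<Longrightarrow> sig a b = 1"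
  by (auto simp: sig_def eta_def pr_def)

lemma sig_sq: "sig a b * sig a b = 1"
  by (auto simp: sig_def eta_def)

lemma eta_pr: "a < N \<Longrightarrow> eta (pr a) = (if a < 2*m then 1 else - eta a)"
  by (auto simp: eta_def pr_def matdim_def)

lemma eta_even: "a < 2*m \<Longrightarrow> eta a = 1"
  by (simp add: eta_def)

lemma sig_pr: "a < N \<Longrightarrow> b < N \<Longrightarrow> sig (pr b) (pr a) = sig a b"
  by (simp add: sig_def eta_pr eta_even not_less[symmetric])

lemma sig_self: "a < N \<Longrightarrow> sig a (pr a) = (if a < 2*m then 1 else -1)"
  by (simp add: sig_def eta_pr eta_even)

lemma sig_mult: "sig a c * sig c b = sig a b * sg a c b"
  by (auto simp: sig_def sg_def ipar_def)

text \<open>Every position has one parity, so the even and the odd condition never compete and merge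
  into a single mirror relation between \<open>(a, b)\<close> and
  \<open>(pr b, pr a)\<close>.\<close>

lemma osp_iff:
  "X \<in> osp m n \<longleftrightarrow> in_range N X \<and> (\<forall>a<N. \<forall>b<N. X a b = - sig a b * X (pr b) (pr a))"
proof -
  have E: "(y * eta (pr b) + c * (eta (pr a) * x) = 0) \<longleftrightarrow> x = - (c * eta (pr a) * eta (pr b)) * y"
    if "c = 1 \<or> c = -1" for x y c :: complex and a b
    using that by (auto simp: eta_def algebra_simps add_eq_0_iff)
  have "(osp_cond m n 0 (ev_part m X) \<and> osp_cond m n 1 (od_part m X)) \<longleftrightarrow>
     (\<forall>a<N. \<forall>b<N. X a b = - sig a b * X (pr b) (pr a))"
    (is "_ \<longleftrightarrow> ?R")
  proof -
    have c: "(-1::complex) ^ k = 1 \<or> (-1::complex) ^ k = -1" for k by (cases "even k") auto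
    have "osp_cond m n 0 (ev_part m X) \<longleftrightarrow> (\<forall>a<N. \<forall>b<N. ipar m a = ipar m b \<longrightarrow>
        X a b = - sig a b * X (pr b) (pr a))"
      unfolding osp_cond_iff E[OF c]
      by (auto simp: ev_part_def sig_def ipar_def split: if_splits)
    moreover have "osp_cond m n 1 (od_part m X) \<longleftrightarrow> (\<forall>a<N. \<forall>b<N. ipar m a \<noteq> ipar m b \<longrightarrow>
        X a b = - sig a b * X (pr b) (pr a))"
      unfolding osp_cond_iff E[OF c]
      by (auto simp: od_part_def sig_def ipar_def split: if_splits)
    ultimately show ?thesis by blast
  qed
  then show ?thesis unfolding osp_def by blast
qed

lemma osp_sym: "X \<in> osp m n \<Longrightarrow> a < N \<Longrightarrow> b < N \<Longrightarrow> X a b = - sig a b * X (pr b) (pr a)"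
  unfolding osp_iff by blast

lemma osp_range: "X \<in> osp m n \<Longrightarrow> X a b \<noteq> 0 \<Longrightarrow> a < N \<and> b < N"
  unfolding osp_iff in_range_def by (meson not_le)

lemma osp_out: "X \<in> osp m n \<Longrightarrow> N \<le> a \<or> N \<le> b \<Longrightarrow> X a b = 0"
  by (metis leD osp_range)

lemma ospI:
  assumes "\<And>a b. N \<le> a \<or> N \<le> b \<Longrightarrow> X a b = 0"
    and "\<And>a b. a < N \<Longrightarrow> b < N \<Longrightarrow> X a b = - sig a b * X (pr b) (pr a)"
  shows "X \<in> osp m n"
  unfolding osp_iff in_range_def using assms by blast

text \<open>The position \<open>(a, pr a)\<close> is its own mirror image. For even \<open>a\<close>
  the mirror sign is -1, so the entry is its own negative: \<plusminus>2\<epsilon>_i is not a root.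
  For odd \<open>a\<close> the sign is +1, in accordance with the roots
  \<plusminus>2\<delta>_j.\<close>

lemma osp_even_dual: "X \<in> osp m n \<Longrightarrow> a < 2*m \<Longrightarrow> X a (pr a) = 0"
proof -
  assume X: "X \<in> osp m n" and a: "a < 2*m"
  then have "a < N" by (simp add: matdim_def)
  have *: "z = 0" if "z = - c * y" "c = 1" "y = z" for z c y :: complex
    using that by (simp add: eq_neg_iff_add_eq_0 flip: mult_2)
  show ?thesis
    by (rule *[OF osp_sym[OF X \<open>a < N\<close> pr_less[OF \<open>a < N\<close>]]])
       (use a \<open>a < N\<close> in \<open>simp_all add: sig_self\<close>)
qed

lemma osp_zero [simp]: "mzero \<in> osp m n"
  by (rule ospI) (simp_all add: mzero_def)

lemma osp_add:
  assumes X: "X \<in> osp m n" and Y: "Y \<in> osp m n"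
  shows "(\<lambda>i j. X i j + Y i j) \<in> osp m n"
proof (rule ospI)
  fix a b assume ab: "a < N" "b < N"
  show "X a b + Y a b = - sig a b * (X (pr b) (pr a) + Y (pr b) (pr a))"
    unfolding osp_sym[OF X ab] osp_sym[OF Y ab] by (simp add: distrib_left)
qed (use osp_out[OF X] osp_out[OF Y] in simp)

lemma osp_scale:
  assumes X: "X \<in> osp m n"
  shows "(\<lambda>i j. c * X i j) \<in> osp m n"
proof (rule ospI)
  fix a b assume ab: "a < N" "b < N"
  show "c * X a b = - sig a b * (c * X (pr b) (pr a))"
    unfolding osp_sym[OF X ab] by simp
qed (use osp_out[OF X] in simp)

lemma osp_sum:
  assumes F: "\<And>p. p \<in> A \<Longrightarrow> F p \<in> osp m n"
  shows "(\<lambda>i j. \<Sum>p\<in>A. F p i j) \<in> osp m n"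
proof (rule ospI)
  fix a b assume ab: "a < N" "b < N"
  show "(\<Sum>p\<in>A. F p a b) = - sig a b * (\<Sum>p\<in>A. F p (pr b) (pr a))"
    unfolding sum_distrib_left by (intro sum.cong refl osp_sym F ab)
qed (use osp_out[OF F] in simp)

lemma sbr_entry:
  "sbr m n X Y a b = (\<Sum>c<N. X a c * Y c b - sg a c b * Y a c * X c b)"
  unfolding sbr_def mmul_def sum_distrib_left sum.distrib[symmetric] sum_subtractf[symmetric]
  by (rule sum.cong) (auto simp: sg_def od_part_def)

lemma sg_pr: "a < N \<Longrightarrow> b < N \<Longrightarrow> c < N \<Longrightarrow> sg (pr b) (pr c) (pr a) = sg a c b"
  by (auto simp: sg_def)

text \<open>Reindexing the sum by \<open>pr\<close> reverses each product and so exchanges the two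
  terms of the supercommutator. By \<open>sig_mult\<close> the two mirror signs multiply to
  \<open>sig a b\<close> times the Koszul sign, which is what this exchange costs.\<close>

lemma osp_sbr:
  assumes X: "X \<in> osp m n" and Y: "Y \<in> osp m n"
  shows "sbr m n X Y \<in> osp m n"
proof (rule ospI)
  show "sbr m n X Y a b = 0" if "N \<le> a \<or> N \<le> b" for a b
    unfolding sbr_entry using that osp_out[OF X] osp_out[OF Y] by (intro sum.neutral) auto
next
  fix a b assume ab: "a < N" "b < N"
  have "sbr m n X Y (pr b) (pr a) =
      (\<Sum>c<N. X (pr b) (pr c) * Y (pr c) (pr a) - sg (pr b) (pr c) (pr a) * Y (pr b) (pr c) * X (pr c) (pr a))"
    unfolding sbr_entry
    by (rule sum.reindex_bij_betw[OF pr_bij, symmetric])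
  then have "- sig a b * sbr m n X Y (pr b) (pr a) =
     (\<Sum>c<N. - sig a b * (X (pr b) (pr c) * Y (pr c) (pr a) - sg a c b * Y (pr b) (pr c) * X (pr c) (pr a)))"
    using ab by (simp add: sg_pr sum_distrib_left)
  also have "\<dots> = (\<Sum>c<N. X a c * Y c b - sg a c b * Y a c * X c b)"
  proof (rule sum.cong, goal_cases)
    case (2 c)
    then have c: "c < N" by simp
    have "X a c * Y c b = (sig a c * sig c b) * (X (pr c) (pr a) * Y (pr b) (pr c))"
      unfolding osp_sym[OF X ab(1) c] osp_sym[OF Y c ab(2)] by simp
    moreover have "Y a c * X c b = (sig a c * sig c b) * (Y (pr c) (pr a) * X (pr b) (pr c))"
      unfolding osp_sym[OF Y ab(1) c] osp_sym[OF X c ab(2)] by simp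
    moreover have "sg a c b = 1 \<or> sg a c b = -1" by (auto simp: sg_def)
    ultimately show ?case
      unfolding sig_mult by (auto simp: algebra_simps)
  qed simp
  finally show "sbr m n X Y a b = - sig a b * sbr m n X Y (pr b) (pr a)"
    by (simp add: sbr_entry)
qed

section \<open>The affine algebra: components, closure and supports of brackets\<close>

abbreviation lpart :: "ghat \<Rightarrow> int \<Rightarrow> mat" where "lpart \<equiv> fst"
abbreviation cK :: "ghat \<Rightarrow> complex" where "cK x \<equiv> fst (snd x)"
abbreviation cd :: "ghat \<Rightarrow> complex" where "cd x \<equiv> snd (snd x)"

lemma ghat_iff: "x \<in> ghat m n \<longleftrightarrow> finite {r. lpart x r \<noteq> mzero} \<and> (\<forall>r. lpart x r \<in> osp m n)"
  by (auto simp: ghat_def split_beta)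

lemma ghat_eqI:
  "(\<And>r i j. lpart x r i j = lpart y r i j) \<Longrightarrow> cK x = cK y \<Longrightarrow> cd x = cd y \<Longrightarrow> x = y"
  by (intro prod_eqI ext)

lemma mzero_iff: "X \<noteq> mzero \<longleftrightarrow> (\<exists>i j. X i j \<noteq> 0)"
  by (auto simp: mzero_def fun_eq_iff)

lemma gbr_l: "lpart (gbr m n x y) r i j =
    (\<Sum>p\<in>{p. lpart x p \<noteq> mzero}. sbr m n (lpart x p) (lpart y (r - p)) i j)
      + cd x * of_int r * lpart y r i j - cd y * of_int r * lpart x r i j"
  by (auto simp: gbr_def split_beta)

lemma gbr_K: "cK (gbr m n x y) =
    (\<Sum>p\<in>{p. lpart x p \<noteq> mzero}. of_int p * mform m n (lpart x p) (lpart y (- p)))"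
  by (auto simp: gbr_def split_beta)

lemma gbr_d [simp]: "cd (gbr m n x y) = 0"
  by (auto simp: gbr_def split_beta)

lemma gadd_sel [simp]:
  "lpart (gadd x y) r i j = lpart x r i j + lpart y r i j"
  "cK (gadd x y) = cK x + cK y" "cd (gadd x y) = cd x + cd y"
  by (auto simp: gadd_def split_beta)

lemma gsc_sel [simp]:
  "lpart (gsc c x) r i j = c * lpart x r i j"
  "cK (gsc c x) = c * cK x" "cd (gsc c x) = c * cd x"
  by (auto simp: gsc_def split_beta)

lemma gzero_sel [simp]: "lpart gzero r i j = 0" "cK gzero = 0" "cd gzero = 0"
  by (auto simp: gzero_def mzero_def)

lemma gev_sel [simp]: "lpart (gev m x) r i j = (if ipar m i = ipar m j then lpart x r i j else 0)"
  "cK (gev m x) = cK x" "cd (gev m x) = cd x"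
  by (auto simp: gev_def ev_part_def split_beta)

lemma god_sel [simp]: "lpart (god m x) r i j = (if ipar m i = ipar m j then 0 else lpart x r i j)"
  "cK (god m x) = 0" "cd (god m x) = 0"
  by (auto simp: god_def od_part_def split_beta)

lemma gev_god: "gadd (gev m x) (god m x) = x"
  by (rule ghat_eqI) auto

lemma ghat_zero [simp]: "gzero \<in> ghat m n"
  by (auto simp: ghat_iff gzero_def)

lemma ghat_add: "x \<in> ghat m n \<Longrightarrow> y \<in> ghat m n \<Longrightarrow> gadd x y \<in> ghat m n"
proof -
  assume *: "x \<in> ghat m n" "y \<in> ghat m n"
  have "{r. lpart (gadd x y) r \<noteq> mzero} \<subseteq> {r. lpart x r \<noteq> mzero} \<union> {r. lpart y r \<noteq> mzero}"
    unfolding mzero_iff by force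
  moreover have "lpart (gadd x y) r = (\<lambda>i j. lpart x r i j + lpart y r i j)" for r
    by (intro ext) simp
  ultimately show ?thesis
    using * by (auto simp: ghat_iff osp_add intro: finite_subset)
qed

lemma ghat_sc: "x \<in> ghat m n \<Longrightarrow> gsc c x \<in> ghat m n"
proof -
  assume *: "x \<in> ghat m n"
  have "{r. lpart (gsc c x) r \<noteq> mzero} \<subseteq> {r. lpart x r \<noteq> mzero}"
    by (auto simp: mzero_iff)
  moreover have "lpart (gsc c x) r = (\<lambda>i j. c * lpart x r i j)" for r
    by (intro ext) simp
  ultimately show ?thesis
    using * by (auto simp: ghat_iff osp_scale intro: finite_subset)
qed

text \<open>Parity parts and degree projections are both restrictions to a set of positions.
  Stability of the set under the mirror map is what keeps the result in the algebra.\<close>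

definition grestr :: "(int \<Rightarrow> nat \<Rightarrow> nat \<Rightarrow> bool) \<Rightarrow> bool \<Rightarrow> ghat \<Rightarrow> ghat" where
  "grestr P c x = (\<lambda>r i j. if P r i j then lpart x r i j else 0,
     if c then cK x else 0, if c then cd x else 0)"

lemma grestr_sel [simp]:
  "lpart (grestr P c x) r i j = (if P r i j then lpart x r i j else 0)"
  "cK (grestr P c x) = (if c then cK x else 0)" "cd (grestr P c x) = (if c then cd x else 0)"
  by (auto simp: grestr_def)

lemma ghat_restr:
  assumes "x \<in> ghat m n" and "\<And>r i j. i < N \<Longrightarrow> j < N \<Longrightarrow> P r (pr j) (pr i) = P r i j"
  shows "grestr P c x \<in> ghat m n"
proof -
  have "{r. lpart (grestr P c x) r \<noteq> mzero} \<subseteq> {r. lpart x r \<noteq> mzero}"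
    by (auto simp: mzero_iff)
  then have "finite {r. lpart (grestr P c x) r \<noteq> mzero}"
    using assms(1) by (auto simp: ghat_iff intro: finite_subset)
  moreover have "lpart (grestr P c x) r \<in> osp m n" for r
  proof -
    have X: "lpart x r \<in> osp m n" using assms(1) by (auto simp: ghat_iff)
    show ?thesis
    proof (rule ospI)
      fix a b assume ab: "a < N" "b < N"
      show "lpart (grestr P c x) r a b = - sig a b * lpart (grestr P c x) r (pr b) (pr a)"
        unfolding grestr_sel assms(2)[OF ab] osp_sym[OF X ab] by simp
    qed (use osp_out[OF X] in simp)
  qed
  ultimately show ?thesis by (auto simp: ghat_iff)
qed

lemma gev_restr: "gev m x = grestr (\<lambda>r i j. ipar m i = ipar m j) True x"
  by (rule ghat_eqI) auto

lemma god_restr: "god m x = grestr (\<lambda>r i j. ipar m i \<noteq> ipar m j) False x"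
  by (rule ghat_eqI) auto

lemma ghat_gev: "x \<in> ghat m n \<Longrightarrow> gev m x \<in> ghat m n"
  unfolding gev_restr by (rule ghat_restr) auto

lemma ghat_god: "x \<in> ghat m n \<Longrightarrow> god m x \<in> ghat m n"
  unfolding god_restr by (rule ghat_restr) auto

lemma ghom_gev: "x \<in> ghat m n \<Longrightarrow> ghom m n 0 (gev m x)"
  by (auto simp: ghom_def ghat_gev intro!: ghat_eqI)

lemma ghom_god: "x \<in> ghat m n \<Longrightarrow> ghom m n 1 (god m x)"
  by (auto simp: ghom_def ghat_god intro!: ghat_eqI)

lemma ghom_ghat: "ghom m n a x \<Longrightarrow> x \<in> ghat m n"
  by (auto simp: ghom_def)

lemma sbr_nonzero:
  assumes "sbr m n X Y i j \<noteq> 0"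
  shows "\<exists>k<N. X i k \<noteq> 0 \<and> Y k j \<noteq> 0 \<or> Y i k \<noteq> 0 \<and> X k j \<noteq> 0"
proof (rule ccontr)
  assume "\<not> ?thesis"
  then have "X i c * Y c j - sg i c j * Y i c * X c j = 0" if "c < N" for c using that by auto
  then have "sbr m n X Y i j = 0" unfolding sbr_entry by (intro sum.neutral) auto
  with assms show False by simp
qed

lemma mform_nonzero:
  assumes "mform m n X Y \<noteq> 0"
  shows "\<exists>i<N. \<exists>k<N. X i k \<noteq> 0 \<and> Y k i \<noteq> 0"
proof (rule ccontr)
  assume "\<not> ?thesis"
  then have "mform m n X Y = 0"
    unfolding mform_def strf_def mmul_def
    by (auto intro!: sum.neutral simp: sum.neutral)
  with assms show False by simp
qed

text \<open>Degree arguments need the support of a bracket and not its values: a nonzero entry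
  arises from a product of nonzero entries or from the derivation \<open>d\<close>.\<close>

lemma gbr_l_nonzero:
  assumes "lpart (gbr m n x y) q i j \<noteq> 0"
  shows "(\<exists>p. \<exists>k<N. lpart x p i k \<noteq> 0 \<and> lpart y (q - p) k j \<noteq> 0
             \<or> lpart y (q - p) i k \<noteq> 0 \<and> lpart x p k j \<noteq> 0)
       \<or> cd x \<noteq> 0 \<and> q \<noteq> 0 \<and> lpart y q i j \<noteq> 0 \<or> cd y \<noteq> 0 \<and> q \<noteq> 0 \<and> lpart x q i j \<noteq> 0"
proof (rule ccontr)
  assume a: "\<not> ?thesis"
  then have "sbr m n (lpart x p) (lpart y (q - p)) i j = 0" for p
    using sbr_nonzero[of "lpart x p" "lpart y (q - p)" i j] by blast
  then have "lpart (gbr m n x y) q i j = 0" unfolding gbr_l using a by auto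
  with assms show False by simp
qed

lemma gbr_K_nonzero:
  assumes "cK (gbr m n x y) \<noteq> 0"
  shows "\<exists>p. \<exists>i<N. \<exists>k<N. p \<noteq> 0 \<and> lpart x p i k \<noteq> 0 \<and> lpart y (- p) k i \<noteq> 0"
proof (rule ccontr)
  assume a: "\<not> ?thesis"
  then have "of_int p * mform m n (lpart x p) (lpart y (- p)) = 0" for p
    using mform_nonzero[of "lpart x p" "lpart y (- p)"] by (metis mult_zero_left mult_zero_right of_int_0)
  then have "cK (gbr m n x y) = 0" unfolding gbr_K by (intro sum.neutral) blast
  with assms show False by simp
qed

lemma ghat_gbr:
  assumes x: "x \<in> ghat m n" and y: "y \<in> ghat m n"
  shows "gbr m n x y \<in> ghat m n"
proof -
  let ?A = "{r. lpart x r \<noteq> mzero}" and ?B = "{r. lpart y r \<noteq> mzero}"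
  have "{r. lpart (gbr m n x y) r \<noteq> mzero} \<subseteq> (\<lambda>(a, b). a + b) ` (?A \<times> ?B) \<union> ?A \<union> ?B"
  proof
    fix r assume "r \<in> {r. lpart (gbr m n x y) r \<noteq> mzero}"
    then obtain i j where "lpart (gbr m n x y) r i j \<noteq> 0" by (auto simp: mzero_iff)
    from gbr_l_nonzero[OF this] consider p where "p \<in> ?A" "r - p \<in> ?B" | "r \<in> ?A" | "r \<in> ?B"
      unfolding mem_Collect_eq mzero_iff by blast
    then show "r \<in> (\<lambda>(a, b). a + b) ` (?A \<times> ?B) \<union> ?A \<union> ?B"
    proof cases
      case 1
      then have "(\<lambda>(a, b). a + b) (p, r - p) \<in> (\<lambda>(a, b). a + b) ` (?A \<times> ?B)"
        by (intro imageI) auto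
      then show ?thesis by simp
    qed auto
  qed
  then have "finite {r. lpart (gbr m n x y) r \<noteq> mzero}"
    by (rule finite_subset) (use x y in \<open>simp add: ghat_iff\<close>)
  moreover have "lpart (gbr m n x y) r \<in> osp m n" for r
  proof -
    have eq: "lpart (gbr m n x y) r = (\<lambda>i j.
       ((\<Sum>p\<in>?A. sbr m n (lpart x p) (lpart y (r - p)) i j) + (cd x * of_int r) * lpart y r i j)
         + (- (cd y * of_int r)) * lpart x r i j)"
      by (intro ext) (simp add: gbr_l)
    show ?thesis unfolding eq
      by (intro osp_add osp_scale osp_sum osp_sbr) (use x y in \<open>auto simp: ghat_iff\<close>)
  qed
  ultimately show ?thesis by (auto simp: ghat_iff)
qed

section \<open>Cartan elements and degree supports\<close>

definition hx :: "(nat \<Rightarrow> complex) \<Rightarrow> complex \<Rightarrow> complex \<Rightarrow> ghat" where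
  "hx f s t = (\<lambda>r i j. if r = 0 \<and> i = j \<and> i < N then f i else 0, s, t)"

lemma hx_sel [simp]: "lpart (hx f s t) r i j = (if r = 0 \<and> i = j \<and> i < N then f i else 0)"
  "cK (hx f s t) = s" "cd (hx f s t) = t"
  by (simp_all add: hx_def)

abbreviation hval :: "ghat \<Rightarrow> nat \<Rightarrow> complex" where "hval h i \<equiv> lpart h 0 i i"

lemma hhat_iff: "h \<in> hhat m n \<longleftrightarrow> lpart h 0 \<in> osp m n \<and> (\<forall>i j. i \<noteq> j \<longrightarrow> lpart h 0 i j = 0)
    \<and> (\<forall>r. r \<noteq> 0 \<longrightarrow> lpart h r = mzero)"
  by (auto simp: hhat_def cartan_def split_beta)

lemma hhat_ghat: "h \<in> hhat m n \<Longrightarrow> h \<in> ghat m n"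
proof -
  assume h: "h \<in> hhat m n"
  then have "{r. lpart h r \<noteq> mzero} \<subseteq> {0}" by (auto simp: hhat_iff)
  moreover have "lpart h r \<in> osp m n" for r using h by (cases "r = 0") (auto simp: hhat_iff)
  ultimately show ?thesis by (auto simp: ghat_iff intro: finite_subset)
qed

lemma sig_diag: "sig a a = 1"
  by (auto simp: sig_def)

lemma hx_hhat:
  assumes "\<And>i. i < N \<Longrightarrow> f (pr i) = - f i"
  shows "hx f s t \<in> hhat m n"
  unfolding hhat_iff
proof (intro conjI allI impI)
  show "lpart (hx f s t) 0 \<in> osp m n"
    by (rule ospI) (auto simp: assms sig_diag pr_inj)
  show "lpart (hx f s t) r = mzero" if "r \<noteq> 0" for r
    using that by (intro ext) (simp add: mzero_def)
qed auto

lemma hval_pr: "h \<in> hhat m n \<Longrightarrow> i < N \<Longrightarrow> hval h (pr i) = - hval h i"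
  using osp_sym[of "lpart h 0" "pr i" "pr i"] by (simp add: hhat_iff sig_diag)

lemma gbr_hhat:
  assumes h: "h \<in> hhat m n" and x: "x \<in> ghat m n"
  shows "lpart (gbr m n h x) r i j = (hval h i - hval h j + cd h * of_int r) * lpart x r i j"
    and "cK (gbr m n h x) = 0"
proof -
  have off: "lpart h 0 i j = 0" if "i \<noteq> j" for i j using h that by (auto simp: hhat_iff)
  have ne: "lpart h p = mzero" if "p \<noteq> 0" for p using h that by (auto simp: hhat_iff)
  have sub: "{p. lpart h p \<noteq> mzero} \<subseteq> {0}" using ne by auto
  have *: "(\<Sum>p\<in>{p. lpart h p \<noteq> mzero}. sbr m n (lpart h p) (lpart x (r - p)) i j)
      = sbr m n (lpart h 0) (lpart x r) i j"
  proof (cases "lpart h 0 = mzero")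
    case True
    then have "{p. lpart h p \<noteq> mzero} = {}" using ne by (metis (mono_tags, lifting) Collect_empty_eq)
    moreover have "sbr m n (lpart h 0) (lpart x r) i j = 0"
      unfolding True sbr_entry by (simp add: mzero_def)
    ultimately show ?thesis by simp
  next
    case False
    then have "{p. lpart h p \<noteq> mzero} = {0}" using sub by auto
    then show ?thesis by simp
  qed
  have "sbr m n (lpart h 0) (lpart x r) i j = (hval h i - hval h j) * lpart x r i j"
  proof (cases "i < N \<and> j < N")
    case True
    have "sbr m n (lpart h 0) (lpart x r) i j =
        (\<Sum>c<N. (if c = i then hval h i * lpart x r i j else 0)
               - (if c = j then hval h j * lpart x r i j else 0))"
      unfolding sbr_entry
      by (rule sum.cong) (auto simp: off sg_def)
    then show ?thesis using True by (simp add: sum_subtractf left_diff_distrib)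
  next
    case False
    then have "lpart x r i j = 0" using x osp_out[of "lpart x r" i j] by (auto simp: ghat_iff)
    moreover have "lpart (gbr m n h x) r i j = 0 \<and> sbr m n (lpart h 0) (lpart x r) i j = 0"
      using False osp_sbr[of "lpart h 0" "lpart x r"] ghat_gbr[OF hhat_ghat[OF h] x] h x
      by (auto intro!: osp_out simp: ghat_iff hhat_iff)
    ultimately show ?thesis by simp
  qed
  moreover have "cd x * of_int r * lpart h r i j = 0"
    using ne[of r] by (cases "r = 0") (auto simp: mzero_def)
  ultimately show "lpart (gbr m n h x) r i j = (hval h i - hval h j + cd h * of_int r) * lpart x r i j"
    unfolding gbr_l * by (simp add: algebra_simps)
  show "cK (gbr m n h x) = 0"
    unfolding gbr_K using sub by (intro sum.neutral) auto
qed

text \<open>All components have degree in \<open>A\<close>, with \<open>K\<close> and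
  \<open>d\<close> counted in degree 0. The value \<open>D\<close> of \<delta> is a parameter here:
  positivity uses a large even one, while \<open>LN_orbit\<close> takes 0 to forget the power of
  t.\<close>

definition gsup :: "(nat \<Rightarrow> int) \<Rightarrow> int \<Rightarrow> int set \<Rightarrow> ghat \<Rightarrow> bool" where
  "gsup w D A x \<longleftrightarrow> (\<forall>q i j. lpart x q i j \<noteq> 0 \<longrightarrow> w i - w j + D * q \<in> A)
     \<and> (cK x \<noteq> 0 \<longrightarrow> 0 \<in> A) \<and> (cd x \<noteq> 0 \<longrightarrow> 0 \<in> A)"

lemma gsupD: "gsup w D A x \<Longrightarrow> lpart x q i j \<noteq> 0 \<Longrightarrow> w i - w j + D * q \<in> A"
  by (auto simp: gsup_def)

lemma gsup_gbr:
  assumes x: "gsup w D A x" and y: "gsup w D B y" and C: "\<And>a b. a \<in> A \<Longrightarrow> b \<in> B \<Longrightarrow> a + b \<in> C"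
  shows "gsup w D C (gbr m n x y)"
  unfolding gsup_def
proof (intro conjI allI impI)
  fix q i j assume "lpart (gbr m n x y) q i j \<noteq> 0"
  from gbr_l_nonzero[OF this] consider
    p k where "lpart x p i k \<noteq> 0" "lpart y (q - p) k j \<noteq> 0"
  | p k where "lpart y (q - p) i k \<noteq> 0" "lpart x p k j \<noteq> 0"
  | "cd x \<noteq> 0" "lpart y q i j \<noteq> 0" | "cd y \<noteq> 0" "lpart x q i j \<noteq> 0" by blast
  then show "w i - w j + D * q \<in> C"
  proof cases
    case (1 p k)
    from C[OF gsupD[OF x 1(1)] gsupD[OF y 1(2)]] show ?thesis by (simp add: algebra_simps)
  next
    case (2 p k)
    from C[OF gsupD[OF x 2(2)] gsupD[OF y 2(1)]] show ?thesis by (simp add: algebra_simps)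
  next
    case 3
    have "0 \<in> A" using x 3 by (simp add: gsup_def)
    from C[OF this gsupD[OF y 3(2)]] show ?thesis by simp
  next
    case 4
    have "0 \<in> B" using y 4 by (simp add: gsup_def)
    from C[OF gsupD[OF x 4(2)] this] show ?thesis by simp
  qed
next
  assume "cK (gbr m n x y) \<noteq> 0"
  from gbr_K_nonzero[OF this] obtain p i k where
    "lpart x p i k \<noteq> 0" "lpart y (- p) k i \<noteq> 0" by blast
  from C[OF gsupD[OF x this(1)] gsupD[OF y this(2)]] show "0 \<in> C" by simp
next
  assume "cd (gbr m n x y) \<noteq> 0"
  then show "0 \<in> C" by simp
qed

lemma gsup_gev: "gsup w D A x \<Longrightarrow> gsup w D A (gev m x)"
  by (auto simp: gsup_def)

lemma gsup_god: "gsup w D A x \<Longrightarrow> gsup w D A (god m x)"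
  by (auto simp: gsup_def)

text \<open>A matrix unit completed to satisfy the mirror relation: a root vector for the weight of
  \<open>a\<close> minus that of \<open>b\<close>. At the self-mirrored positions
  \<open>b = pr a\<close> the two terms meet; they cancel for even \<open>a\<close> and add up to 2
  for odd \<open>a\<close>.\<close>

definition Xm :: "nat \<Rightarrow> nat \<Rightarrow> mat" where
  "Xm a b = (\<lambda>i j. (if i = a \<and> j = b then 1 else 0)
      - sig a b * (if i = pr b \<and> j = pr a then 1 else 0))"

definition El :: "int \<Rightarrow> nat \<Rightarrow> nat \<Rightarrow> ghat" where
  "El r a b = (\<lambda>q. if q = r then Xm a b else mzero, 0, 0)"

lemma El_sel [simp]: "lpart (El r a b) q i j = (if q = r then Xm a b i j else 0)"
  "cK (El r a b) = 0" "cd (El r a b) = 0"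
  by (simp_all add: El_def mzero_def)

lemma Xm_nonzero: "Xm a b i j \<noteq> 0 \<Longrightarrow> i = a \<and> j = b \<or> i = pr b \<and> j = pr a"
  by (auto simp: Xm_def split: if_splits)

lemma Xm_osp:
  assumes ab: "a < N" "b < N"
  shows "Xm a b \<in> osp m n"
proof (rule ospI)
  fix i j assume ij: "i < N" "j < N"
  have e: "pr j = a \<longleftrightarrow> j = pr a" "pr i = b \<longleftrightarrow> i = pr b" "pr j = pr b \<longleftrightarrow> j = b" "pr i = pr a \<longleftrightarrow> i = a"
    using ij ab pr_pr pr_inj by metis+
  have *: "(if P then 1 else 0) - s * (if Q then 1 else 0)
       = - s' * ((if Q then 1 else 0) - s * (if P then 1 else 0))"
    if "s * s = 1" "P \<Longrightarrow> s' = s" "Q \<Longrightarrow> s' = s" for s s' :: complex and P Q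
    using that by (auto simp: algebra_simps)
  show "Xm a b i j = - sig i j * Xm a b (pr j) (pr i)"
    unfolding Xm_def e conj_commute[of "j = _"]
    by (rule *) (use sig_sq[of a b] sig_pr[OF ab] in auto)
next
  show "Xm a b i j = 0" if "N \<le> i \<or> N \<le> j" for i j
    using Xm_nonzero[of a b i j] that ab pr_less[OF ab(1)] pr_less[OF ab(2)]
    by (metis not_le)
qed

lemma El_ghat: "a < N \<Longrightarrow> b < N \<Longrightarrow> El r a b \<in> ghat m n"
proof -
  assume ab: "a < N" "b < N"
  have "{q. lpart (El r a b) q \<noteq> mzero} \<subseteq> {r}" by (auto simp: El_def)
  moreover have "lpart (El r a b) q \<in> osp m n" for q using Xm_osp[OF ab] by (simp add: El_def)
  ultimately show ?thesis by (auto simp: ghat_iff intro: finite_subset)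
qed

lemma El_ghom: "a < N \<Longrightarrow> b < N \<Longrightarrow> ghom m n (if ipar m a = ipar m b then 0 else 1) (El r a b)"
proof -
  assume ab: "a < N" "b < N"
  have *: "Xm a b i j = 0" if "(ipar m i = ipar m j) \<noteq> (ipar m a = ipar m b)" for i j
    using Xm_nonzero[of a b i j] that ab by (cases "Xm a b i j = 0") auto
  show ?thesis
    by (auto simp: ghom_def El_ghat ab * intro!: ghat_eqI)
qed

lemma El_gsup:
  assumes "a < N" "b < N" "w (pr a) = - w a" "w (pr b) = - w b" "w a - w b + D * r \<in> A"
  shows "gsup w D A (El r a b)"
  using assms by (auto simp: gsup_def dest!: Xm_nonzero split: if_splits)

lemma sig_cases: "sig a b = 1 \<or> sig a b = -1"
  by (auto simp: sig_def eta_def)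

lemma El_dual: "a < N \<Longrightarrow> b < N \<Longrightarrow> El r (pr b) (pr a) = gsc (- sig a b) (El r a b)"
  using sig_cases[of a b] by (intro ghat_eqI) (auto simp: Xm_def sig_pr)

lemma sum_ind:
  fixes F :: "nat \<Rightarrow> complex"
  assumes "b < N"
  shows "(\<Sum>c<N. (if P \<and> c = b then 1 else 0) * F c) = (if P then F b else 0)"
    and "(\<Sum>c<N. (if c = b \<and> P then 1 else 0) * F c) = (if P then F b else 0)"
proof -
  have "(\<lambda>c. (if P \<and> c = b then 1 else 0) * F c) = (\<lambda>c. if c = b then (if P then F b else 0) else 0)"
    by auto
  then show "(\<Sum>c<N. (if P \<and> c = b then 1 else 0) * F c) = (if P then F b else 0)"
    using assms by (simp only: sum.delta finite_lessThan lessThan_iff if_True)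
  then show "(\<Sum>c<N. (if c = b \<and> P then 1 else 0) * F c) = (if P then F b else 0)"
    by (simp only: conj_commute)
qed

lemma Xm_left:
  assumes "a < N" "b < N"
  shows "(\<Sum>c<N. Xm a b i c * F c) = (if i = a then F b else 0) - sig a b * (if i = pr b then F (pr a) else 0)"
  unfolding Xm_def left_diff_distrib sum_subtractf mult.assoc sum_distrib_left[symmetric]
    sum_ind[OF assms(2)] sum_ind[OF pr_less[OF assms(1)]] ..

lemma Xm_right:
  assumes "a < N" "b < N"
  shows "(\<Sum>c<N. F c * Xm a b c j) = (if j = b then F a else 0) - sig a b * (if j = pr a then F (pr b) else 0)"
  unfolding Xm_def mult.commute[of "F _"] left_diff_distrib sum_subtractf mult.assoc sum_distrib_left[symmetric]
    sum_ind[OF assms(1)] sum_ind[OF pr_less[OF assms(2)]] ..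

lemma sbr_Xm:
  assumes "a < N" "b < N"
  shows "sbr m n (Xm a b) Y i j =
     (if i = a then Y b j else 0) - sig a b * (if i = pr b then Y (pr a) j else 0)
   - (if j = b then sg i a j * Y i a else 0) + sig a b * (if j = pr a then sg i (pr b) j * Y i (pr b) else 0)"
  unfolding sbr_entry sum_subtractf Xm_left[OF assms] Xm_right[OF assms, of "\<lambda>c. sg i c j * Y i c"]
  by (simp add: algebra_simps)

lemma mform_Xm:
  assumes "a < N" "b < N"
  shows "mform m n (Xm a b) Y =
    ((if a < 2*m then 1 else -1) * Y b a - sig a b * (if b < 2*m then 1 else -1) * Y (pr a) (pr b)) / 2"
proof -
  have "strf m n (mmul N (Xm a b) Y) =
    (\<Sum>i<N. (if i = a then (if a < 2*m then 1 else -1) * Y b a else 0)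
       - (if i = pr b then sig a b * (if b < 2*m then 1 else -1) * Y (pr a) (pr b) else 0))"
    unfolding strf_def mmul_def Xm_left[OF assms]
    using assms by (intro sum.cong) (auto simp: ipar_def)
  then show ?thesis using assms unfolding mform_def by (simp add: sum_subtractf)
qed

lemma gbr_El:
  assumes "a < N" "b < N"
  shows "lpart (gbr m n (El r a b) y) q i j = sbr m n (Xm a b) (lpart y (q - r)) i j
            - cd y * of_int q * lpart (El r a b) q i j"
    and "cK (gbr m n (El r a b) y) = of_int r * mform m n (Xm a b) (lpart y (- r))"
proof -
  let ?S = "{p. lpart (El r a b) p \<noteq> mzero}"
  have sub: "?S \<subseteq> {r}" by (auto simp: El_def)
  have S: "?S = {} \<or> ?S = {r}" using sub by blast
  have l: "lpart (El r a b) r = Xm a b" by (simp add: El_def)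
  have z: "Xm a b = mzero" if "?S = {}"
    using that l by (metis (mono_tags, lifting) empty_iff mem_Collect_eq)
  show "lpart (gbr m n (El r a b) y) q i j = sbr m n (Xm a b) (lpart y (q - r)) i j
            - cd y * of_int q * lpart (El r a b) q i j"
    using S
  proof
    assume "?S = {}"
    then show ?thesis unfolding gbr_l using z by (simp add: sbr_entry mzero_def)
  next
    assume "?S = {r}"
    then show ?thesis unfolding gbr_l using l by simp
  qed
  show "cK (gbr m n (El r a b) y) = of_int r * mform m n (Xm a b) (lpart y (- r))"
    using S
  proof
    assume "?S = {}"
    then show ?thesis unfolding gbr_K using z by (simp add: mform_def strf_def mmul_def mzero_def)
  next
    assume "?S = {r}"
    then show ?thesis unfolding gbr_K using l by simp
  qed
qed

lemma gbr_El_El: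
  assumes "a < N" "b < N"
  shows "lpart (gbr m n (El r a b) (El s c d)) q i j
      = (if q = r + s then sbr m n (Xm a b) (Xm c d) i j else 0)"
    and "cK (gbr m n (El r a b) (El s c d)) = (if r + s = 0 then of_int r * mform m n (Xm a b) (Xm c d) else 0)"
proof -
  have z: "sbr m n (Xm a b) mzero i j = 0" by (simp add: sbr_entry mzero_def)
  show "lpart (gbr m n (El r a b) (El s c d)) q i j
      = (if q = r + s then sbr m n (Xm a b) (Xm c d) i j else 0)"
    unfolding gbr_El[OF assms] using z by (auto simp: El_def)
  have z: "mform m n (Xm a b) mzero = 0" by (simp add: mform_def strf_def mmul_def mzero_def)
  show "cK (gbr m n (El r a b) (El s c d)) = (if r + s = 0 then of_int r * mform m n (Xm a b) (Xm c d) else 0)"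
    unfolding gbr_El[OF assms] using z by (auto simp: El_def)
qed

text \<open>The right-hand side is the coroot of an affine so(2m) root. Its central part is
  \<open>s\<close> because the two root vectors pair to 1 under the form, and the root itself takes
  the value 2 on it, as sl(2)-theory requires.\<close>

lemma gbr_El_even:
  assumes "a < 2*m" "b < 2*m" "a \<noteq> b" "a \<noteq> pr b"
  shows "gbr m n (El s a b) (El (- s) b a) = hx (\<lambda>i. (if i = a then 1 else 0) - (if i = b then 1 else 0)
      + (if i = pr b then 1 else 0) - (if i = pr a then 1 else 0)) (of_int s) 0"
proof -
  have ab: "a < N" "b < N" using assms by (auto simp: matdim_def)
  have ne: "b \<noteq> pr a" "pr a \<noteq> pr b" "pr a \<noteq> b" using assms ab by (auto simp: pr_inj pr_swap)
  have ev: "ipar m a = 0" "ipar m b = 0" using assms by (auto simp: ipar_def)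
  have sgab: "sig a b = 1" "sig b a = 1" using assms by (auto simp: sig_even)
  show ?thesis
  proof (rule ghat_eqI)
    fix q i j
    show "lpart (gbr m n (El s a b) (El (- s) b a)) q i j = lpart (hx (\<lambda>i. (if i = a then 1 else 0) - (if i = b then 1 else 0)
      + (if i = pr b then 1 else 0) - (if i = pr a then 1 else 0)) (of_int s) 0) q i j"
      unfolding gbr_El_El[OF ab] sbr_Xm[OF ab] hx_sel
      using assms ab ne by (auto simp: Xm_def sgab sg_def ev)
  next
    have "mform m n (Xm a b) (Xm b a) = 1"
      unfolding mform_Xm[OF ab] using assms ab ne by (auto simp: Xm_def sgab)
    then show "cK (gbr m n (El s a b) (El (- s) b a)) = cK (hx (\<lambda>i. (if i = a then 1 else 0) - (if i = b then 1 else 0)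
      + (if i = pr b then 1 else 0) - (if i = pr a then 1 else 0)) (of_int s) 0)"
      by (simp add: gbr_El_El ab)
  qed simp
qed

lemma odd_even_neq:
  assumes "2*m \<le> a" "a < N" "b < 2*m"
  shows "a \<noteq> b" "a \<noteq> pr b" "b \<noteq> pr a" "pr a \<noteq> pr b" "pr a \<noteq> b"
proof -
  have "b < N" using assms by simp
  then have "pr b < 2*m" "\<not> pr a < 2*m" using assms by simp_all
  then show "a \<noteq> b" "a \<noteq> pr b" "b \<noteq> pr a" "pr a \<noteq> pr b" "pr a \<noteq> b"
    using assms by linarith+
qed

text \<open>For opposite odd root vectors the bracket is an anticommutator. A weight takes on it, up
  to sign, the value of its product with the isotropic root, so its vanishing is the orthogonality
  condition of an odd reflection.\<close>

lemma gbr_El_odd: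
  assumes "2*m \<le> a" "a < N" "b < 2*m"
  shows "gbr m n (El 0 a b) (El 0 b a) = hx (\<lambda>i. (if i = a then 1 else 0) + (if i = b then 1 else 0)
      - (if i = pr b then 1 else 0) - (if i = pr a then 1 else 0)) 0 0"
proof -
  have ab: "a < N" "b < N" using assms by (auto simp: matdim_def)
  note ne = odd_even_neq[OF assms]
  have ev: "ipar m a = 1" "ipar m b = 0" using assms by (auto simp: ipar_def)
  have sgab: "sig a b * sig b a = -1" using sig_mult[of a b a] by (simp add: sg_def ev sig_diag)
  show ?thesis
  proof (rule ghat_eqI)
    fix q i j
    show "lpart (gbr m n (El 0 a b) (El 0 b a)) q i j = lpart (hx (\<lambda>i. (if i = a then 1 else 0) + (if i = b then 1 else 0)
      - (if i = pr b then 1 else 0) - (if i = pr a then 1 else 0)) 0 0) q i j"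
      unfolding gbr_El_El[OF ab] sbr_Xm[OF ab] hx_sel
      using assms ab ne sgab by (auto simp: Xm_def sg_def ev)
  qed (use ab in \<open>auto simp: gbr_El_El\<close>)
qed

text \<open>The inequalities say that \<open>a\<close>, \<open>b\<close>, \<open>c\<close> carry
  \<plusminus>\<epsilon> with three different subscripts. The two roots then span a system of type
  A_2: their sum is a root, and adding either summand once more leaves the root system.\<close>

lemma gbr_El_sum:
  assumes "a < 2*m" "b < 2*m" "c < 2*m" "a \<noteq> b" "a \<noteq> pr b" "a \<noteq> c" "a \<noteq> pr c" "b \<noteq> c" "b \<noteq> pr c"
  shows "gbr m n (El r a b) (El s b c) = El (r + s) a c"
    and "gbr m n (El r a b) (El s a c) = gzero"
    and "gbr m n (El r b c) (El s a c) = gzero"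
proof -
  have ab: "a < N" "b < N" "c < N" using assms by (auto simp: matdim_def)
  have ne: "b \<noteq> pr a" "pr a \<noteq> pr b" "pr a \<noteq> b" "c \<noteq> pr a" "pr a \<noteq> pr c" "pr a \<noteq> c"
     "c \<noteq> pr b" "pr b \<noteq> pr c" "pr b \<noteq> c"
    using assms ab by (auto simp: pr_inj pr_swap)
  have ev: "ipar m a = 0" "ipar m b = 0" "ipar m c = 0" using assms by (auto simp: ipar_def)
  have sgab: "sig a b = 1" "sig b a = 1" "sig b c = 1" "sig a c = 1" using assms by (auto simp: sig_even)
  have mf: "mform m n (Xm a b) (Xm b c) = 0" "mform m n (Xm a b) (Xm a c) = 0" "mform m n (Xm b c) (Xm a c) = 0"
    unfolding mform_Xm[OF ab(1,2)] mform_Xm[OF ab(2,3)] using assms ab ne by (auto simp: Xm_def sgab)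
  have sb: "sbr m n (Xm a b) (Xm b c) i j = Xm a c i j" "sbr m n (Xm a b) (Xm a c) i j = 0"
      "sbr m n (Xm b c) (Xm a c) i j = 0" for i j
    unfolding sbr_Xm[OF ab(1,2)] sbr_Xm[OF ab(2,3)]
    using assms ab ne by (auto simp: Xm_def sgab sg_def ev)
  show "gbr m n (El r a b) (El s b c) = El (r + s) a c" "gbr m n (El r a b) (El s a c) = gzero"
     "gbr m n (El r b c) (El s a c) = gzero"
    by (rule ghat_eqI; simp add: gbr_El_El ab mf sb)+
qed

lemma gbr_El_self_odd:
  assumes "2*m \<le> a" "a < N" "b < 2*m"
  shows "gbr m n (El r b a) (El r b a) = gzero"
proof -
  have ab: "a < N" "b < N" using assms by (auto simp: matdim_def)
  note ne = odd_even_neq[OF assms]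
  have mf: "mform m n (Xm b a) (Xm b a) = 0"
    unfolding mform_Xm[OF ab(2,1)] using ne ab by (auto simp: Xm_def)
  have sb: "sbr m n (Xm b a) (Xm b a) i j = 0" for i j
    unfolding sbr_Xm[OF ab(2,1)] using ne ab by (auto simp: Xm_def)
  show ?thesis
    by (rule ghat_eqI; simp add: gbr_El_El ab mf sb)
qed

lemma gbr_h_El:
  assumes "h \<in> hhat m n" "a < N" "b < N"
  shows "gbr m n h (El r a b) = gsc (hval h a - hval h b + cd h * of_int r) (El r a b)"
proof (rule ghat_eqI)
  fix q i j
  show "lpart (gbr m n h (El r a b)) q i j
      = lpart (gsc (hval h a - hval h b + cd h * of_int r) (El r a b)) q i j"
  proof (cases "q = r \<and> Xm a b i j \<noteq> 0")
    case True
    with Xm_nonzero[of a b i j] have "i = a \<and> j = b \<or> i = pr b \<and> j = pr a" by simp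
    then show ?thesis using True assms by (auto simp: gbr_hhat El_ghat hval_pr)
  qed (use assms in \<open>auto simp: gbr_hhat El_ghat\<close>)
qed (use assms in \<open>simp_all add: gbr_hhat El_ghat\<close>)

section \<open>Gradings\<close>

definition supp :: "ghat \<Rightarrow> (int \<times> nat \<times> nat) set" where
  "supp x = {(q, i, j). lpart x q i j \<noteq> 0}"

lemma supp_iff [simp]: "(q, i, j) \<in> supp x \<longleftrightarrow> lpart x q i j \<noteq> 0"
  by (simp add: supp_def)

lemma ghat_osp: "x \<in> ghat m n \<Longrightarrow> lpart x q \<in> osp m n"
  by (simp add: ghat_iff)

lemma ghat_range: "x \<in> ghat m n \<Longrightarrow> lpart x q i j \<noteq> 0 \<Longrightarrow> i < N \<and> j < N"
  by (rule osp_range[OF ghat_osp])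

lemma finite_supp: "x \<in> ghat m n \<Longrightarrow> finite (supp x)"
proof -
  assume x: "x \<in> ghat m n"
  have "supp x \<subseteq> {r. lpart x r \<noteq> mzero} \<times> {..<N} \<times> {..<N}"
    unfolding supp_def mzero_iff using ghat_range[OF x] by blast
  then show ?thesis using x by (auto simp: ghat_iff intro: finite_subset)
qed

lemma Xm_diag_entry:
  assumes "a < N" "b < N" "\<not> (a < 2*m \<and> b = pr a)"
  shows "Xm a b a b \<noteq> 0"
proof (cases "a = pr b")
  case True
  then have b: "b = pr a" using assms by (simp add: pr_swap)
  have s: "sig a b = -1" unfolding b using assms b by (auto simp: sig_self)
  have e: "(a = pr b \<and> b = pr a) = True" using True b by blast
  show ?thesis unfolding Xm_def s e by simp
qed (simp add: Xm_def)

lemma ghat_not_dual: "x \<in> ghat m n \<Longrightarrow> lpart x q i j \<noteq> 0 \<Longrightarrow> \<not> (i < 2*m \<and> j = pr i)"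
  using osp_even_dual[OF ghat_osp] by blast

text \<open>A root space decomposition in the form of an induction. Subtracting a multiple of
  \<open>El q a b\<close> clears one entry together with its mirror image and fills no new position,
  so the support shrinks.\<close>

lemma ghat_span_induct:
  assumes x: "x \<in> ghat m n" "cK x = 0" "cd x = 0"
    and zero: "P gzero"
    and add: "\<And>y z. y \<in> ghat m n \<Longrightarrow> z \<in> ghat m n \<Longrightarrow> P y \<Longrightarrow> P z \<Longrightarrow> P (gadd y z)"
    and El: "\<And>q a b c. lpart x q a b \<noteq> 0 \<Longrightarrow> P (gsc c (El q a b))"
  shows "P x"
proof -
  have "P y" if "y \<in> ghat m n" "cK y = 0" "cd y = 0" "supp y \<subseteq> supp x" for y
    using that
  proof (induction "card (supp y)" arbitrary: y rule: less_induct)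
    case less
    show ?case
    proof (cases "supp y = {}")
      case True
      then have "y = gzero"
        using less.prems by (intro ghat_eqI) (auto simp: supp_def)
      then show ?thesis using zero by simp
    next
      case False
      then obtain q a b where nz: "lpart y q a b \<noteq> 0" by (auto simp: supp_def)
      have ab: "a < N" "b < N" using ghat_range[OF less.prems(1) nz] by auto
      have X: "Xm a b a b \<noteq> 0"
        using Xm_diag_entry[OF ab] ghat_not_dual[OF less.prems(1) nz] by blast
      \<comment> \<open>The entry of \<open>Xm a b\<close> is 2 rather than 1 on the roots
        \<plusminus>2\<delta>_j, hence the division.\<close>
      define c where "c = lpart y q a b / Xm a b a b"
      define y' where "y' = gadd y (gsc (- c) (El q a b))"
      have y': "y' \<in> ghat m n" "cK y' = 0" "cd y' = 0"
        using less.prems ab by (auto simp: y'_def intro!: ghat_add ghat_sc El_ghat)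
      have "lpart y q (pr b) (pr a) \<noteq> 0"
        using osp_sym[OF ghat_osp[OF less.prems(1)] ab, of q] nz by auto
      then have sub: "supp y' \<subseteq> supp y"
        using nz by (auto simp: y'_def dest!: Xm_nonzero split: if_splits)
      moreover have "lpart y' q a b = 0" using X by (simp add: y'_def c_def)
      ultimately have "supp y' \<subset> supp y" using nz by (metis psubsetI supp_iff)
      then have "card (supp y') < card (supp y)"
        by (rule psubset_card_mono[OF finite_supp[OF less.prems(1)]])
      then have "P y'" using less.hyps y' sub less.prems by blast
      moreover have "P (gsc c (El q a b))" using El less.prems(4) nz by (metis subsetD supp_iff)
      ultimately have "P (gadd y' (gsc c (El q a b)))"
        using y' ab by (intro add ghat_sc El_ghat)
      moreover have "gadd y' (gsc c (El q a b)) = y"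
        by (rule ghat_eqI) (auto simp: y'_def)
      ultimately show ?thesis by simp
    qed
  qed
  then show ?thesis using x by blast
qed

text \<open>The value of \<delta>. With labels m + n and m + n - 1 on \<epsilon>_m and
  \<epsilon>_(m-1) it gives \<delta> - \<theta> degree 1; being even, it leaves the parity of a
  degree to the finite part of the root.\<close>

abbreviation D :: int where "D \<equiv> 2 * int m + 2 * int n"

definition dg :: "(nat \<Rightarrow> int) \<Rightarrow> int \<Rightarrow> nat \<Rightarrow> nat \<Rightarrow> int" where
  "dg w q i j = w i - w j + D * q"

text \<open>A label \<open>w\<close> records the values of the weights \<open>\<epsilon>\<^sub>i\<close>, \<open>\<delta>\<^sub>j\<close> on an element of the Cartan subalgebra on
  which \<open>\<delta>\<close> takes the value \<open>D\<close>; the sign of the degree \<open>dg w\<close> then encodes a choice of positive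
  roots. The simple roots of interest get degree 1, which replaces any reference to a base.\<close>
definition lab :: "(nat \<Rightarrow> int) \<Rightarrow> bool" where
  "lab w \<longleftrightarrow> inj_on w {..<N} \<and> (\<forall>i<N. w (pr i) = - w i \<and> \<bar>w i\<bar> \<le> (int m + int n))
     \<and> w (m - 1) = (int m + int n)"

lemma lab_pr: "lab w \<Longrightarrow> i < N \<Longrightarrow> w (pr i) = - w i"
  by (simp add: lab_def)

lemma lab_inj: "lab w \<Longrightarrow> i < N \<Longrightarrow> j < N \<Longrightarrow> w i = w j \<Longrightarrow> i = j"
  by (auto simp: lab_def inj_on_def)

lemma m1_less: "m - 1 < m" "m - 1 < 2*m" "m - 1 < N"
  using m_gt by (auto simp: matdim_def)

text \<open>A difference of labels is at most \<open>D\<close> in absolute value, so it cancels a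
  nonzero multiple of \<open>D\<close> only at the extreme labels, those of
  \<plusminus>\<epsilon>_m. The exception would be \<plusminus>(2\<epsilon>_m - \<delta>), which is
  no root; this is why a label must put its maximum on an even index.\<close>

lemma lab_regular:
  assumes w: "lab w" and ij: "i < N" "j < N" and z: "dg w q i j = 0"
  shows "i = j \<and> q = 0 \<or> i < 2*m \<and> j = pr i"
proof -
  let ?M = "(int m + int n)"
  have Mp: "?M > 0" using n_ge by simp
  have b: "w i \<le> ?M" "- ?M \<le> w i" "w j \<le> ?M" "- ?M \<le> w j"
    using w ij by (auto simp: lab_def abs_le_iff)
  have wm: "w (m - 1) = ?M" "w (pr (m - 1)) = - ?M" using w m1_less by (auto simp: lab_def)
  have eq: "w j - w i = 2 * ?M * q" using z by (simp add: dg_def algebra_simps)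
  have "\<bar>2 * ?M * q\<bar> \<le> 2 * ?M" using b unfolding eq[symmetric] by auto
  then have "?M * \<bar>q\<bar> \<le> ?M * 1" by (simp add: abs_mult del: distrib_left_numeral)
  then have "\<bar>q\<bar> \<le> 1" using Mp mult_le_cancel_left_pos by blast
  then consider "q = 0" | "q = 1" | "q = -1" by linarith
  then show ?thesis
  proof cases
    case 1
    then show ?thesis using eq lab_inj[OF w ij] by simp
  next
    case 2
    then have "w j - w i = 2 * int m + 2 * int n" using eq by simp
    then have "w j = ?M" "w i = - ?M" using b by linarith+
    then have "w j = w (m - 1)" "w i = w (pr (m - 1))" unfolding wm .
    then have "j = m - 1" "i = pr (m - 1)" using lab_inj[OF w] ij m1_less pr_less by blast+
    then show ?thesis using m1_less by simp
  next
    case 3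
    then have "w j - w i = - (2 * int m + 2 * int n)" using eq by simp
    then have "w i = ?M" "w j = - ?M" using b by linarith+
    then have "w i = w (m - 1)" "w j = w (pr (m - 1))" unfolding wm .
    then have "i = m - 1" "j = pr (m - 1)" using lab_inj[OF w] ij m1_less pr_less by blast+
    then show ?thesis using m1_less by simp
  qed
qed

lemma ghat_regular:
  assumes "lab w" "x \<in> ghat m n" "lpart x q i j \<noteq> 0" "dg w q i j = 0"
  shows "i = j \<and> q = 0"
  using lab_regular[OF assms(1) _ _ assms(4)] ghat_range[OF assms(2,3)] ghat_not_dual[OF assms(2,3)]
  by blast

abbreviation posi :: "(nat \<Rightarrow> int) \<Rightarrow> ghat \<Rightarrow> bool" where "posi w \<equiv> gsup w D {0<..}"

lemma gsupD': "gsup w D A x \<Longrightarrow> lpart x q i j \<noteq> 0 \<Longrightarrow> dg w q i j \<in> A"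
  unfolding dg_def by (rule gsupD)

lemma zero_deg_hhat:
  assumes w: "lab w" and x: "x \<in> ghat m n" and z: "gsup w D {0} x"
  shows "x \<in> hhat m n"
proof -
  have *: "i = j \<and> q = 0" if "lpart x q i j \<noteq> 0" for q i j
    using ghat_regular[OF w x that] gsupD'[OF z that] by simp
  show ?thesis unfolding hhat_iff using ghat_osp[OF x] * by (metis mzero_iff)
qed

definition gproj :: "(nat \<Rightarrow> int) \<Rightarrow> int set \<Rightarrow> ghat \<Rightarrow> ghat" where
  "gproj w A = grestr (\<lambda>q i j. dg w q i j \<in> A) (0 \<in> A)"

lemma gproj_ghat: "lab w \<Longrightarrow> x \<in> ghat m n \<Longrightarrow> gproj w A x \<in> ghat m n"
  unfolding gproj_def by (rule ghat_restr) (auto simp: dg_def lab_pr)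

lemma gproj_gsup: "gsup w D A (gproj w A x)"
  unfolding gsup_def gproj_def by (auto simp: dg_def split: if_splits)

lemma gproj_split: "x = gadd (gproj w {..<0} x) (gadd (gproj w {0} x) (gproj w {0<..} x))"
  by (rule ghat_eqI) (auto simp: gproj_def)

definition h0 :: "(nat \<Rightarrow> int) \<Rightarrow> ghat" where
  "h0 w = hx (\<lambda>i. of_int (w i)) 0 (of_int D)"

lemma h0_hhat: "lab w \<Longrightarrow> h0 w \<in> hhat m n"
  unfolding h0_def by (rule hx_hhat) (simp add: lab_pr)

lemma h0_sel: "i < N \<Longrightarrow> hval (h0 w) i = of_int (w i)" "cd (h0 w) = of_int D" "cK (h0 w) = 0"
  by (simp_all add: h0_def)

text \<open>The nilradical of the minimal parabolic subalgebra attached to the root of \<open>El s a b\<close>.\<close>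
definition Psup :: "(nat \<Rightarrow> int) \<Rightarrow> int \<Rightarrow> nat \<Rightarrow> nat \<Rightarrow> ghat \<Rightarrow> bool" where
  "Psup w s a b x \<longleftrightarrow> x \<in> ghat m n \<and> posi w x \<and> lpart x s a b = 0"

lemma Psup_gev: "Psup w s a b x \<Longrightarrow> Psup w s a b (gev m x)"
  by (simp add: Psup_def ghat_gev gsup_gev)

lemma Psup_god: "Psup w s a b x \<Longrightarrow> Psup w s a b (god m x)"
  by (simp add: Psup_def ghat_god gsup_god)

lemma El_gsup_lab:
  "lab w \<Longrightarrow> a < N \<Longrightarrow> b < N \<Longrightarrow> dg w r a b \<in> A \<Longrightarrow> gsup w D A (El r a b)"
  by (rule El_gsup) (simp_all add: lab_pr dg_def)

text \<open>The bracket has degree at least 0, and degree 0 could come only from the root of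
  \<open>El s a b\<close>, whose coefficient in \<open>x\<close> is zero. So the negative root
  vector normalizes the nilradical; this is the form in which simplicity of the root enters.\<close>

lemma Psup_gbr:
  assumes w: "lab w" and ab: "a < N" "b < N" "a \<noteq> b" "a \<noteq> pr b" and d: "dg w s a b = 1"
    and P: "Psup w s a b x"
  shows "Psup w s a b (gbr m n x (El (- s) b a))"
proof -
  let ?f = "El (- s) b a" and ?y = "gbr m n x (El (- s) b a)"
  have x: "x \<in> ghat m n" "posi w x" "lpart x s a b = 0" using P by (auto simp: Psup_def)
  have ba: "b \<noteq> pr a" using ab by (simp add: pr_swap)
  have x2: "lpart x s (pr b) (pr a) = 0"
    using osp_sym[OF ghat_osp[OF x(1)] ab(1,2), of s] sig_sq[of a b] x(3) by auto
  have cdx: "cd x = 0" using x(2) by (auto simp: gsup_def)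
  have y: "?y \<in> ghat m n" using x ab by (intro ghat_gbr El_ghat)
  have f: "gsup w D {-1} ?f" using d by (intro El_gsup_lab w ab) (simp add: dg_def)
  have y0: "gsup w D {0..} ?y" by (rule gsup_gbr[OF x(2) f]) auto
  have prod: "\<exists>k. lpart x (q + s) i k \<noteq> 0 \<and> (k = b \<and> j = a \<or> k = pr a \<and> j = pr b)
         \<or> lpart x (q + s) k j \<noteq> 0 \<and> (i = b \<and> k = a \<or> i = pr a \<and> k = pr b)"
    if nz: "lpart ?y q i j \<noteq> 0" for q i j
  proof -
    from gbr_l_nonzero[OF nz] cdx obtain p k where
      "lpart x p i k \<noteq> 0 \<and> lpart ?f (q - p) k j \<noteq> 0 \<or> lpart ?f (q - p) i k \<noteq> 0 \<and> lpart x p k j \<noteq> 0"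
      by auto
    moreover have "p = q + s" if "lpart ?f (q - p) k j \<noteq> 0" for k j
      using that by (auto split: if_splits)
    moreover have "k = b \<and> j = a \<or> k = pr a \<and> j = pr b" if "lpart ?f (q - p) k j \<noteq> 0" for k j
      using that Xm_nonzero[of b a k j] by (auto split: if_splits)
    ultimately show ?thesis by metis
  qed
  have "dg w q i j > 0" if nz: "lpart ?y q i j \<noteq> 0" for q i j
  proof -
    have "dg w q i j \<noteq> 0"
    proof
      assume "dg w q i j = 0"
      from ghat_regular[OF w y nz this] have "i = j" "q = 0" by auto
      with prod[OF nz] x(3) x2 show False by auto
    qed
    then show ?thesis using gsupD'[OF y0 nz] by auto
  qed
  moreover have "cK ?y = 0"
  proof (rule ccontr)
    assume "cK ?y \<noteq> 0"
    from gbr_K_nonzero[OF this] obtain p i k where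
      k: "lpart x p i k \<noteq> 0" "lpart ?f (- p) k i \<noteq> 0" by blast
    then have "p = s" "k = b \<and> i = a \<or> k = pr a \<and> i = pr b"
      using Xm_nonzero[of b a k i] by (auto split: if_splits)
    with k(1) x(3) x2 show False by auto
  qed
  ultimately have "posi w ?y" by (auto simp: gsup_def dg_def)
  moreover have "lpart ?y s a b = 0"
  proof (rule ccontr)
    assume "lpart ?y s a b \<noteq> 0"
    from prod[OF this] show False using ab by auto
  qed
  ultimately show ?thesis using y by (simp add: Psup_def)
qed

lemma posi_decomp:
  assumes w: "lab w" and ab: "a < N" "b < N" "a \<noteq> pr b" and d: "dg w s a b > 0"
    and x: "x \<in> ghat m n" "posi w x"
  obtains c x' where "x = gadd (gsc c (El s a b)) x'" "Psup w s a b x'"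
proof
  define c where "c = lpart x s a b"
  define x' where "x' = gadd x (gsc (- c) (El s a b))"
  have "Xm a b a b = 1" using ab by (simp add: Xm_def)
  moreover have "posi w (El s a b)" using d by (intro El_gsup_lab w ab) simp
  then have "posi w x'"
    using x(2) unfolding gsup_def x'_def gadd_sel gsc_sel by (metis add.right_neutral mult_zero_right)
  ultimately show "Psup w s a b x'"
    using x ab by (simp add: Psup_def x'_def c_def ghat_add ghat_sc El_ghat)
  show "x = gadd (gsc c (El s a b)) x'"
    by (rule ghat_eqI) (auto simp: x'_def)
qed

text \<open>The odd reflection on labels. If \<open>a\<close> and \<open>b\<close> carry adjacent
  labels, exchanging these, together with those of the mirrors, makes the root of
  \<open>El 0 a b\<close> negative, and \<open>posi_tau\<close> shows that only its opposite becomes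
  newly positive.\<close>

definition tau :: "nat \<Rightarrow> nat \<Rightarrow> nat \<Rightarrow> nat" where
  "tau a b i = (if i = a then b else if i = b then a else if i = pr a then pr b
     else if i = pr b then pr a else i)"

lemma tau_less: "a < N \<Longrightarrow> b < N \<Longrightarrow> i < N \<Longrightarrow> tau a b i < N"
  by (simp add: tau_def)

lemma tau_tau:
  assumes "2*m \<le> a" "a < N" "b < 2*m"
  shows "tau a b (tau a b i) = i"
  using odd_even_neq[OF assms] assms by (auto simp: tau_def)

lemma tau_pr:
  assumes "2*m \<le> a" "a < N" "b < 2*m" "i < N"
  shows "tau a b (pr i) = pr (tau a b i)"
proof -
  have b: "b < N" using assms by simp
  note ne = odd_even_neq[OF assms(1-3)]
  have e: "pr i = a \<longleftrightarrow> i = pr a" "pr i = b \<longleftrightarrow> i = pr b" "pr i = pr a \<longleftrightarrow> i = a" "pr i = pr b \<longleftrightarrow> i = b"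
    using assms b pr_pr pr_inj by metis+
  show ?thesis unfolding tau_def e using ne assms b by auto
qed

lemma lab_tau:
  assumes w: "lab w" and ab: "2*m \<le> a" "a < N" "b < 2*m" and bm: "b \<noteq> m - 1" "b \<noteq> pr (m - 1)"
  shows "lab (w \<circ> tau a b)"
proof -
  have b: "b < N" using ab by simp
  have "inj_on (w \<circ> tau a b) {..<N}"
  proof (rule inj_onI)
    fix i j assume "i \<in> {..<N}" "j \<in> {..<N}" "(w \<circ> tau a b) i = (w \<circ> tau a b) j"
    then have "tau a b i = tau a b j"
      using lab_inj[OF w] tau_less[OF ab(2) b] by auto
    then show "i = j" using tau_tau[OF ab] by metis
  qed
  moreover have "(w \<circ> tau a b) (pr i) = - (w \<circ> tau a b) i \<and> \<bar>(w \<circ> tau a b) i\<bar> \<le> (int m + int n)" if "i < N" for i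
    using that tau_pr[OF ab that] tau_less[OF ab(2) b that] w by (simp add: lab_def)
  moreover have "tau a b (m - 1) = m - 1"
  proof -
    have "m - 1 \<noteq> pr a" using odd_even_neq[of a "m - 1"] ab m1_less by auto
    moreover have "m - 1 \<noteq> pr b" using bm m1_less b by (metis pr_pr)
    moreover have "m - 1 \<noteq> a" using ab m1_less by linarith
    ultimately show ?thesis using bm by (simp add: tau_def)
  qed
  ultimately show ?thesis using w by (simp add: lab_def)
qed

text \<open>Swapping two adjacent values changes a degree by at most 2, so only an entry of degree -1 can
  become positive; since \<open>D\<close> is even, parity leaves only the root being reflected.\<close>
lemma posi_tau:
  assumes w: "lab w" and ab: "2*m \<le> a" "a < N" "b < 2*m" and bm: "b \<noteq> m - 1" "b \<noteq> pr (m - 1)"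
    and d: "w a = w b + 1"
    and x: "x \<in> ghat m n" "posi (w \<circ> tau a b) x"
  obtains c x' where "x = gadd (gsc c (El 0 b a)) x'" "Psup w 0 a b x'"
proof -
  let ?w = "w \<circ> tau a b"
  have b: "b < N" using ab by simp
  note ne = odd_even_neq[OF ab]
  have w': "lab ?w" by (rule lab_tau[OF w ab bm])
  have pos: "dg ?w 0 b a > 0" using ne d by (simp add: dg_def tau_def)
  have "b \<noteq> pr a" using ne by simp
  from posi_decomp[OF w' b ab(2) this pos x] obtain c x' where
    x': "x = gadd (gsc c (El 0 b a)) x'" and P: "Psup ?w 0 b a x'" .
  have xg: "x' \<in> ghat m n" and xp: "posi ?w x'" and x0: "lpart x' 0 b a = 0"
    using P by (auto simp: Psup_def)
  have x1: "lpart x' 0 (pr a) (pr b) = 0"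
    using osp_sym[OF ghat_osp[OF xg] b ab(2), of 0] sig_sq[of b a] x0 by auto
  define c' where "c' i = (if i = a \<or> i = pr b then - 1 else if i = b \<or> i = pr a then 1 else (0::int))" for i
  have wc: "?w i = w i + c' i" if "i < N" for i
    using that ne d ab b lab_pr[OF w] by (auto simp: tau_def c'_def)
  have main: "dg w q i j > 0" if nz: "lpart x' q i j \<noteq> 0" for q i j
  proof -
    have ij: "i < N" "j < N" using ghat_range[OF xg nz] by auto
    have p: "dg ?w q i j > 0" using gsupD'[OF xp nz] by simp
    then have n0: "\<not> (i = j \<and> q = 0)" by (auto simp: dg_def)
    then have "dg w q i j \<noteq> 0" using ghat_regular[OF w xg nz] by blast
    moreover have eq: "dg ?w q i j = dg w q i j + c' i - c' j"
      using wc ij by (simp add: dg_def)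
    moreover have "dg w q i j \<noteq> -1 \<or> c' i \<noteq> 1 \<or> c' j \<noteq> -1"
    proof (rule ccontr)
      assume "\<not> ?thesis"
      then have m1: "w i - w j + D * q = - 1" and ci: "i = b \<or> i = pr a" and cj: "j = a \<or> j = pr b"
        by (auto simp: dg_def c'_def split: if_splits)
      have odd: "odd (w i - w j)" 
      proof -
        have "odd (w i - w j + D * q)" unfolding m1 by simp
        then show ?thesis by simp
      qed
      from ci cj consider "i = b" "j = a" | "i = b" "j = pr b" | "i = pr a" "j = a" | "i = pr a" "j = pr b"
        by blast
      then show False
      proof cases
        case 1
        then have "D * q = 0" using m1 d by simp
        then have "q = 0" using n_ge by auto
        then show False using 1 nz x0 by simp
      next
        case 4
        then have "D * q = 0" using m1 d lab_pr[OF w] ab b by simp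
        then have "q = 0" using n_ge by auto
        then show False using 4 nz x1 by simp
      qed (use odd lab_pr[OF w] ab b in auto)
    qed
    moreover have "c' i \<in> {-1, 0, 1}" "c' j \<in> {-1, 0, 1}" by (auto simp: c'_def)
    ultimately show ?thesis using p by auto
  qed
  have "posi w x'"
    using main xp by (auto simp: gsup_def dg_def)
  moreover have "lpart x' 0 a b = 0"
  proof (rule ccontr)
    assume "lpart x' 0 a b \<noteq> 0"
    then have "dg ?w 0 a b > 0" using gsupD'[OF xp] by auto
    then show False using ne d by (simp add: dg_def tau_def)
  qed
  ultimately show thesis using x' xg by (intro that) (auto simp: Psup_def)
qed

end

section \<open>Local nilpotency and singular vectors\<close>

locale osp_rep = osp_setting m n for m n :: nat +
  fixes sc :: "complex \<Rightarrow> 'v::ab_group_add \<Rightarrow> 'v" and \<rho> :: "ghat \<Rightarrow> 'v \<Rightarrow> 'v"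
  assumes rep: "is_rep m n sc \<rho>"
begin

sublocale vs: vector_space sc
  using rep by (simp add: is_rep_def)

lemma rho_add: "x \<in> ghat m n \<Longrightarrow> \<rho> x (u + w) = \<rho> x u + \<rho> x w"
  using rep by (simp add: is_rep_def)

lemma rho_sc: "x \<in> ghat m n \<Longrightarrow> \<rho> x (sc c u) = sc c (\<rho> x u)"
  using rep by (simp add: is_rep_def)

lemma rho_gadd: "x \<in> ghat m n \<Longrightarrow> y \<in> ghat m n \<Longrightarrow> \<rho> (gadd x y) u = \<rho> x u + \<rho> y u"
  using rep by (simp add: is_rep_def)

lemma rho_gsc: "x \<in> ghat m n \<Longrightarrow> \<rho> (gsc c x) u = sc c (\<rho> x u)"
  using rep by (simp add: is_rep_def)

lemma rho_gbr: "ghom m n a x \<Longrightarrow> ghom m n b y \<Longrightarrow> \<rho> (gbr m n x y) u =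
    (if a = 1 \<and> b = 1 then \<rho> x (\<rho> y u) + \<rho> y (\<rho> x u) else \<rho> x (\<rho> y u) - \<rho> y (\<rho> x u))"
  using rep unfolding is_rep_def by blast

lemma rho_0 [simp]: "x \<in> ghat m n \<Longrightarrow> \<rho> x 0 = 0"
  using rho_sc[of x 0 0] by simp

lemma rho_diff: "x \<in> ghat m n \<Longrightarrow> \<rho> x (u - w) = \<rho> x u - \<rho> x w"
  using rho_add[of x u "sc (-1) w"] rho_sc[of x "-1" w] by simp

lemma rho_gzero [simp]: "\<rho> gzero u = 0"
proof -
  have "gzero = gsc 0 gzero" by (rule ghat_eqI) auto
  then show ?thesis by (metis rho_gsc ghat_zero vs.scale_zero_left)
qed

text \<open>The sign \<epsilon> stays unspecified since it is only applied to terms that vanish or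
  that lie in a given span.\<close>

lemma rho_swap:
  assumes "ghom m n a x" "ghom m n b y"
  shows "\<exists>\<epsilon>. \<forall>u. \<rho> x (\<rho> y u) = sc \<epsilon> (\<rho> y (\<rho> x u)) + \<rho> (gbr m n x y) u"
proof (cases "a = 1 \<and> b = 1")
  case True
  then show ?thesis by (intro exI[of _ "-1"]) (use rho_gbr[OF assms] in simp)
next
  case False
  then show ?thesis by (intro exI[of _ 1]) (use rho_gbr[OF assms] in auto)
qed

lemma rho_swap_even:
  assumes "ghom m n a x" "ghom m n 0 y"
  shows "\<rho> x (\<rho> y u) = \<rho> y (\<rho> x u) + \<rho> (gbr m n x y) u"
  using rho_gbr[OF assms] by simp

lemma rho_split: "x \<in> ghat m n \<Longrightarrow> \<rho> x u = \<rho> (gev m x) u + \<rho> (god m x) u"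
  by (metis gev_god rho_gadd ghat_gev ghat_god)

lemma hhat_ghom:
  assumes "h \<in> hhat m n"
  shows "ghom m n 0 h"
proof -
  have "lpart h q i j = 0" if "ipar m i \<noteq> ipar m j" for q i j
    using assms that by (cases "q = 0"; cases "i = j") (auto simp: hhat_iff mzero_def)
  then show ?thesis
    using hhat_ghat[OF assms] by (auto simp: ghom_def intro!: ghat_eqI)
qed

lemma rho_h_El:
  assumes "h \<in> hhat m n" "a < N" "b < N"
  shows "\<rho> h (\<rho> (El r a b) u) = \<rho> (El r a b) (\<rho> h u)
     + sc (hval h a - hval h b + cd h * of_int r) (\<rho> (El r a b) u)"
proof -
  let ?p = "if ipar m a = ipar m b then 0 else 1"
  have "\<rho> (gbr m n h (El r a b)) u = \<rho> h (\<rho> (El r a b) u) - \<rho> (El r a b) (\<rho> h u)"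
    using rho_gbr[OF hhat_ghom[OF assms(1)] El_ghom[OF assms(2,3)]] by simp
  then show ?thesis
    by (simp add: gbr_h_El assms rho_gsc El_ghat algebra_simps)
qed

lemma rho_h0_El:
  assumes "lab w" "a < N" "b < N"
  shows "\<rho> (h0 w) (\<rho> (El r a b) u) = \<rho> (El r a b) (\<rho> (h0 w) u) + sc (of_int (dg w r a b)) (\<rho> (El r a b) u)"
  using rho_h_El[OF h0_hhat[OF assms(1)] assms(2,3)] assms by (simp add: h0_sel dg_def)

text \<open>Positivity refers to a label, so that one vector can be tested against several bases.
  The weight is a function because reflected weights are formed by subtracting values on the Cartan
  subalgebra.\<close>

definition sing :: "(nat \<Rightarrow> int) \<Rightarrow> 'v \<Rightarrow> (ghat \<Rightarrow> complex) \<Rightarrow> bool" where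
  "sing w v \<Phi> \<longleftrightarrow> (\<forall>h \<in> hhat m n. \<rho> h v = sc (\<Phi> h) v)
     \<and> (\<forall>x \<in> ghat m n. posi w x \<longrightarrow> \<rho> x v = 0)"

lemma sing_h: "sing w v \<Phi> \<Longrightarrow> h \<in> hhat m n \<Longrightarrow> \<rho> h v = sc (\<Phi> h) v"
  by (simp add: sing_def)

lemma sing_pos: "sing w v \<Phi> \<Longrightarrow> x \<in> ghat m n \<Longrightarrow> posi w x \<Longrightarrow> \<rho> x v = 0"
  by (simp add: sing_def)

text \<open>Stands for U(n_-)u, where n_- is the span of the root vectors of negative
  degree.\<close>

inductive lowered :: "(nat \<Rightarrow> int) \<Rightarrow> 'v \<Rightarrow> 'v \<Rightarrow> bool" for w u where
  lowered_base: "lowered w u u"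
| lowered_add: "lowered w u y \<Longrightarrow> lowered w u z \<Longrightarrow> lowered w u (y + z)"
| lowered_sc: "lowered w u y \<Longrightarrow> lowered w u (sc c y)"
| lowered_El: "lowered w u y \<Longrightarrow> a < N \<Longrightarrow> b < N \<Longrightarrow> dg w r a b < 0 \<Longrightarrow> lowered w u (\<rho> (El r a b) y)"

lemma lowered_0: "lowered w u 0"
  using lowered_sc[OF lowered_base, of w u 0] by simp

lemma lowered_neg:
  assumes w: "lab w" and y: "lowered w u y" and x: "x \<in> ghat m n" "gsup w D {..<0} x"
  shows "lowered w u (\<rho> x y)"
proof (rule ghat_span_induct[OF x(1)])
  show "cK x = 0" "cd x = 0" using x(2) by (auto simp: gsup_def)
  show "lowered w u (\<rho> gzero y)" by (simp add: lowered_0)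
  show "lowered w u (\<rho> (gadd y' z') y)"
    if "y' \<in> ghat m n" "z' \<in> ghat m n" "lowered w u (\<rho> y' y)" "lowered w u (\<rho> z' y)" for y' z'
    using that by (simp add: rho_gadd lowered_add)
  show "lowered w u (\<rho> (gsc c (El q a b)) y)" if "lpart x q a b \<noteq> 0" for q a b c
  proof -
    have ab: "a < N" "b < N" using ghat_range[OF x(1) that] by auto
    have "dg w q a b < 0" using gsupD'[OF x(2) that] by simp
    then show ?thesis using ab y by (simp add: rho_gsc El_ghat lowered_sc lowered_El)
  qed
qed

text \<open>In place of a PBW argument, \<open>x\<close> is moved past the outermost lowering
  operator. The bracket produced is again an arbitrary element, so the induction needs the claim for
  all \<open>x\<close> at once.\<close>

lemma lowered_stable:
  assumes w: "lab w" and u: "sing w u M" and y: "lowered w u y"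
  shows "\<forall>x \<in> ghat m n. lowered w u (\<rho> x y)"
  using y
proof induction
  case lowered_base
  show ?case
  proof
    fix x assume x: "x \<in> ghat m n"
    note g = gproj_ghat[OF w x]
    have "\<rho> x u = \<rho> (gproj w {..<0} x) u + (\<rho> (gproj w {0} x) u + \<rho> (gproj w {0<..} x) u)"
      by (subst gproj_split[of x w]) (simp add: rho_gadd g ghat_add)
    moreover have "\<rho> (gproj w {0<..} x) u = 0"
      by (rule sing_pos[OF u g gproj_gsup])
    moreover have "gproj w {0} x \<in> hhat m n"
      by (rule zero_deg_hhat[OF w g gproj_gsup])
    then have "\<rho> (gproj w {0} x) u = sc (M (gproj w {0} x)) u"
      by (rule sing_h[OF u])
    moreover have "lowered w u (\<rho> (gproj w {..<0} x) u)"
      by (rule lowered_neg[OF w lowered.lowered_base g gproj_gsup])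
    ultimately show "lowered w u (\<rho> x u)"
      by (simp add: lowered_add lowered_sc lowered.lowered_base)
  qed
next
  case (lowered_add y z)
  then show ?case by (simp add: rho_add lowered.lowered_add)
next
  case (lowered_sc y c)
  then show ?case by (simp add: rho_sc lowered.lowered_sc)
next
  case (lowered_El y a b r)
  note E = El_ghat[OF lowered_El.hyps(2,3), of r] and Eh = El_ghom[OF lowered_El.hyps(2,3), of r]
  have hom: "lowered w u (\<rho> x (\<rho> (El r a b) y))" if x: "ghom m n p x" for p x
  proof -
    obtain \<epsilon> where e: "\<And>u. \<rho> x (\<rho> (El r a b) u) = sc \<epsilon> (\<rho> (El r a b) (\<rho> x u)) + \<rho> (gbr m n x (El r a b)) u"
      using rho_swap[OF x Eh] by blast
    have "lowered w u (\<rho> (El r a b) (\<rho> x y))"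
      using lowered_El ghom_ghat[OF x] by (intro lowered.lowered_El) auto
    moreover have "lowered w u (\<rho> (gbr m n x (El r a b)) y)"
      using lowered_El.IH ghat_gbr[OF ghom_ghat[OF x] E] by blast
    ultimately show ?thesis
      unfolding e by (intro lowered.lowered_add lowered.lowered_sc)
  qed
  show ?case
    using rho_split hom[OF ghom_gev] hom[OF ghom_god] by (simp add: lowered.lowered_add)
qed

text \<open>The product of the operators \<open>\<rho> h - s\<close> over a list of scalars.
  Annihilating products of this kind replace a decomposition into eigenspaces of
  \<open>h\<close>.\<close>

fun pol :: "ghat \<Rightarrow> complex list \<Rightarrow> 'v \<Rightarrow> 'v" where
  "pol h [] z = z"
| "pol h (s # ss) z = \<rho> h (pol h ss z) - sc s (pol h ss z)"

context
  fixes h :: ghat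
  assumes h: "h \<in> ghat m n"
begin

lemma pol_append: "pol h (ss @ ts) z = pol h ss (pol h ts z)"
  by (induction ss) auto

lemma pol_rho: "pol h ss (\<rho> h z) = \<rho> h (pol h ss z)"
  by (induction ss) (auto simp: rho_diff rho_sc h)

lemma pol_sc: "pol h ss (sc c z) = sc c (pol h ss z)"
  by (induction ss) (auto simp: rho_sc h vs.scale_right_diff_distrib vs.scale_left_commute)

lemma pol_add: "pol h ss (y + z) = pol h ss y + pol h ss z"
  by (induction ss) (auto simp: rho_add h vs.scale_right_distrib algebra_simps)

lemma pol_diff: "pol h ss (y - z) = pol h ss y - pol h ss z"
proof (induction ss)
  case (Cons s ss)
  show ?case unfolding pol.simps Cons by (simp add: rho_diff h vs.scale_right_diff_distrib)
qed simp

lemma pol_0: "pol h ss 0 = 0"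
  by (induction ss) (auto simp: h)

lemma pol_comm: "pol h ss (pol h ts z) = pol h ts (pol h ss z)"
  by (induction ss) (auto simp: pol_diff pol_rho pol_sc)

lemma pol_eigen: "\<rho> h v = sc c v \<Longrightarrow> pol h ss v = sc (\<Prod>s\<leftarrow>ss. c - s) v"
proof (induction ss)
  case (Cons s ss)
  let ?P = "\<Prod>s\<leftarrow>ss. c - s"
  have "pol h (s # ss) v = sc (?P * c) v - sc (s * ?P) v"
    unfolding pol.simps Cons.IH[OF Cons.prems] by (simp add: rho_sc h Cons.prems)
  also have "\<dots> = sc (?P * c - s * ?P) v" by (rule vs.scale_left_diff_distrib[symmetric])
  also have "?P * c - s * ?P = (c - s) * ?P" by (simp add: algebra_simps)
  finally show ?case by simp
qed simp

end

lemma lowered_pol: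
  assumes w: "lab w" and u: "sing w u M" and y: "lowered w u y"
  shows "\<exists>ss. (\<forall>s \<in> set ss. \<exists>k::nat. s = M (h0 w) - of_nat k) \<and> pol (h0 w) ss y = 0"
proof -
  note hh = h0_hhat[OF w] and hg = hhat_ghat[OF h0_hhat[OF w]]
  show ?thesis
    using y
  proof induction
    case lowered_base
    show ?case
      by (rule exI[of _ "[M (h0 w)]"]) (use sing_h[OF u hh] in \<open>auto intro: exI[of _ 0]\<close>)
  next
    case (lowered_add y z)
    then obtain ss ts where "\<forall>s \<in> set ss. \<exists>k::nat. s = M (h0 w) - of_nat k" "pol (h0 w) ss y = 0"
      "\<forall>s \<in> set ts. \<exists>k::nat. s = M (h0 w) - of_nat k" "pol (h0 w) ts z = 0" by blast
    then show ?case
      by (intro exI[of _ "ss @ ts"])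
         (auto simp: pol_append[OF hg] pol_add[OF hg] pol_comm[OF hg, of ss ts y] pol_0[OF hg])
  next
    case (lowered_sc y c)
    then show ?case by (metis pol_sc[OF hg] vs.scale_zero_right)
  next
    case (lowered_El y a b r)
    then obtain ss where ss: "\<forall>s \<in> set ss. \<exists>k::nat. s = M (h0 w) - of_nat k" "pol (h0 w) ss y = 0"
      by blast
    note ab = lowered_El.hyps(2,3)
    define k where "k = nat (- dg w r a b)"
    have k: "of_int (dg w r a b) = - (of_nat k :: complex)"
      using lowered_El.hyps(4) by (simp add: k_def)
    \<comment> \<open>Passing a root vector of degree \<open>- k\<close> shifts every root of the
      annihilating product by \<open>- k\<close>.\<close>
    have "pol (h0 w) (map (\<lambda>s. s - of_nat k) ts) (\<rho> (El r a b) z) = \<rho> (El r a b) (pol (h0 w) ts z)" for ts z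
      by (induction ts)
         (simp_all add: rho_h0_El[OF w ab] k rho_diff rho_sc El_ghat ab vs.scale_left_diff_distrib)
    then have "pol (h0 w) (map (\<lambda>s. s - of_nat k) ss) (\<rho> (El r a b) y) = 0"
      using ss(2) by (simp add: El_ghat ab)
    moreover have "\<exists>k'::nat. s - of_nat k = M (h0 w) - of_nat k'" if s: "s \<in> set ss" for s
    proof -
      obtain j :: nat where "s = M (h0 w) - of_nat j" using ss(1) s by blast
      then show ?thesis by (intro exI[of _ "j + k"]) simp
    qed
    ultimately show ?case
      by (intro exI[of _ "map (\<lambda>s. s - of_nat k) ss"]) auto
  qed
qed

section \<open>Locally nilpotent root vectors\<close>

definition LN :: "ghat \<Rightarrow> bool" where
  "LN x \<longleftrightarrow> (\<forall>v. \<exists>k. (\<rho> x ^^ k) v = 0)"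

lemma funpow_0: "x \<in> ghat m n \<Longrightarrow> (\<rho> x ^^ k) 0 = 0"
  by (induction k) auto

lemma funpow_add_vec: "x \<in> ghat m n \<Longrightarrow> (\<rho> x ^^ k) (u + v) = (\<rho> x ^^ k) u + (\<rho> x ^^ k) v"
  by (induction k) (auto simp: rho_add)

lemma funpow_sc: "x \<in> ghat m n \<Longrightarrow> (\<rho> x ^^ k) (sc c v) = sc c ((\<rho> x ^^ k) v)"
  by (induction k) (auto simp: rho_sc)

lemma funpow_ge: "x \<in> ghat m n \<Longrightarrow> (\<rho> x ^^ k) v = 0 \<Longrightarrow> k \<le> l \<Longrightarrow> (\<rho> x ^^ l) v = 0"
  by (metis funpow_0 funpow_add comp_apply le_add_diff_inverse2)

lemma LN_gsc: "x \<in> ghat m n \<Longrightarrow> LN x \<Longrightarrow> LN (gsc c x)"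
proof -
  assume x: "x \<in> ghat m n" "LN x"
  have "(\<rho> (gsc c x) ^^ k) v = sc (c ^ k) ((\<rho> x ^^ k) v)" for k v
    by (induction k) (simp_all add: rho_gsc rho_sc x)
  then show ?thesis using x unfolding LN_def by (metis vs.scale_zero_right)
qed

text \<open>The identity \<open>(k+1) E^k Z Y^j v = E^(k+1) Y^(j+1) v - Y E^(k+1) Y^j v\<close> shows that
  \<open>Z\<close> lowers by one the power of \<open>E\<close> annihilating all \<open>Y^j v\<close>.\<close>
lemma LN_commutator:
  assumes e: "ghom m n 0 e" and y: "ghom m n 0 y" and z: "ghom m n 0 (gbr m n e y)"
    and ez: "gbr m n e (gbr m n e y) = gzero" and yz: "gbr m n y (gbr m n e y) = gzero"
    and LN: "LN e" "LN y"
  shows "LN (gbr m n e y)"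
proof -
  define Z where "Z = gbr m n e y"
  note g = ghom_ghat[OF e] ghom_ghat[OF y] ghom_ghat[OF z, folded Z_def]
  have EY: "\<rho> e (\<rho> y u) = \<rho> y (\<rho> e u) + \<rho> Z u" for u
    using rho_swap_even[OF e y] by (simp add: Z_def)
  have EZ: "\<rho> e (\<rho> Z u) = \<rho> Z (\<rho> e u)" for u
    using rho_swap_even[OF e z] ez by (simp add: Z_def)
  have YZ: "\<rho> y (\<rho> Z u) = \<rho> Z (\<rho> y u)" for u
    using rho_swap_even[OF y z] yz by (simp add: Z_def)
  have EkZ: "(\<rho> e ^^ k) (\<rho> Z u) = \<rho> Z ((\<rho> e ^^ k) u)" for k u
    by (induction k) (simp_all add: EZ)
  have YkZ: "(\<rho> y ^^ k) (\<rho> Z u) = \<rho> Z ((\<rho> y ^^ k) u)" for k u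
    by (induction k) (simp_all add: YZ)
  have EkY: "(\<rho> e ^^ Suc k) (\<rho> y u) = \<rho> y ((\<rho> e ^^ Suc k) u) + sc (of_nat (Suc k)) ((\<rho> e ^^ k) (\<rho> Z u))" for k u
  proof (induction k)
    case 0
    show ?case by (simp add: EY)
  next
    case (Suc k)
    have "(\<rho> e ^^ Suc (Suc k)) (\<rho> y u) = \<rho> e ((\<rho> e ^^ Suc k) (\<rho> y u))" by simp
    also have "\<dots> = \<rho> e (\<rho> y ((\<rho> e ^^ Suc k) u)) + sc (of_nat (Suc k)) ((\<rho> e ^^ Suc k) (\<rho> Z u))"
      unfolding Suc by (simp add: rho_add rho_sc g)
    also have "\<rho> e (\<rho> y ((\<rho> e ^^ Suc k) u)) = \<rho> y ((\<rho> e ^^ Suc (Suc k)) u) + (\<rho> e ^^ Suc k) (\<rho> Z u)"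
      unfolding EY EkZ by simp
    finally have *: "(\<rho> e ^^ Suc (Suc k)) (\<rho> y u) = \<rho> y ((\<rho> e ^^ Suc (Suc k)) u)
        + ((\<rho> e ^^ Suc k) (\<rho> Z u) + sc (of_nat (Suc k)) ((\<rho> e ^^ Suc k) (\<rho> Z u)))"
      by (simp only: add.assoc)
    have "x + sc (of_nat (Suc k)) x = sc (of_nat (Suc (Suc k))) x" for x
      using vs.scale_left_distrib[of 1 "of_nat (Suc k)" x] by simp
    then show ?case using * by simp
  qed
  have main: "(\<forall>j. (\<rho> e ^^ k) ((\<rho> y ^^ j) v) = 0) \<Longrightarrow> (\<rho> Z ^^ k) v = 0" for k v
  proof (induction k arbitrary: v)
    case 0
    then have "(\<rho> e ^^ 0) ((\<rho> y ^^ 0) v) = 0" by blast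
    then show ?case by simp
  next
    case (Suc k)
    have "(\<rho> e ^^ k) ((\<rho> y ^^ j) (\<rho> Z v)) = 0" for j
    proof -
      have "sc (of_nat (Suc k)) ((\<rho> e ^^ k) (\<rho> Z ((\<rho> y ^^ j) v)))
          = (\<rho> e ^^ Suc k) ((\<rho> y ^^ Suc j) v) - \<rho> y ((\<rho> e ^^ Suc k) ((\<rho> y ^^ j) v))"
        using EkY[of k "(\<rho> y ^^ j) v"] by simp
      also have "\<dots> = 0" using Suc.prems g by (simp del: funpow.simps)
      finally show ?thesis by (simp add: YkZ del: of_nat_Suc)
    qed
    then have "(\<rho> Z ^^ k) (\<rho> Z v) = 0" using Suc.IH by blast
    then show ?case by (simp add: funpow_Suc_right del: funpow.simps)
  qed
  show ?thesis unfolding LN_def Z_def[symmetric]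
  proof
    fix v
    obtain b where b: "(\<rho> y ^^ b) v = 0" using LN(2) by (auto simp: LN_def)
    have "\<forall>j. \<exists>k. (\<rho> e ^^ k) ((\<rho> y ^^ j) v) = 0"
      using LN(1) unfolding LN_def by blast
    then obtain K where K: "\<And>j. (\<rho> e ^^ K j) ((\<rho> y ^^ j) v) = 0"
      using choice[of "\<lambda>j k. (\<rho> e ^^ k) ((\<rho> y ^^ j) v) = 0"] by blast
    \<comment> \<open>From the exponent \<open>b\<close> on, the powers of \<open>y\<close> kill
      \<open>v\<close>, so finitely many exponents \<open>K j\<close> compete and their maximum
      serves for every \<open>j\<close>.\<close>
    define k where "k = Max (K ` {..b})"
    have "(\<rho> e ^^ k) ((\<rho> y ^^ j) v) = 0" for j
    proof (cases "j \<le> b")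
      case True
      then have "K j \<le> k" by (auto simp: k_def)
      then show ?thesis using funpow_ge[OF g(1) K] by blast
    next
      case False
      then have "(\<rho> y ^^ j) v = 0" using funpow_ge[OF g(2) b] by simp
      then show ?thesis using funpow_0[OF g(1)] by simp
    qed
    then show "\<exists>k. (\<rho> Z ^^ k) v = 0" using main by blast
  qed
qed

lemma LN_sum:
  assumes "a < 2*m" "b < 2*m" "c < 2*m" "a \<noteq> b" "a \<noteq> pr b" "a \<noteq> c" "a \<noteq> pr c" "b \<noteq> c" "b \<noteq> pr c"
    and "LN (El r a b)" "LN (El s b c)"
  shows "LN (El (r + s) a c)"
proof -
  have N: "a < N" "b < N" "c < N" using assms by (auto simp: matdim_def)
  have par: "ipar m a = 0" "ipar m b = 0" "ipar m c = 0" using assms by (auto simp: ipar_def)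
  note br = gbr_El_sum[OF assms(1-9)]
  show ?thesis
    unfolding br(1)[symmetric, of r s]
    by (rule LN_commutator)
       (use El_ghom[OF N(1,2), of r] El_ghom[OF N(2,3), of s] El_ghom[OF N(1,3), of "r + s"] par br assms
         in simp_all)
qed

lemma LN_dual:
  assumes "a < 2*m" "b < 2*m" "LN (El r a b)"
  shows "LN (El r (pr b) (pr a))"
proof -
  have N: "a < N" "b < N" using assms by (auto simp: matdim_def)
  show ?thesis unfolding El_dual[OF N] by (intro LN_gsc El_ghat N assms)
qed

text \<open>The vector \<open>El (- s) b a\<close> is ad-nilpotent: its coroot has eigenvalues
  between -2 and 2 on the algebra and eigenvalue -2 on the vector itself, so three brackets kill
  everything. Hence the vectors killed by some power of it are stable under the algebra.\<close>

lemma LN_orbit: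
  assumes f: "ghom m n 0 (El (- s) b a)" and ab: "a < 2*m" "b < 2*m" "a \<noteq> b" "a \<noteq> pr b"
    and x: "x \<in> ghat m n" and u: "\<exists>k. (\<rho> (El (- s) b a) ^^ k) u = 0"
  shows "\<exists>k. (\<rho> (El (- s) b a) ^^ k) (\<rho> x u) = 0"
proof -
  let ?f = "El (- s) b a"
  have N: "a < N" "b < N" using ab by (auto simp: matdim_def)
  note fg = ghom_ghat[OF f]
  define w where "w i = (if i = a \<or> i = pr b then 1 else if i = b \<or> i = pr a then - 1 else (0::int))" for i
  have ne: "b \<noteq> pr a" "pr a \<noteq> pr b" "pr a \<noteq> b" using ab N by (auto simp: pr_inj pr_swap)
  have wp: "w (pr a) = - w a" "w (pr b) = - w b" "w a = 1" "w b = -1"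
    using ne ab N by (auto simp: w_def)
  have fs: "gsup w 0 {-2} ?f" using N wp by (intro El_gsup) auto
  have step: "\<exists>k. (\<rho> ?f ^^ k) (\<rho> x u) = 0"
    if T: "\<And>x u. x \<in> ghat m n \<Longrightarrow> gsup w 0 {..l - 2} x \<Longrightarrow> \<exists>k. (\<rho> ?f ^^ k) u = 0
         \<Longrightarrow> \<exists>k. (\<rho> ?f ^^ k) (\<rho> x u) = 0"
      and x: "x \<in> ghat m n" "gsup w 0 {..l} x" and u: "\<exists>k. (\<rho> ?f ^^ k) u = 0" for l x u
  proof -
    have hom: "\<exists>j. (\<rho> ?f ^^ j) (\<rho> x u) = 0" if x: "ghom m n p x" "gsup w 0 {..l} x" and "(\<rho> ?f ^^ k) u = 0" for k p x u
      using that(3)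
    proof (induction k arbitrary: u)
      case 0
      then show ?case using ghom_ghat[OF x(1)] by (intro exI[of _ 0]) simp
    next
      case (Suc k)
      have "(\<rho> ?f ^^ k) (\<rho> ?f u) = 0" using Suc.prems by (simp add: funpow_Suc_right del: funpow.simps)
      then obtain j1 where j1: "(\<rho> ?f ^^ j1) (\<rho> x (\<rho> ?f u)) = 0" using Suc.IH by blast
      have "gsup w 0 {..l - 2} (gbr m n x ?f)" by (rule gsup_gbr[OF x(2) fs]) auto
      then obtain j2 where j2: "(\<rho> ?f ^^ j2) (\<rho> (gbr m n x ?f) u) = 0"
        using T ghat_gbr[OF ghom_ghat[OF x(1)] fg] Suc.prems by blast
      have "(\<rho> ?f ^^ (j1 + j2)) (\<rho> ?f (\<rho> x u) + \<rho> (gbr m n x ?f) u) = 0"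
        using rho_swap_even[OF x(1) f, of u] funpow_ge[OF fg j1, of "j1 + j2"] by simp
      then have "(\<rho> ?f ^^ (j1 + j2)) (\<rho> ?f (\<rho> x u)) = 0"
        using funpow_ge[OF fg j2, of "j1 + j2"] by (simp add: funpow_add_vec fg)
      then have "(\<rho> ?f ^^ Suc (j1 + j2)) (\<rho> x u) = 0" by (simp add: funpow_Suc_right del: funpow.simps)
      then show ?case by blast
    qed
    obtain k where k: "(\<rho> ?f ^^ k) u = 0" using u by blast
    obtain j1 where j1: "(\<rho> ?f ^^ j1) (\<rho> (gev m x) u) = 0"
      using hom[OF ghom_gev[OF x(1)] gsup_gev[OF x(2)] k] by blast
    obtain j2 where j2: "(\<rho> ?f ^^ j2) (\<rho> (god m x) u) = 0"
      using hom[OF ghom_god[OF x(1)] gsup_god[OF x(2)] k] by blast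
    have "(\<rho> ?f ^^ (j1 + j2)) (\<rho> x u) = 0"
      unfolding rho_split[OF x(1)] funpow_add_vec[OF fg]
      using funpow_ge[OF fg j1, of "j1 + j2"] funpow_ge[OF fg j2, of "j1 + j2"] by simp
    then show ?thesis by blast
  qed
  have wb: "- 1 \<le> w i \<and> w i \<le> 1" for i by (simp add: w_def)
  have dgb: "- 2 \<le> w i - w j \<and> w i - w j \<le> 2" for i j using wb[of i] wb[of j] by linarith
  have m4: "\<exists>k. (\<rho> ?f ^^ k) (\<rho> x u) = 0" if "gsup w 0 {..-4} x" for x u
  proof -
    have "lpart x q i j = 0" for q i j
      using gsupD[OF that, of q i j] dgb[of i j] by fastforce
    then have "x = gzero" using that by (intro ghat_eqI) (auto simp: gsup_def)
    then show ?thesis by (intro exI[of _ 0]) simp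
  qed
  have m2: "\<exists>k. (\<rho> ?f ^^ k) (\<rho> x u) = 0"
    if "x \<in> ghat m n" "gsup w 0 {..-2} x" "\<exists>k. (\<rho> ?f ^^ k) u = 0" for x u
    by (rule step[OF _ that]) (use m4 in simp)
  have m0: "\<exists>k. (\<rho> ?f ^^ k) (\<rho> x u) = 0"
    if "x \<in> ghat m n" "gsup w 0 {..0} x" "\<exists>k. (\<rho> ?f ^^ k) u = 0" for x u
    by (rule step[OF _ that]) (use m2 in simp)
  have "gsup w 0 {..2} x" using dgb by (auto simp: gsup_def)
  then show ?thesis using m0 by (intro step[OF _ x _ u, of 2]) simp_all
qed

end

section \<open>Odd reflections and rank-one integrability\<close>

locale osp_irrep = osp_rep m n sc \<rho>
  for m n :: nat and sc :: "complex \<Rightarrow> 'v::ab_group_add \<Rightarrow> 'v" and \<rho> :: "ghat \<Rightarrow> 'v \<Rightarrow> 'v" +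
  assumes irreducible: "\<And>W. 0 \<in> W \<Longrightarrow> (\<And>u w. u \<in> W \<Longrightarrow> w \<in> W \<Longrightarrow> u + w \<in> W)
     \<Longrightarrow> (\<And>c u. u \<in> W \<Longrightarrow> sc c u \<in> W) \<Longrightarrow> (\<And>x u. x \<in> ghat m n \<Longrightarrow> u \<in> W \<Longrightarrow> \<rho> x u \<in> W)
     \<Longrightarrow> W = {0} \<or> W = UNIV"
begin

lemma sing_generates:
  assumes "lab w" "sing w u M" "u \<noteq> 0"
  shows "lowered w u y"
proof -
  have "{y. lowered w u y} = {0} \<or> {y. lowered w u y} = UNIV"
    using lowered_stable[OF assms(1,2)]
    by (intro irreducible) (auto simp: lowered_0 lowered.intros)
  moreover have "u \<in> {y. lowered w u y}" by (simp add: lowered_base)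
  ultimately show ?thesis using assms(3) by blast
qed

text \<open>The vector \<open>v\<close> is obtained from \<open>u\<close> by lowering, so a product
  of factors with roots \<open>M (h0 w) - k\<close> annihilates it. On an eigenvector this product
  is a scalar, and one factor must vanish. Used in both directions, this fixes the degree.\<close>

lemma sing_le:
  assumes w: "lab w" and u: "sing w u M" "u \<noteq> 0" and v: "sing w v \<Phi>" "v \<noteq> 0"
  shows "\<exists>k::nat. \<Phi> (h0 w) = M (h0 w) - of_nat k"
proof -
  note hg = hhat_ghat[OF h0_hhat[OF w]]
  obtain ss where ss: "\<forall>s \<in> set ss. \<exists>k::nat. s = M (h0 w) - of_nat k" "pol (h0 w) ss v = 0"
    using lowered_pol[OF w u(1) sing_generates[OF w u]] by blast
  have "sc (\<Prod>s\<leftarrow>ss. \<Phi> (h0 w) - s) v = 0"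
    using pol_eigen[OF hg sing_h[OF v(1) h0_hhat[OF w]]] ss(2) by simp
  then have "(\<Prod>s\<leftarrow>ss. \<Phi> (h0 w) - s) = 0" using v(2) by simp
  then have "\<Phi> (h0 w) \<in> set ss" by (auto simp: prod_list_zero_iff)
  then show ?thesis using ss(1) by blast
qed

lemma sing_unique:
  assumes w: "lab w" and u: "sing w u M" "u \<noteq> 0" and v: "sing w v \<Phi>" "v \<noteq> 0"
  shows "\<Phi> (h0 w) = M (h0 w)"
proof -
  obtain k l :: nat where "\<Phi> (h0 w) = M (h0 w) - of_nat k" "M (h0 w) = \<Phi> (h0 w) - of_nat l"
    using sing_le[OF w u v] sing_le[OF w v u] by blast
  then have "of_nat (k + l) = (0 :: complex)" by (simp add: algebra_simps)
  then have "k = 0" by (simp only: of_nat_eq_0_iff)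
  then show ?thesis using \<open>\<Phi> (h0 w) = M (h0 w) - of_nat k\<close> by simp
qed

lemma LN_of_vector:
  assumes f: "ghom m n 0 (El (- s) b a)" and ab: "a < 2*m" "b < 2*m" "a \<noteq> b" "a \<noteq> pr b"
    and v: "v \<noteq> 0" "(\<rho> (El (- s) b a) ^^ k) v = 0"
  shows "LN (El (- s) b a)"
proof -
  let ?f = "El (- s) b a"
  let ?W = "{u. \<exists>k. (\<rho> ?f ^^ k) u = 0}"
  note fg = ghom_ghat[OF f]
  have "?W = {0} \<or> ?W = UNIV"
  proof (rule irreducible)
    show "0 \<in> ?W" using funpow_0[OF fg] by simp
  next
    fix u w assume "u \<in> ?W" "w \<in> ?W"
    then obtain k l where "(\<rho> ?f ^^ k) u = 0" "(\<rho> ?f ^^ l) w = 0" by blast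
    then have "(\<rho> ?f ^^ (k + l)) (u + w) = 0"
      using funpow_ge[OF fg, of k u "k + l"] funpow_ge[OF fg, of l w "k + l"]
      by (simp add: funpow_add_vec fg)
    then show "u + w \<in> ?W" by blast
  next
    fix c u assume "u \<in> ?W"
    then obtain k where "(\<rho> ?f ^^ k) u = 0" by blast
    then have "(\<rho> ?f ^^ k) (sc c u) = 0" by (simp add: funpow_sc fg)
    then show "sc c u \<in> ?W" by blast
  next
    fix x u assume "x \<in> ghat m n" "u \<in> ?W"
    then show "\<rho> x u \<in> ?W" using LN_orbit[OF f ab] by simp
  qed
  moreover have "v \<in> ?W" using v by blast
  ultimately have "?W = UNIV" using v(1) by blast
  then show ?thesis by (auto simp: LN_def)
qed

lemma sing_El_weight:
  assumes "sing w v \<Phi>" "h \<in> hhat m n" "a < N" "b < N"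
  shows "\<rho> h (\<rho> (El r a b) v) = sc (\<Phi> h + (hval h a - hval h b + cd h * of_int r)) (\<rho> (El r a b) v)"
  using rho_h_El[OF assms(2-4), of r v] sing_h[OF assms(1,2)]
  by (simp add: rho_sc El_ghat assms vs.scale_left_distrib)

text \<open>With e and f the two root vectors, the relations are e f v = \<kappa> v and f f v = 0,
  together with stability of the nilradical under f. For \<kappa> = 0 the vector f v would be
  singular for the old label one degree below \<open>v\<close>, so it is zero and \<open>v\<close>
  itself passes to the new label. For \<kappa> \<noteq> 0 the first relation shows that f v is
  nonzero.\<close>

lemma odd_reflection:
  assumes w: "lab w" and ab: "2*m \<le> a" "a < N" "b < 2*m" and bm: "b \<noteq> m - 1" "b \<noteq> pr (m - 1)"
    and d: "w a = w b + 1" and v: "sing w v \<Phi>" "v \<noteq> 0"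
  defines "\<kappa> \<equiv> \<Phi> (gbr m n (El 0 a b) (El 0 b a))"
  shows "\<kappa> = 0 \<Longrightarrow> sing (w \<circ> tau a b) v \<Phi>"
    and "\<kappa> \<noteq> 0 \<Longrightarrow> \<rho> (El 0 b a) v \<noteq> 0"
    and "\<kappa> \<noteq> 0 \<Longrightarrow> sing (w \<circ> tau a b) (\<rho> (El 0 b a) v) (\<lambda>h. \<Phi> h - (hval h a - hval h b))"
proof -
  have b: "b < N" using ab by simp
  note ne = odd_even_neq[OF ab]
  have par: "ipar m a = 1" "ipar m b = 0" using ab by (auto simp: ipar_def)
  let ?e = "El 0 a b" and ?f = "El 0 b a"
  have eh: "ghom m n 1 ?e" using El_ghom[OF ab(2) b, of 0] par by simp
  have fh: "ghom m n 1 ?f" using El_ghom[OF b ab(2), of 0] par by simp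
  note eg = ghom_ghat[OF eh] and fg = ghom_ghat[OF fh]
  have dg1: "dg w 0 a b = 1" using d by (simp add: dg_def)
  have Psing: "\<rho> x v = 0" if "Psup w 0 a b x" for x
    using that sing_pos[OF v(1)] by (auto simp: Psup_def)
  have Pf_hom: "\<rho> x (\<rho> ?f v) = 0" if P: "Psup w 0 a b x" and x: "ghom m n p x" for x p
  proof -
    obtain \<epsilon> where e: "\<And>u. \<rho> x (\<rho> ?f u) = sc \<epsilon> (\<rho> ?f (\<rho> x u)) + \<rho> (gbr m n x ?f) u"
      using rho_swap[OF x fh] by blast
    have "Psup w 0 a b (gbr m n x ?f)"
      using Psup_gbr[OF w ab(2) b ne(1,2) dg1 P] by simp
    then show ?thesis unfolding e using Psing[OF P] Psing fg by simp
  qed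
  have Pf: "\<rho> x (\<rho> ?f v) = 0" if P: "Psup w 0 a b x" for x
  proof -
    have x: "x \<in> ghat m n" using P by (simp add: Psup_def)
    show ?thesis
      unfolding rho_split[OF x]
      using Pf_hom[OF Psup_gev[OF P] ghom_gev[OF x]] Pf_hom[OF Psup_god[OF P] ghom_god[OF x]] by simp
  qed
  have hh: "gbr m n ?e ?f \<in> hhat m n"
    unfolding gbr_El_odd[OF ab] by (rule hx_hhat) (use b ab in \<open>auto simp: pr_inj pr_swap\<close>)
  have "posi w ?e" using dg1 by (intro El_gsup_lab w ab b) simp
  then have ev: "\<rho> ?e v = 0" by (rule sing_pos[OF v(1) eg])
  have efv: "\<rho> ?e (\<rho> ?f v) = sc \<kappa> v"
    using rho_gbr[OF eh fh, of v] ev fg sing_h[OF v(1) hh] by (simp add: \<kappa>_def)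
  have ffv: "\<rho> ?f (\<rho> ?f v) = 0"
  proof -
    have "\<rho> ?f (\<rho> ?f v) + \<rho> ?f (\<rho> ?f v) = 0"
      using rho_gbr[OF fh fh, of v] gbr_El_self_odd[OF ab, of 0] by simp
    then have "sc 2 (\<rho> ?f (\<rho> ?f v)) = 0"
      using vs.scale_left_distrib[of 1 1 "\<rho> ?f (\<rho> ?f v)"] by simp
    then show ?thesis by simp
  qed
  have hf: "\<rho> h (\<rho> ?f v) = sc (\<Phi> h - (hval h a - hval h b)) (\<rho> ?f v)" if "h \<in> hhat m n" for h
    using sing_El_weight[OF v(1) that b ab(2), of 0] by (simp add: algebra_simps)
  have tau: "sing (w \<circ> tau a b) u M"
    if "\<forall>h \<in> hhat m n. \<rho> h u = sc (M h) u" "\<rho> ?f u = 0" "\<And>x. Psup w 0 a b x \<Longrightarrow> \<rho> x u = 0" for u M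
    unfolding sing_def
  proof (intro conjI ballI impI)
    fix x assume x: "x \<in> ghat m n" "posi (w \<circ> tau a b) x"
    obtain c x' where x': "x = gadd (gsc c ?f) x'" "Psup w 0 a b x'"
      by (rule posi_tau[OF w ab bm d x])
    then show "\<rho> x u = 0" using that(2,3) fg
      by (simp add: rho_gadd rho_gsc ghat_sc Psup_def)
  qed (use that in blast)
  show "sing (w \<circ> tau a b) v \<Phi>" if "\<kappa> = 0"
  proof (rule tau)
    show "\<rho> ?f v = 0"
    proof (rule ccontr)
      assume fv: "\<rho> ?f v \<noteq> 0"
      have "sing w (\<rho> ?f v) (\<lambda>h. \<Phi> h - (hval h a - hval h b))"
        unfolding sing_def
      proof (intro conjI ballI impI)
        fix x assume x: "x \<in> ghat m n" "posi w x"
        have "dg w 0 a b > 0" using dg1 by simp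
        then obtain c x' where x': "x = gadd (gsc c ?e) x'" "Psup w 0 a b x'"
          by (rule posi_decomp[OF w ab(2) b ne(2) _ x])
        then show "\<rho> x (\<rho> ?f v) = 0" using Pf efv that eg
          by (simp add: rho_gadd rho_gsc ghat_sc Psup_def)
      qed (use hf in blast)
      from sing_unique[OF w v this fv] show False
        using d ab b by (simp add: h0_sel)
    qed
  qed (use Psing sing_h[OF v(1)] in auto)
  show "\<rho> ?f v \<noteq> 0" if "\<kappa> \<noteq> 0"
    using efv that v(2) eg by auto
  show "sing (w \<circ> tau a b) (\<rho> ?f v) (\<lambda>h. \<Phi> h - (hval h a - hval h b))" if "\<kappa> \<noteq> 0"
    by (rule tau) (use hf ffv Pf in auto)
qed

text \<open>The string of vectors \<open>F j\<close> can only break off after a nonzero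
  \<open>F j\<close> with \<kappa> = j, by the formula for the raising operator. Conversely, at
  \<kappa> = j the vector \<open>F (Suc j)\<close> is singular of lower degree, hence zero, and by
  irreducibility one terminating string forces local nilpotency everywhere.\<close>

lemma LN_iff_nat:
  assumes w: "lab w" and ab: "a < 2*m" "b < 2*m" "a \<noteq> b" "a \<noteq> pr b"
    and d: "dg w s a b = 1" and v: "sing w v \<Phi>" "v \<noteq> 0"
  shows "LN (El (- s) b a) \<longleftrightarrow> \<Phi> (gbr m n (El s a b) (El (- s) b a)) \<in> \<nat>"
proof -
  let ?e = "El s a b" and ?f = "El (- s) b a"
  define \<kappa> where "\<kappa> = \<Phi> (gbr m n ?e ?f)"
  have N: "a < N" "b < N" using ab by (auto simp: matdim_def)
  have par: "ipar m a = 0" "ipar m b = 0" using ab by (auto simp: ipar_def)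
  have eh: "ghom m n 0 ?e" using El_ghom[OF N, of s] par by simp
  have fh: "ghom m n 0 ?f" using El_ghom[OF N(2,1), of "- s"] par by simp
  note eg = ghom_ghat[OF eh] and fg = ghom_ghat[OF fh]
  define F where "F j = (\<rho> ?f ^^ j) v" for j
  have F0: "F 0 = v" and FS: "F (Suc j) = \<rho> ?f (F j)" for j by (simp_all add: F_def)
  have PF: "Psup w s a b x \<Longrightarrow> \<rho> x (F j) = 0" for x j
  proof (induction j arbitrary: x)
    case 0
    then show ?case using sing_pos[OF v(1)] by (simp add: Psup_def F0)
  next
    case (Suc j)
    have hom: "\<rho> y (F (Suc j)) = 0" if P: "Psup w s a b y" and y: "ghom m n p y" for y p
      using rho_swap_even[OF y fh, of "F j"] Suc.IH[OF P] Suc.IH[OF Psup_gbr[OF w N ab(3,4) d P]] fg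
      by (simp add: FS)
    have x: "x \<in> ghat m n" using Suc.prems by (simp add: Psup_def)
    show ?case
      unfolding rho_split[OF x]
      using hom[OF Psup_gev[OF Suc.prems] ghom_gev[OF x]] hom[OF Psup_god[OF Suc.prems] ghom_god[OF x]]
      by simp
  qed
  define \<alpha> where "\<alpha> h = hval h a - hval h b + cd h * of_int s" for h
  have hF: "\<rho> h (F j) = sc (\<Phi> h - of_nat j * \<alpha> h) (F j)" if h: "h \<in> hhat m n" for h j
  proof (induction j)
    case 0
    show ?case using sing_h[OF v(1) h] by (simp add: F0)
  next
    case (Suc j)
    have "\<rho> h (F (Suc j)) = sc (\<Phi> h - of_nat j * \<alpha> h) (F (Suc j)) - sc (\<alpha> h) (F (Suc j))"
    proof -
      have neg: "hval h b - hval h a + cd h * of_int (- s) = - \<alpha> h" by (simp add: \<alpha>_def)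
      show ?thesis unfolding FS rho_h_El[OF h N(2,1)] Suc neg by (simp add: rho_sc fg)
    qed
    also have "\<dots> = sc (\<Phi> h - of_nat j * \<alpha> h - \<alpha> h) (F (Suc j))"
      by (rule vs.scale_left_diff_distrib[symmetric])
    finally show ?case by (simp add: algebra_simps)
  qed
  have ne: "b \<noteq> pr a" "pr a \<noteq> pr b" using ab N by (auto simp: pr_inj pr_swap)
  define h where "h = gbr m n ?e ?f"
  have hh: "h \<in> hhat m n"
    unfolding h_def gbr_El_even[OF ab] by (rule hx_hhat) (use N in \<open>auto simp: pr_inj pr_swap\<close>)
  have \<alpha>h: "\<alpha> h = 2"
    unfolding h_def \<alpha>_def gbr_El_even[OF ab] using ab N ne by simp
  have "posi w ?e" using d by (intro El_gsup_lab w N) simp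
  then have ev: "\<rho> ?e v = 0" by (rule sing_pos[OF v(1) eg])
  have eF: "\<rho> ?e (F (Suc j)) = sc (of_nat (Suc j) * (\<kappa> - of_nat j)) (F j)" for j
  proof (induction j)
    case 0
    show ?case using rho_swap_even[OF eh fh, of v] ev fg sing_h[OF v(1) hh] by (simp add: FS F0 \<kappa>_def h_def)
  next
    case (Suc j)
    have "\<rho> ?e (F (Suc (Suc j))) = \<rho> ?f (\<rho> ?e (F (Suc j))) + \<rho> h (F (Suc j))"
      using rho_swap_even[OF eh fh, of "F (Suc j)"] by (simp add: FS h_def)
    also have "\<dots> = sc (of_nat (Suc j) * (\<kappa> - of_nat j)) (F (Suc j)) + sc (\<kappa> - of_nat (Suc j) * 2) (F (Suc j))"
      unfolding Suc hF[OF hh] \<alpha>h by (simp add: rho_sc fg FS \<kappa>_def h_def)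
    also have "\<dots> = sc (of_nat (Suc j) * (\<kappa> - of_nat j) + (\<kappa> - of_nat (Suc j) * 2)) (F (Suc j))"
      by (rule vs.scale_left_distrib[symmetric])
    also have "of_nat (Suc j) * (\<kappa> - of_nat j) + (\<kappa> - of_nat (Suc j) * 2) = of_nat (Suc (Suc j)) * (\<kappa> - of_nat (Suc j))"
      by (simp add: algebra_simps)
    finally show ?case .
  qed
  show ?thesis unfolding \<kappa>_def[symmetric]
  proof
    assume "LN ?f"
    then obtain k0 where "F k0 = 0" by (auto simp: LN_def F_def)
    then obtain k where k: "F k = 0" "\<And>i. i < k \<Longrightarrow> F i \<noteq> 0"
      using LeastI[of "\<lambda>k. F k = 0"] not_less_Least[of _ "\<lambda>k. F k = 0"] that by blast
    have "k \<noteq> 0"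
    proof
      assume "k = 0"
      then show False using k(1) F0 v(2) by simp
    qed
    then obtain j where j: "k = Suc j" by (cases k) auto
    have "sc (of_nat (Suc j) * (\<kappa> - of_nat j)) (F j) = 0"
      using eF[of j] k(1) j eg by simp
    moreover have "F j \<noteq> 0" using k(2) j by simp
    ultimately have "of_nat (Suc j) * (\<kappa> - of_nat j) = 0" by simp
    then have "\<kappa> = of_nat j" by (simp del: of_nat_Suc)
    then show "\<kappa> \<in> \<nat>" by simp
  next
    assume "\<kappa> \<in> \<nat>"
    then obtain j where j: "\<kappa> = of_nat j" by (auto elim: Nats_cases)
    have "F (Suc j) = 0"
    proof (rule ccontr)
      assume nz: "F (Suc j) \<noteq> 0"
      have "sing w (F (Suc j)) (\<lambda>h. \<Phi> h - of_nat (Suc j) * \<alpha> h)"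
        unfolding sing_def
      proof (intro conjI ballI impI)
        fix x assume x: "x \<in> ghat m n" "posi w x"
        have "dg w s a b > 0" using d by simp
        then obtain c x' where x': "x = gadd (gsc c ?e) x'" "Psup w s a b x'"
          by (rule posi_decomp[OF w N ab(4) _ x])
        then show "\<rho> x (F (Suc j)) = 0" using PF eF[of j] j eg
          by (simp add: rho_gadd rho_gsc ghat_sc Psup_def)
      qed (use hF in blast)
      from sing_unique[OF w v this nz] have "\<alpha> (h0 w) = 0"
        by (simp del: of_nat_Suc)
      moreover have "\<alpha> (h0 w) = of_int (dg w s a b)" using N by (simp add: \<alpha>_def h0_sel dg_def)
      ultimately show False using d by simp
    qed
    then show "LN ?f" unfolding F_def by (rule LN_of_vector[OF fh ab v(2)])
  qed
qed

end

section \<open>The positive root cone\<close>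

context osp_setting
begin

text \<open>The order \<open>\<epsilon>\<^sub>m > \<dots> > \<epsilon>\<^sub>n\<^sub>+\<^sub>1 > \<delta>\<^sub>n > \<epsilon>\<^sub>n > \<dots> > \<delta>\<^sub>1 > \<bar>\<epsilon>\<^sub>1\<bar>\<close> of the given base. As \<open>\<epsilon>\<^sub>1\<close> itself is
  not a root, both signs \<open>s\<close> of its label describe the same positive roots; the sign is chosen so
  that \<open>\<delta>\<^sub>1 - s\<epsilon>\<^sub>1\<close> has degree 1.\<close>
definition w0 :: "int \<Rightarrow> nat \<Rightarrow> int" where
  "w0 s i = (let e = (\<lambda>i. if i = 0 then s else if i < n then 2 * int i + 1 else int n + int i + 1) in
     if i < m then e i else if i < 2*m then - e (i - m)
     else if i < 2*m + n then 2 * int (i - 2*m) + 2 else - (2 * int (i - 2*m - n) + 2))"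

text \<open>Indices of weight +\<epsilon>_i or +\<delta>_j. All other indices are mirrors of these,
  so labels have to be inspected only here.\<close>

definition pos_half :: "nat set" where
  "pos_half = {..<m} \<union> {2*m..<2*m+n}"

lemma pos_half_less: "a \<in> pos_half \<Longrightarrow> a < N"
  by (auto simp: pos_half_def matdim_def)

lemma pos_half_elim: "a \<in> pos_half \<Longrightarrow> a < m \<or> (\<exists>j<n. a = 2*m + j)"
  by (auto simp: pos_half_def intro!: exI[of _ "a - 2*m"])

lemma pos_half_cases:
  assumes "a < N"
  obtains "a \<in> pos_half" | a' where "a' \<in> pos_half" "a = pr a'"
proof (cases "a \<in> pos_half")
  case False
  then have "pr a \<in> pos_half" using assms by (auto simp: pos_half_def pr_def matdim_def)
  then show ?thesis using that(2)[of "pr a"] assms by simp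
qed (use that in blast)

lemma w0_pr:
  assumes "i < N"
  shows "w0 s (pr i) = - w0 s i"
proof -
  have P: "w0 s (pr a) = - w0 s a" if "a \<in> pos_half" for a
    using that by (auto simp: pos_half_def w0_def pr_def Let_def)
  show ?thesis using assms
    by (cases rule: pos_half_cases) (use P pos_half_less in auto)
qed

lemma w0_eps: "i < m \<Longrightarrow> w0 s i = (if i = 0 then s else if i < n then 2 * int i + 1 else int n + int i + 1)"
  by (simp add: w0_def Let_def)

lemma w0_del: "j < n \<Longrightarrow> w0 s (2*m + j) = 2 * int j + 2"
  by (simp add: w0_def Let_def)

lemma w0_lower:
  assumes "a \<in> pos_half" "a \<noteq> 0"
  shows "2 \<le> w0 s a \<and> w0 s a \<le> int m + int n"
  using assms m_gt n_ge by (auto simp: pos_half_def w0_def Let_def)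

lemma w0_zero: "w0 s 0 = s"
  using m_gt by (simp add: w0_def Let_def)

lemma w0_s: "a \<noteq> 0 \<Longrightarrow> a \<in> pos_half \<Longrightarrow> w0 s a = w0 1 a"
  by (auto simp: pos_half_def w0_def Let_def)

lemma w0_inj_half:
  assumes "a \<in> pos_half" "b \<in> pos_half" "a \<noteq> 0" "b \<noteq> 0" "w0 s a = w0 s b"
  shows "a = b"
proof -
  \<comment> \<open>Recovers the index from its label: above 2n lie \<epsilon>_(n+1) to
    \<epsilon>_m, while up to 2n the odd labels belong to some \<epsilon>_i and the even ones to
    some \<delta>_j.\<close>
  define dec where "dec u = (if u > 2 * int n then nat (u - int n - 1)
     else if odd u then nat ((u - 1) div 2) else 2*m + nat (u div 2 - 1))" for u
  have *: "dec (w0 s a) = a" if "a \<in> pos_half" "a \<noteq> 0" for a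
  proof (cases "a < m")
    case True
    then show ?thesis using that(2) by (cases "a < n") (simp_all add: w0_eps dec_def)
  next
    case False
    then obtain j where "a = 2*m + j" "j < n" using pos_half_elim[OF \<open>a \<in> pos_half\<close>] by blast
    then show ?thesis by (simp add: w0_del dec_def)
  qed
  show ?thesis using *[OF assms(1,3)] *[OF assms(2,4)] unfolding assms(5) by (rule trans[OF sym])
qed

lemma w0_lab:
  assumes s: "s = 1 \<or> s = -1"
  shows "lab (w0 s)"
proof -
  have bnd: "\<bar>w0 s i\<bar> \<le> int m + int n" if i: "i < N" for i
  proof -
    have P: "\<bar>w0 s a\<bar> \<le> int m + int n" if "a \<in> pos_half" for a
      using w0_lower[OF that, of s] s m_gt by (cases "a = 0") (auto simp: w0_zero)
    show ?thesis using i
      by (cases rule: pos_half_cases) (use P w0_pr pos_half_less in auto)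
  qed
  have inj: "a = b" if "a \<in> pos_half" "b < N" "w0 s a = w0 s b" for a b
    using that(2)
  proof (cases rule: pos_half_cases)
    case 1
    show ?thesis
      using w0_inj_half[OF that(1) 1] that(3) w0_lower[OF that(1), of s] w0_lower[OF 1, of s] s
      by (cases "a = 0"; cases "b = 0") (auto simp: w0_zero)
  next
    case (2 b')
    then have "w0 s a = - w0 s b'" using that(3) w0_pr pos_half_less by auto
    then have False
      using w0_lower[OF that(1), of s] w0_lower[OF 2(1), of s] s
      by (cases "a = 0"; cases "b' = 0") (auto simp: w0_zero)
    then show ?thesis ..
  qed
  have "inj_on (w0 s) {..<N}"
  proof (rule inj_onI)
    fix a b assume ab: "a \<in> {..<N}" "b \<in> {..<N}" "w0 s a = w0 s b"
    then have "a < N" by simp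
    then show "a = b"
    proof (cases rule: pos_half_cases)
      case 1
      then show ?thesis using inj ab by simp
    next
      case (2 a')
      then have "w0 s a' = w0 s (pr b)" using ab w0_pr[of a' s] w0_pr[of b s] pos_half_less[of a'] by simp
      then have "a' = pr b" using inj 2 ab by simp
      then show ?thesis using 2 ab by simp
    qed
  qed
  moreover have "w0 s (m - 1) = int m + int n"
    using m_gt by (simp add: w0_eps of_nat_diff)
  ultimately show ?thesis using bnd w0_pr by (simp add: lab_def)
qed

section \<open>Weights as functions, and generation of positive roots by simple ones\<close>

lemma hw_ev_add: "hw_ev m n (hw_add \<mu> \<nu>) h = hw_ev m n \<mu> h + hw_ev m n \<nu> h"
  by (simp add: hw_ev_def hw_add_def split_beta sum.distrib algebra_simps)

lemma hw_ev_sc: "hw_ev m n (hw_sc c \<mu>) h = c * hw_ev m n \<mu> h"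
  by (simp add: hw_ev_def hw_sc_def split_beta sum_distrib_left algebra_simps)

lemma hw_ev_sub: "hw_ev m n (hw_sub \<mu> \<nu>) h = hw_ev m n \<mu> h - hw_ev m n \<nu> h"
  by (simp add: hw_sub_def hw_ev_add hw_ev_sc)

lemma hw_ev_zero: "hw_ev m n hw_zero h = 0"
  by (simp add: hw_ev_def hw_zero_def split_beta)

lemma hw_ev_deltaw: "hw_ev m n deltaw h = cd h"
  by (simp add: hw_ev_def deltaw_def hw_zero_def split_beta)

lemma hw_ev_Lam0w: "hw_ev m n Lam0w h = cK h"
  by (simp add: hw_ev_def Lam0w_def hw_zero_def split_beta)

lemma sum_unit: "(\<Sum>i\<in>A. (if i = k then 1 else 0) * (f i :: complex)) = (if k \<in> A then f k else 0)" if "finite A"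
proof -
  have "(\<Sum>i\<in>A. (if i = k then 1 else 0) * f i) = (\<Sum>i\<in>A. if i = k then f k else 0)"
    by (rule sum.cong) auto
  then show ?thesis using that by simp
qed

lemma hw_ev_epsw: "1 \<le> i \<Longrightarrow> i \<le> m \<Longrightarrow> hw_ev m n (epsw i) h = hval h (i - 1)"
  by (simp add: hw_ev_def epsw_def hw_zero_def split_beta sum_unit)

lemma hw_ev_delw: "1 \<le> j \<Longrightarrow> j \<le> n \<Longrightarrow> hw_ev m n (delw j) h = hval h (2*m + j - 1)"
  by (simp add: hw_ev_def delw_def hw_zero_def split_beta sum_unit)

text \<open>Membership in the positive root cone, for weights given as functions on the Cartan
  subalgebra.\<close>
definition QP :: "(ghat \<Rightarrow> complex) \<Rightarrow> bool" where
  "QP g \<longleftrightarrow> (\<exists>c :: hw \<Rightarrow> nat. \<forall>h \<in> hhat m n.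
      g h = (\<Sum>\<alpha>\<in>sroots m n. of_nat (c \<alpha>) * hw_ev m n \<alpha> h))"

lemma qplus_iff: "\<gamma> \<in> qplus m n \<longleftrightarrow> QP (hw_ev m n \<gamma>)"
  by (simp add: qplus_def QP_def)

lemma QP_cong: "QP g \<Longrightarrow> (\<And>h. h \<in> hhat m n \<Longrightarrow> g' h = g h) \<Longrightarrow> QP g'"
  by (simp add: QP_def)

lemma QP_zero: "QP (\<lambda>h. 0)"
  unfolding QP_def by (rule exI[of _ "\<lambda>_. 0"]) simp

lemma QP_add: "QP f \<Longrightarrow> QP g \<Longrightarrow> QP (\<lambda>h. f h + g h)"
proof -
  assume "QP f" "QP g"
  then obtain c d :: "hw \<Rightarrow> nat" where
    "\<forall>h \<in> hhat m n. f h = (\<Sum>\<alpha>\<in>sroots m n. of_nat (c \<alpha>) * hw_ev m n \<alpha> h)"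
    "\<forall>h \<in> hhat m n. g h = (\<Sum>\<alpha>\<in>sroots m n. of_nat (d \<alpha>) * hw_ev m n \<alpha> h)"
    by (auto simp: QP_def)
  then show ?thesis unfolding QP_def
    by (intro exI[of _ "\<lambda>\<alpha>. c \<alpha> + d \<alpha>"]) (simp add: sum.distrib distrib_right)
qed

lemma finite_sroots: "finite (sroots m n)"
proof -
  have "finite {hw_sub (epsw (i + 1)) (epsw i) | i. n + 1 \<le> i \<and> i \<le> m - 1}"
    by (rule finite_subset[of _ "(\<lambda>i. hw_sub (epsw (i + 1)) (epsw i)) ` {..m}"]) auto
  moreover have "finite {hw_sub (epsw (j + 1)) (delw j) | j. 1 \<le> j \<and> j \<le> n}"
    by (rule finite_subset[of _ "(\<lambda>j. hw_sub (epsw (j + 1)) (delw j)) ` {..n}"]) auto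
  moreover have "finite {hw_sub (delw j) (epsw j) | j. 1 \<le> j \<and> j \<le> n}"
    by (rule finite_subset[of _ "(\<lambda>j. hw_sub (delw j) (epsw j)) ` {..n}"]) auto
  ultimately show ?thesis by (simp add: sroots_def)
qed

lemma QP_simple: "\<alpha> \<in> sroots m n \<Longrightarrow> QP (hw_ev m n \<alpha>)"
proof -
  assume a: "\<alpha> \<in> sroots m n"
  have "(\<Sum>\<beta>\<in>sroots m n. of_nat (if \<beta> = \<alpha> then 1 else 0) * hw_ev m n \<beta> h) = hw_ev m n \<alpha> h" for h
  proof -
    have "(\<Sum>\<beta>\<in>sroots m n. of_nat (if \<beta> = \<alpha> then 1 else 0) * hw_ev m n \<beta> h)
       = (\<Sum>\<beta>\<in>sroots m n. if \<beta> = \<alpha> then hw_ev m n \<alpha> h else 0)"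
      by (rule sum.cong) auto
    then show ?thesis using a finite_sroots by simp
  qed
  then show ?thesis unfolding QP_def by (intro exI[of _ "\<lambda>\<beta>. if \<beta> = \<alpha> then 1 else 0"]) simp
qed

lemma QP_mult: "QP g \<Longrightarrow> QP (\<lambda>h. of_nat k * g h)"
proof (induction k)
  case (Suc k)
  from QP_add[OF Suc.prems Suc.IH[OF Suc.prems]] show ?case
    by (rule QP_cong) (simp add: algebra_simps)
qed (simp add: QP_zero)

text \<open>Comparing \<open>a\<close> with \<open>pr b\<close> expresses that a sum of two weights
  lies in the cone, so this one relation covers all finite roots.\<close>

abbreviation ge :: "nat \<Rightarrow> nat \<Rightarrow> bool" where
  "ge a b \<equiv> QP (\<lambda>h. hval h a - hval h b)"

lemma ge_refl: "ge a a"
  by (simp add: QP_zero)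

lemma ge_trans: "ge a b \<Longrightarrow> ge b c \<Longrightarrow> ge a c"
  by (drule (1) QP_add, erule QP_cong) simp

lemma ge_dual: "ge a b \<Longrightarrow> a < N \<Longrightarrow> b < N \<Longrightarrow> ge (pr b) (pr a)"
  by (erule QP_cong) (simp add: hval_pr)

lemma ge_eps_step:
  assumes "n \<le> i" "Suc i < m"
  shows "ge (Suc i) i"
proof -
  have "hw_sub (epsw (Suc i + 1)) (epsw (Suc i)) \<in> sroots m n"
    unfolding sroots_def using assms by auto
  from QP_simple[OF this] show ?thesis
    by (rule QP_cong) (use assms in \<open>simp add: hw_ev_sub hw_ev_epsw\<close>)
qed

lemma ge_eps_del:
  assumes "j < n"
  shows "ge (Suc j) (2*m + j)"
proof -
  have "hw_sub (epsw (Suc j + 1)) (delw (Suc j)) \<in> sroots m n"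
    unfolding sroots_def using assms by auto
  from QP_simple[OF this] show ?thesis
    by (rule QP_cong) (use assms m_gt in \<open>simp add: hw_ev_sub hw_ev_epsw hw_ev_delw\<close>)
qed

lemma ge_del_eps:
  assumes "j < n"
  shows "ge (2*m + j) j"
proof -
  have "hw_sub (delw (Suc j)) (epsw (Suc j)) \<in> sroots m n"
    unfolding sroots_def using assms by auto
  from QP_simple[OF this] show ?thesis
    by (rule QP_cong) (use assms m_gt in \<open>simp add: hw_ev_sub hw_ev_epsw hw_ev_delw\<close>)
qed

lemma zero_lt: "0 < m" "0 < N" "2*m < N" "m - 2 < N"
  using m_gt n_ge by (auto simp: matdim_def)

lemma ge_del_neg_eps: "ge (2*m) (pr 0)"
proof -
  have "hw_add (delw 1) (epsw 1) \<in> sroots m n"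
    unfolding sroots_def by auto
  from QP_simple[OF this] show ?thesis
    by (rule QP_cong) (use zero_lt n_ge in \<open>simp add: hw_ev_add hw_ev_epsw hw_ev_delw hval_pr\<close>)
qed

lemma QP_affine: "QP (\<lambda>h. cd h - hval h (m - 1) - hval h (m - 2))"
proof -
  have "hw_sub deltaw (hw_add (epsw m) (epsw (m - 1))) \<in> sroots m n"
    unfolding sroots_def by auto
  moreover have "m - 1 - 1 = m - 2" by simp
  ultimately show ?thesis
    by (intro QP_cong[OF QP_simple])
       (use m_gt in \<open>auto simp: hw_ev_sub hw_ev_add hw_ev_epsw hw_ev_deltaw\<close>)
qed

lemma ge_eps:
  assumes "i \<le> j" "j < m"
  shows "ge j i"
  using assms
proof (induction j rule: dec_induct)
  case base
  show ?case by (rule ge_refl)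
next
  case (step j)
  have "ge (Suc j) j"
  proof (cases "j < n")
    case True
    show ?thesis by (rule ge_trans[OF ge_eps_del[OF True] ge_del_eps[OF True]])
  next
    case False
    then show ?thesis using step by (intro ge_eps_step) auto
  qed
  moreover have "ge j i" using step by simp
  ultimately show ?case by (rule ge_trans)
qed

lemma ge_half:
  assumes a: "a \<in> pos_half" and b: "b \<in> pos_half" and w: "w0 1 b \<le> w0 1 a"
  shows "ge a b"
proof -
  have nm: "n < m" using m_gt by simp
  from pos_half_elim[OF a] pos_half_elim[OF b] consider
    "a < m" "b < m" | j where "a < m" "j < n" "b = 2*m + j" | j where "j < n" "a = 2*m + j" "b < m"
    | j j' where "j < n" "j' < n" "a = 2*m + j" "b = 2*m + j'" by blast
  then show ?thesis
  proof cases
    case 1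
    then have "b \<le> a" using w by (auto simp: w0_eps split: if_splits)
    then show ?thesis using 1 by (intro ge_eps) auto
  next
    case (2 j)
    then have "Suc j \<le> a" using w by (auto simp: w0_eps w0_del split: if_splits)
    then have "ge a (Suc j)" using 2 by (intro ge_eps) auto
    then show ?thesis using ge_trans ge_eps_del[OF 2(2)] 2(3) by blast
  next
    case (3 j)
    then have "b \<le> j" using w by (auto simp: w0_eps w0_del split: if_splits)
    then have "ge j b" using 3 nm by (intro ge_eps) auto
    then show ?thesis using ge_trans[OF ge_del_eps[OF 3(1)]] 3(2) by blast
  next
    case (4 j j')
    then have le: "j' \<le> j" using w by (auto simp: w0_del)
    show ?thesis
    proof (cases "j' = j")
      case True
      then show ?thesis using 4 ge_refl by simp
    next
      case False
      then have "ge j (Suc j')" using le 4 nm by (intro ge_eps) auto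
      then have "ge j (2*m + j')" using ge_trans ge_eps_del[OF 4(2)] by blast
      then show ?thesis using ge_trans[OF ge_del_eps[OF 4(1)]] 4 by blast
    qed
  qed
qed

lemma half_mem: "0 \<in> pos_half" "2*m \<in> pos_half"
  using m_gt n_ge by (auto simp: pos_half_def)

lemma ge_half_zero: "a \<in> pos_half \<Longrightarrow> ge a 0"
  using w0_lower[of a 1] half_mem by (intro ge_half; cases "a = 0") (auto simp: w0_zero)

lemma ge_half_neg_zero: "a \<in> pos_half \<Longrightarrow> a \<noteq> 0 \<Longrightarrow> ge a (pr 0)"
proof (rule ge_trans)
  assume a: "a \<in> pos_half" "a \<noteq> 0"
  show "ge a (2*m)"
    using w0_lower[OF a, of 1] half_mem a w0_del[of 0 1] n_ge by (intro ge_half) auto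
  show "ge (2*m) (pr 0)" by (rule ge_del_neg_eps)
qed

text \<open>The excluded pair is 2\<epsilon>_1, the difference of the simple roots \<delta>_1 +
  \<epsilon>_1 and \<delta>_1 - \<epsilon>_1, which is not in the cone. Every other sum passes
  through -\<epsilon>_1, possibly after duality has exchanged the summands.\<close>

lemma ge_pos_neg:
  assumes a: "a \<in> pos_half" and b: "b \<in> pos_half" and ne: "\<not> (a = 0 \<and> b = 0)"
  shows "ge a (pr b)"
proof -
  note N = pos_half_less[OF a] pos_half_less[OF b] zero_lt(2)
  show ?thesis
  proof (cases "a = 0")
    case False
    have "ge (pr 0) (pr b)" by (rule ge_dual[OF ge_half_zero[OF b] N(2,3)])
    then show ?thesis by (rule ge_trans[OF ge_half_neg_zero[OF a False]])
  next
    case True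
    then have "ge b (pr 0)" using ne b ge_half_neg_zero by simp
    from ge_dual[OF this] N have "ge 0 (pr b)" by simp
    then show ?thesis using True by simp
  qed
qed

lemma ge_finite:
  assumes s: "s = 1 \<or> s = -1" and ab: "a < N" "b < N" "\<not> (a < 2*m \<and> b = pr a)"
    and d: "w0 s a > w0 s b"
  shows "ge a b"
proof -
  have PP: "ge a b" if "a \<in> pos_half" "b \<in> pos_half" "w0 s a > w0 s b" for a b
  proof (cases "b = 0")
    case True
    then show ?thesis using ge_half_zero that by simp
  next
    case False
    have "w0 s a > 1"
      using that(3) w0_lower[OF that(2) False, of s] by linarith
    then have "a \<noteq> 0"
      using s w0_zero[of s] by (cases "a = 0") auto
    then have "w0 1 b \<le> w0 1 a" using that False w0_s[of a s] w0_s[of b s] by simp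
    then show ?thesis using that ge_half by blast
  qed
  show ?thesis using ab(1)
  proof (cases rule: pos_half_cases)
    case a: 1
    show ?thesis using ab(2)
    proof (cases rule: pos_half_cases)
      case 1
      then show ?thesis using a PP d by blast
    next
      case (2 b')
      have "\<not> (a = 0 \<and> b' = 0)"
      proof
        assume "a = 0 \<and> b' = 0"
        then show False using 2 ab m_gt by simp
      qed
      then show ?thesis using ge_pos_neg[OF a 2(1)] 2(2) by simp
    qed
  next
    case a: (2 a')
    note N' = pos_half_less[OF a(1)]
    show ?thesis using ab(2)
    proof (cases rule: pos_half_cases)
      case 1
      have "\<not> (a' = 0 \<and> b = 0)"
      proof
        assume *: "a' = 0 \<and> b = 0"
        then have "pr 0 < 2*m" using zero_lt by simp
        then show False using a ab * zero_lt by simp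
      qed
      then have "w0 s a' + w0 s b \<ge> 0"
        using w0_lower[OF a(1), of s] w0_lower[OF 1, of s] s
        by (cases "a' = 0"; cases "b = 0") (auto simp: w0_zero)
      then show ?thesis using d w0_pr[OF N', of s] a by simp
    next
      case (2 b')
      note N'' = pos_half_less[OF 2(1)]
      have "w0 s b' > w0 s a'" using d w0_pr[OF N', of s] w0_pr[OF N'', of s] a 2 by simp
      then have "ge b' a'" using PP a 2 by blast
      then show ?thesis using ge_dual N' N'' a 2 by simp
    qed
  qed
qed

lemma w0_top: "w0 s (m - 1) = int m + int n" "w0 s (m - 2) = int m + int n - 1"
  using m_gt by (simp_all add: w0_eps of_nat_diff)

lemma ge_top:
  assumes "b < N"
  shows "ge (m - 1) b" and "b \<noteq> m - 1 \<Longrightarrow> ge (m - 2) b"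
proof -
  have h: "m - 1 \<in> pos_half" "m - 2 \<in> pos_half" "m - 1 \<noteq> 0" "m - 2 \<noteq> 0"
    using m_gt by (auto simp: pos_half_def)
  note w = w0_top[of 1]
  have lower: "w0 1 a \<le> int m + int n" if "a \<in> pos_half" for a
    using w0_lower[OF that, of 1] n_ge by (cases "a = 0") (auto simp: w0_zero)
  show "ge (m - 1) b" using assms
    by (cases rule: pos_half_cases) (use ge_half[OF h(1)] ge_pos_neg[OF h(1)] lower w h in auto)
  show "ge (m - 2) b" if ne: "b \<noteq> m - 1"
    using assms
  proof (cases rule: pos_half_cases)
    case 1
    have "w0 1 b \<noteq> w0 1 (m - 1)" using lab_inj[OF w0_lab[of 1] assms m1_less(3)] ne by auto
    then have "w0 1 b \<le> w0 1 (m - 2)" using lower[OF 1] w by linarith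
    then show ?thesis using ge_half[OF h(2) 1] by blast
  qed (use ge_pos_neg[OF h(2)] h in auto)
qed

lemma QP_delta: "QP cd"
proof -
  have N: "m - 2 < N" "m - 1 < N" by (rule zero_lt(4) m1_less(3))+
  have "ge (m - 1) (pr (m - 2))" using ge_top(1) N by simp
  from QP_add[OF QP_affine this] show ?thesis
    by (rule QP_cong) (simp add: hval_pr N)
qed

text \<open>Labels bound the finite part by \<open>D\<close>, so a positive degree excludes negative
  \<open>r\<close>. For positive \<open>r\<close> all copies of \<delta> but one are split off,
  since \<delta> itself is in the cone.\<close>

lemma QP_root:
  assumes s: "s = 1 \<or> s = -1" and ab: "a < N" "b < N" "\<not> (a < 2*m \<and> b = pr a)"
    and d: "dg (w0 s) r a b > 0"
  shows "QP (\<lambda>h. hval h a - hval h b + cd h * of_int r)"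
proof -
  have w: "\<bar>w0 s a\<bar> \<le> int m + int n" "\<bar>w0 s b\<bar> \<le> int m + int n"
    using w0_lab[OF s] ab by (auto simp: lab_def)
  have "r \<ge> 0"
  proof (rule ccontr)
    assume "\<not> r \<ge> 0"
    then have "D * r \<le> D * (- 1)" by (intro mult_left_mono) auto
    then have "D * r \<le> - D" unfolding mult_minus1_right .
    then show False using d w unfolding dg_def abs_le_iff by auto
  qed
  then consider "r = 0" | "r \<ge> 1" by linarith
  then show ?thesis
  proof cases
    case 1
    then have "w0 s a > w0 s b" using d by (simp add: dg_def)
    then show ?thesis using ge_finite[OF s ab] 1 by simp
  next
    case 2
    then obtain k where k: "r = int k + 1"
      using that[of "nat (r - 1)"] by simp
    have N: "m - 2 < N" "m - 1 < N" by (rule zero_lt(4) m1_less(3))+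
    \<comment> \<open>This is \<delta> - \<theta> plus the weight of \<open>a\<close> plus
      \<epsilon>_m plus \<epsilon>_(m-1) minus the weight of \<open>b\<close>. The weight
      \<epsilon>_(m-1) dominates all others except \<epsilon>_m; if \<open>b\<close> carries
      \<epsilon>_m, then -\<theta> already contains its negative and only \<open>a\<close> has to be
      compared.\<close>
    have "QP (\<lambda>h. cd h + hval h a - hval h b)"
    proof (cases "b = m - 1")
      case False
      have "ge a (pr (m - 1))" using ge_dual[OF ge_top(1)[OF pr_less[OF ab(1)]]] N ab by simp
      from QP_add[OF QP_affine QP_add[OF this ge_top(2)[OF ab(2) False]]] show ?thesis
        by (rule QP_cong) (simp add: hval_pr N[unfolded One_nat_def])
    next
      case True
      then have "pr a \<noteq> m - 1" using ab m1_less by (metis pr_pr pr_even)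
      then have "ge a (pr (m - 2))" using ge_dual[OF ge_top(2)[OF pr_less[OF ab(1)]]] N ab by simp
      from QP_add[OF QP_affine this] show ?thesis
        by (rule QP_cong) (simp add: hval_pr N[unfolded One_nat_def] True)
    qed
    from QP_add[OF QP_mult[OF QP_delta, of k] this] show ?thesis
      by (rule QP_cong) (simp add: k algebra_simps)
  qed
qed

text \<open>Gives elements of the cone a nonnegative degree, by which \<open>rt_qplus\<close>
  decides which roots of so(2m) are positive. Every simple root has degree 1 except \<delta>_1 +
  \<epsilon>_1, which has degree 3 because the label with sign 1 favours \<delta>_1 -
  \<epsilon>_1.\<close>

lemma sroots_height:
  assumes "\<alpha> \<in> sroots m n"
  shows "\<exists>k::nat. hw_ev m n \<alpha> (h0 (w0 1)) = of_nat k"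
proof -
  have v: "hval (h0 (w0 1)) i = of_int (w0 1 i)" if "i < N" for i
    using that by (rule h0_sel)
  have eN: "i < m \<Longrightarrow> i < N" "j < n \<Longrightarrow> 2*m + j < N" for i j by (auto simp: matdim_def)
  have nm: "n + 2 < m" by (rule m_gt)
  consider "\<alpha> = hw_sub deltaw (hw_add (epsw m) (epsw (m - 1)))"
    | i where "\<alpha> = hw_sub (epsw (i + 1)) (epsw i)" "n + 1 \<le> i" "i \<le> m - 1"
    | j where "\<alpha> = hw_sub (epsw (j + 1)) (delw j)" "1 \<le> j" "j \<le> n"
    | j where "\<alpha> = hw_sub (delw j) (epsw j)" "1 \<le> j" "j \<le> n"
    | "\<alpha> = hw_add (delw 1) (epsw 1)"
    using assms unfolding sroots_def by blast
  then show ?thesis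
  proof cases
    case 1
    have e: "hw_ev m n (epsw m) h = hval h (m - 1)" "hw_ev m n (epsw (m - 1)) h = hval h (m - 2)" for h
      using nm hw_ev_epsw[of m h] hw_ev_epsw[of "m - 1" h] by (simp_all add: numeral_2_eq_2)
    have "hw_ev m n \<alpha> (h0 (w0 1)) = of_nat 1"
      unfolding 1 hw_ev_sub hw_ev_add hw_ev_deltaw e v[OF m1_less(3)] v[OF zero_lt(4)] w0_top h0_sel(2)
      by simp
    then show ?thesis by blast
  next
    case (2 i)
    then obtain i' where i: "i = Suc i'" by (cases i) auto
    have "hw_ev m n \<alpha> (h0 (w0 1)) = of_nat 1"
      using nm n_ge 2 unfolding 2(1) hw_ev_sub i
      by (auto simp: hw_ev_epsw v eN w0_eps)
    then show ?thesis by blast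
  next
    case (3 j)
    then obtain j' where j: "j = Suc j'" by (cases j) auto
    have "hw_ev m n \<alpha> (h0 (w0 1)) = of_nat 1"
      using nm 3 unfolding 3(1) hw_ev_sub j
      by (auto simp: hw_ev_epsw hw_ev_delw v eN w0_eps w0_del)
    then show ?thesis by blast
  next
    case (4 j)
    then obtain j' where j: "j = Suc j'" by (cases j) auto
    have "hw_ev m n \<alpha> (h0 (w0 1)) = of_nat 1"
      using nm 4 unfolding 4(1) hw_ev_sub j
      by (auto simp: hw_ev_epsw hw_ev_delw v eN w0_eps w0_del)
    then show ?thesis by blast
  next
    case 5
    have "hw_ev m n \<alpha> (h0 (w0 1)) = of_nat 3"
      using nm n_ge w0_del[of 0 1] unfolding 5 hw_ev_add
      by (simp add: hw_ev_epsw hw_ev_delw v eN zero_lt w0_zero)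
    then show ?thesis by blast
  qed
qed

lemma qplus_height:
  assumes "\<gamma> \<in> qplus m n"
  shows "\<exists>k::nat. hw_ev m n \<gamma> (h0 (w0 1)) = of_nat k"
proof -
  obtain c :: "hw \<Rightarrow> nat" where
    "hw_ev m n \<gamma> (h0 (w0 1)) = (\<Sum>\<alpha>\<in>sroots m n. of_nat (c \<alpha>) * hw_ev m n \<alpha> (h0 (w0 1)))"
    using assms h0_hhat[OF w0_lab[of 1]] by (auto simp: qplus_def)
  moreover obtain k :: "hw \<Rightarrow> nat" where "\<forall>\<alpha>\<in>sroots m n. hw_ev m n \<alpha> (h0 (w0 1)) = of_nat (k \<alpha>)"
    using bchoice[of "sroots m n" "\<lambda>\<alpha> k. hw_ev m n \<alpha> (h0 (w0 1)) = of_nat k"] sroots_height by blast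
  ultimately have "hw_ev m n \<gamma> (h0 (w0 1)) = of_nat (\<Sum>\<alpha>\<in>sroots m n. c \<alpha> * k \<alpha>)"
    by simp
  then show ?thesis by blast
qed

end

section \<open>Reduction to simple roots\<close>

text \<open>\<open>L r x y\<close> stands for a property of the root \<open>\<epsilon>\<^sub>x - \<epsilon>\<^sub>y + r\<delta>\<close>, with the convention \<open>\<epsilon>\<^sub>-\<^sub>x = - \<epsilon>\<^sub>x\<close>.\<close>
lemma affine_D_closure:
  fixes L :: "int \<Rightarrow> int \<Rightarrow> int \<Rightarrow> bool" and M :: int
  assumes M: "M \<ge> 4"
    and sum: "\<And>r s x y z. L r x y \<Longrightarrow> L s y z \<Longrightarrow> 1 \<le> \<bar>x\<bar> \<Longrightarrow> \<bar>x\<bar> \<le> M \<Longrightarrow> 1 \<le> \<bar>y\<bar> \<Longrightarrow> \<bar>y\<bar> \<le> M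
       \<Longrightarrow> 1 \<le> \<bar>z\<bar> \<Longrightarrow> \<bar>z\<bar> \<le> M \<Longrightarrow> \<bar>x\<bar> \<noteq> \<bar>y\<bar> \<Longrightarrow> \<bar>x\<bar> \<noteq> \<bar>z\<bar> \<Longrightarrow> \<bar>y\<bar> \<noteq> \<bar>z\<bar> \<Longrightarrow> L (r + s) x z"
    and dual: "\<And>r x y. L r x y \<Longrightarrow> 1 \<le> \<bar>x\<bar> \<Longrightarrow> \<bar>x\<bar> \<le> M \<Longrightarrow> 1 \<le> \<bar>y\<bar> \<Longrightarrow> \<bar>y\<bar> \<le> M \<Longrightarrow> L r (- y) (- x)"
    and step: "\<And>i. 1 \<le> i \<Longrightarrow> i < M \<Longrightarrow> L 0 i (i + 1)"
    and fork: "L 0 (- 1) 2" and affine: "L (- 1) (M - 1) (- M)"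
  shows "1 \<le> \<bar>x\<bar> \<Longrightarrow> \<bar>x\<bar> \<le> M \<Longrightarrow> 1 \<le> \<bar>y\<bar> \<Longrightarrow> \<bar>y\<bar> \<le> M \<Longrightarrow> x < y \<Longrightarrow> \<bar>x\<bar> \<noteq> \<bar>y\<bar> \<Longrightarrow> L 0 x y"
    and "1 \<le> \<bar>x\<bar> \<Longrightarrow> \<bar>x\<bar> \<le> M \<Longrightarrow> 1 \<le> \<bar>y\<bar> \<Longrightarrow> \<bar>y\<bar> \<le> M \<Longrightarrow> \<bar>x\<bar> \<noteq> \<bar>y\<bar> \<Longrightarrow> L (- int (Suc k)) x y"
proof -
  have sum0: "L 0 x y \<Longrightarrow> L 0 y z \<Longrightarrow> 1 \<le> \<bar>x\<bar> \<Longrightarrow> \<bar>x\<bar> \<le> M \<Longrightarrow> 1 \<le> \<bar>y\<bar> \<Longrightarrow> \<bar>y\<bar> \<le> M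
       \<Longrightarrow> 1 \<le> \<bar>z\<bar> \<Longrightarrow> \<bar>z\<bar> \<le> M \<Longrightarrow> \<bar>x\<bar> \<noteq> \<bar>y\<bar> \<Longrightarrow> \<bar>x\<bar> \<noteq> \<bar>z\<bar> \<Longrightarrow> \<bar>y\<bar> \<noteq> \<bar>z\<bar> \<Longrightarrow> L 0 x z" for x y z
    using sum[of 0 x y 0 z] by simp
  have pos: "L 0 i j" if "1 \<le> i" "i < j" "j \<le> M" for i j
    using that(2,3)
  proof (induction j rule: int_gr_induct)
    case base
    then show ?case using step[of i] that(1) by simp
  next
    case (step j)
    then have "L 0 i j" by simp
    moreover have "L 0 j (j + 1)" using assms(4)[of j] step that(1) by simp
    ultimately show ?case using step that(1) by (intro sum0[of i j "j + 1"]) auto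
  qed
  have neg1: "L 0 (- 1) j" if "2 \<le> j" "j \<le> M" for j
  proof (cases "j = 2")
    case False
    then have "L 0 2 j" using that by (intro pos) auto
    with fork show ?thesis using that False M by (intro sum0[of "- 1" 2 j]) auto
  qed (use fork in simp)
  have neg: "L 0 (- i) j" if "1 \<le> i" "i \<le> M" "1 \<le> j" "j \<le> M" "i \<noteq> j" for i j
  proof -
    have one: "L 0 (- j) 1" if "2 \<le> j" "j \<le> M" for j
      using dual[OF neg1[OF that]] that by simp
    consider "i = 1" | "j = 1" | "i \<noteq> 1" "j \<noteq> 1" by blast
    then show ?thesis
    proof cases
      case 1
      then show ?thesis using neg1 that by auto
    next
      case 2
      then show ?thesis using one that by auto
    next
      case 3
      then have "L 0 (- i) 1" "L 0 1 j" using one pos that by auto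
      then show ?thesis using 3 that M by (intro sum0[of "- i" 1 j]) auto
    qed
  qed
  have fin: "L 0 x y" if xy: "1 \<le> \<bar>x\<bar>" "\<bar>x\<bar> \<le> M" "1 \<le> \<bar>y\<bar>" "\<bar>y\<bar> \<le> M" "x < y" "\<bar>x\<bar> \<noteq> \<bar>y\<bar>" for x y
  proof -
    consider "x > 0" | "x < 0" "y > 0" | "x < 0" "y < 0" using xy by linarith
    then show ?thesis
    proof cases
      case 1
      then show ?thesis using pos xy by auto
    next
      case 2
      then show ?thesis using neg[of "- x" y] xy by auto
    next
      case 3
      then have "L 0 (- y) (- x)" using pos[of "- y" "- x"] xy by auto
      then show ?thesis using dual[of 0 "- y" "- x"] xy by simp
    qed
  qed
  have lsum: "L (- 1) x z" if "L 0 x y" "L (- 1) y z" "1 \<le> \<bar>x\<bar>" "\<bar>x\<bar> \<le> M" "1 \<le> \<bar>y\<bar>" "\<bar>y\<bar> \<le> M"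
      "1 \<le> \<bar>z\<bar>" "\<bar>z\<bar> \<le> M" "\<bar>x\<bar> \<noteq> \<bar>y\<bar>" "\<bar>x\<bar> \<noteq> \<bar>z\<bar>" "\<bar>y\<bar> \<noteq> \<bar>z\<bar>" for x y z
    using sum[OF that] by simp
  have rsum: "L (- 1) x z" if "L (- 1) x y" "L 0 y z" "1 \<le> \<bar>x\<bar>" "\<bar>x\<bar> \<le> M" "1 \<le> \<bar>y\<bar>" "\<bar>y\<bar> \<le> M"
      "1 \<le> \<bar>z\<bar>" "\<bar>z\<bar> \<le> M" "\<bar>x\<bar> \<noteq> \<bar>y\<bar>" "\<bar>x\<bar> \<noteq> \<bar>z\<bar>" "\<bar>y\<bar> \<noteq> \<bar>z\<bar>" for x y z
    using sum[OF that] by simp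
  \<comment> \<open>Each sum requires three different absolute values, so the pairs are reached in
    stages: \<open>M - 1\<close> is moved to a smaller index, then \<open>- M\<close> is moved, and
    duality with a detour through the index 1 gives the rest.\<close>
  have A1: "L (- 1) a (- M)" if "1 \<le> \<bar>a\<bar>" "\<bar>a\<bar> \<le> M - 2" for a
    using that M by (intro lsum[OF fin affine]) auto
  have A2: "L (- 1) a b" if "1 \<le> \<bar>a\<bar>" "\<bar>a\<bar> \<le> M - 2" "1 \<le> \<bar>b\<bar>" "\<bar>b\<bar> \<le> M - 1" "\<bar>a\<bar> \<noteq> \<bar>b\<bar>" for a b
    using that M by (intro rsum[OF A1 fin]) auto
  have A3: "L (- 1) a M" if a: "1 \<le> \<bar>a\<bar>" "\<bar>a\<bar> \<le> M - 2" for a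
  proof -
    define c :: int where "c = (if \<bar>a\<bar> = 1 then 2 else 1)"
    have c: "1 \<le> c" "c \<le> 2" "\<bar>a\<bar> \<noteq> \<bar>c\<bar>" by (auto simp: c_def)
    show ?thesis
      using a c M by (intro rsum[OF A2[of a c] fin[of c M]]) auto
  qed
  have A4: "L (- 1) a b" if ab: "1 \<le> \<bar>a\<bar>" "\<bar>a\<bar> \<le> M - 2" "1 \<le> \<bar>b\<bar>" "\<bar>b\<bar> \<le> M" "\<bar>a\<bar> \<noteq> \<bar>b\<bar>" for a b
  proof -
    consider "\<bar>b\<bar> \<le> M - 1" | "b = M" | "b = - M" using ab by linarith
    then show ?thesis using A1 A2 A3 ab by cases auto
  qed
  have A5: "L (- 1) a b" if "1 \<le> \<bar>b\<bar>" "\<bar>b\<bar> \<le> M - 2" "1 \<le> \<bar>a\<bar>" "\<bar>a\<bar> \<le> M" "\<bar>a\<bar> \<noteq> \<bar>b\<bar>" for a b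
    using dual[OF A4[of "- b" "- a"]] that M by auto
  have A6: "L (- 1) a b" if "1 \<le> \<bar>a\<bar>" "\<bar>a\<bar> \<le> M" "M - 1 \<le> b" "b \<le> M" "\<bar>a\<bar> \<noteq> \<bar>b\<bar>" for a b
  proof (cases "\<bar>a\<bar> \<le> M - 2")
    case True
    then show ?thesis using A4 that M by auto
  next
    case False
    then show ?thesis using that M by (intro rsum[OF A5[of 1 a] fin[of 1 b]]) auto
  qed
  have aff: "L (- 1) a b" if ab: "1 \<le> \<bar>a\<bar>" "\<bar>a\<bar> \<le> M" "1 \<le> \<bar>b\<bar>" "\<bar>b\<bar> \<le> M" "\<bar>a\<bar> \<noteq> \<bar>b\<bar>" for a b
  proof -
    consider "\<bar>a\<bar> \<le> M - 2" | "\<bar>b\<bar> \<le> M - 2" | "M - 1 \<le> b" | "a \<le> - (M - 1)"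
      | "a = M - 1" "b = - M" | "a = M" "b = - (M - 1)"
      using ab M by linarith
    then show ?thesis
    proof cases
      case 4
      then have "L (- 1) (- b) (- a)" using A6[of "- b" "- a"] ab by auto
      then show ?thesis using dual[of "- 1" "- b" "- a"] ab by simp
    next
      case 6
      then show ?thesis using dual[OF affine] M by simp
    qed (use A4 A5 A6 affine ab in auto)
  qed
  show "L 0 x y" if "1 \<le> \<bar>x\<bar>" "\<bar>x\<bar> \<le> M" "1 \<le> \<bar>y\<bar>" "\<bar>y\<bar> \<le> M" "x < y" "\<bar>x\<bar> \<noteq> \<bar>y\<bar>"
    using fin that by blast
  show "L (- int (Suc k)) x y" if "1 \<le> \<bar>x\<bar>" "\<bar>x\<bar> \<le> M" "1 \<le> \<bar>y\<bar>" "\<bar>y\<bar> \<le> M" "\<bar>x\<bar> \<noteq> \<bar>y\<bar>"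
    using that
  proof (induction k arbitrary: x y)
    case 0
    then show ?case using aff by simp
  next
    case (Suc k)
    \<comment> \<open>An intermediate index whose absolute value differs from both others; one of 1,
      2, 3 is always free.\<close>
    define c :: int where "c = (if \<bar>x\<bar> \<noteq> 1 \<and> \<bar>y\<bar> \<noteq> 1 then 1 else if \<bar>x\<bar> \<noteq> 2 \<and> \<bar>y\<bar> \<noteq> 2 then 2 else 3)"
    have c: "1 \<le> c" "c \<le> 3" "\<bar>x\<bar> \<noteq> \<bar>c\<bar>" "\<bar>c\<bar> \<noteq> \<bar>y\<bar>" using Suc.prems(5) by (auto simp: c_def)
    have "L (- int (Suc k)) x c" using Suc c M by auto
    moreover have "L (- 1) c y" using aff c M Suc.prems by auto
    ultimately have "L (- int (Suc k) + - 1) x y"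
      by (rule sum) (use Suc.prems c M in auto)
    then show ?case by simp
  qed
qed

context osp_setting
begin

section \<open>Root spaces and signed indices\<close>

definition wt :: "nat \<Rightarrow> hw" where
  "wt i = (if i < m then epsw (i + 1) else if i < 2*m then hw_sc (-1) (epsw (i - m + 1))
     else if i < 2*m + n then delw (i - 2*m + 1) else hw_sc (-1) (delw (i - 2*m - n + 1)))"

lemma hw_ev_wt:
  assumes i: "i < N" and h: "h \<in> hhat m n"
  shows "hw_ev m n (wt i) h = hval h i"
  using i
proof (cases rule: pos_half_cases)
  case 1
  then show ?thesis
    by (auto simp: wt_def pos_half_def hw_ev_epsw hw_ev_delw)
next
  case (2 i')
  have "hw_ev m n (wt (pr i')) h = - hval h i'"
    using 2(1) by (auto simp: wt_def pos_half_def hw_ev_epsw hw_ev_delw hw_ev_sc pr_def)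
  then show ?thesis using hval_pr[OF h pos_half_less[OF 2(1)]] 2 by simp
qed

definition has_root :: "hw \<Rightarrow> int \<Rightarrow> nat \<Rightarrow> nat \<Rightarrow> bool" where
  "has_root \<gamma> r a b \<longleftrightarrow> (\<forall>h \<in> hhat m n. hw_ev m n \<gamma> h = hval h a - hval h b + cd h * of_int r)"

lemma has_root_wt:
  "a < N \<Longrightarrow> b < N \<Longrightarrow> has_root (hw_add (hw_sub (wt a) (wt b)) (hw_sc (of_int r) deltaw)) r a b"
  by (simp add: has_root_def hw_ev_add hw_ev_sub hw_ev_wt hw_ev_sc hw_ev_deltaw)

lemma El_groot:
  assumes "has_root \<gamma> r a b" "a < N" "b < N"
  shows "El r a b \<in> groot m n \<gamma>"
  using assms by (simp add: groot_def El_ghat gbr_h_El has_root_def)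

text \<open>The root space is one-dimensional, so integrability along a root concerns a single
  vector. The bracket with \<open>d\<close> determines the power of t, and two diagonal elements
  determine the position up to the mirror map.\<close>

lemma groot_El:
  assumes \<gamma>: "has_root \<gamma> r a b" and ab: "a < N" "b < N" "a \<noteq> b" "a \<noteq> pr b" and x: "x \<in> groot m n \<gamma>"
  shows "x = gsc (lpart x r a b) (El r a b)"
proof -
  have xg: "x \<in> ghat m n" using x by (simp add: groot_def)
  have gx: "gbr m n h x = gsc (hval h a - hval h b + cd h * of_int r) x" if "h \<in> hhat m n" for h
    using x \<gamma> that by (simp add: groot_def has_root_def)
  have ne: "b \<noteq> pr a" "pr a \<noteq> pr b" "pr a \<noteq> b" "pr b \<noteq> a" using ab by (auto simp: pr_inj pr_swap)
  define ind :: "nat \<Rightarrow> nat \<Rightarrow> complex" where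
    "ind k i = (if i = k then 1 else 0) - (if i = pr k then 1 else 0)" for k i
  have ih: "hx (ind k) 0 0 \<in> hhat m n" if "k < N" for k
    by (rule hx_hhat) (use that in \<open>auto simp: ind_def pr_inj pr_swap\<close>)
  have dh: "hx (\<lambda>_. 0) 0 1 \<in> hhat m n" by (rule hx_hhat) simp
  have ind_ab: "ind a a = 1" "ind a b = 0" "ind b a = 0" "ind b b = 1"
    using ab ne by (auto simp: ind_def)
  have entry: "q = r \<and> (i = a \<and> j = b \<or> i = pr b \<and> j = pr a)" if nz: "lpart x q i j \<noteq> 0" for q i j
  proof -
    have ij: "i < N" "j < N" using ghat_range[OF xg nz] by auto
    have ev: "hval h i - hval h j + cd h * of_int q = hval h a - hval h b + cd h * of_int r"
      if h: "h \<in> hhat m n" for h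
    proof -
      have "lpart (gbr m n h x) q i j = lpart (gsc (hval h a - hval h b + cd h * of_int r) x) q i j"
        using gx[OF h] by simp
      then show ?thesis using nz by (simp add: gbr_hhat[OF h xg])
    qed
    have "of_int q = (of_int r :: complex)" using ev[OF dh] by simp
    then have q: "q = r" by simp
    have ia: "ind a i - ind a j = 1" using ev[OF ih[OF ab(1)]] ij ab ind_ab by simp
    have ib: "ind b i - ind b j = - 1" using ev[OF ih[OF ab(2)]] ij ab ind_ab by simp
    have v: "ind k l = 1 \<longleftrightarrow> l = k" "ind k l = - 1 \<longleftrightarrow> l = pr k" "ind k l \<in> {1, - 1, 0}" if "k < N" for k l
      using that by (auto simp: ind_def)
    have "i = a \<or> j = pr a"
    proof (rule ccontr)
      assume "\<not> ?thesis"
      then have "ind a i \<in> {- 1, 0}" "ind a j \<in> {1, 0}" using v[OF ab(1)] by blast+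
      then show False using ia by auto
    qed
    then show ?thesis
    proof
      assume i: "i = a"
      then have "ind b j = 1" using ib ind_ab by (simp add: algebra_simps)
      then show ?thesis using i q v(1)[OF ab(2)] by simp
    next
      assume j: "j = pr a"
      have "ind b (pr a) = 0" using ne by (simp add: ind_def)
      then have "ind b i = - 1" using ib j by simp
      then show ?thesis using j q v(2)[OF ab(2)] by simp
    qed
  qed
  \<comment> \<open>A bracket with a Cartan element has no component along \<open>K\<close> or
    \<open>d\<close>, whereas the eigenvalue for this element is 1.\<close>
  have "cK (gbr m n (hx (ind a) 0 0) x) = cK (gsc 1 x)" "cd (gbr m n (hx (ind a) 0 0) x) = cd (gsc 1 x)"
    using gx[OF ih[OF ab(1)]] ab ind_ab by simp_all
  then have c0: "cK x = 0" "cd x = 0" by (simp_all add: gbr_hhat(2)[OF ih[OF ab(1)] xg])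
  show ?thesis
  proof (rule ghat_eqI)
    fix q i j
    have d: "lpart x r (pr b) (pr a) = - sig a b * lpart x r a b"
      using osp_sym[OF ghat_osp[OF xg] pr_less[OF ab(2)] pr_less[OF ab(1)], of r] ab
      by (simp add: sig_pr)
    have X: "Xm a b a b = 1" "Xm a b (pr b) (pr a) = - sig a b"
      using ab ne by (simp_all add: Xm_def)
    consider "q = r" "i = a" "j = b" | "q = r" "i = pr b" "j = pr a"
      | "\<not> (q = r \<and> (i = a \<and> j = b \<or> i = pr b \<and> j = pr a))" by blast
    then show "lpart x q i j = lpart (gsc (lpart x r a b) (El r a b)) q i j"
    proof cases
      case 3
      then have "lpart x q i j = 0" "q = r \<Longrightarrow> Xm a b i j = 0"
        using entry[of q i j] Xm_nonzero[of a b i j] by blast+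
      then show ?thesis by simp
    qed (use d X in simp_all)
  qed (use c0 in simp_all)
qed

text \<open>The matrix index of a signed subscript, where \<epsilon>_(-x) = -\<epsilon>_x. Roots of
  so(2m) become pairs with different absolute values, and positivity becomes the order of the
  integers.\<close>

definition sidx :: "int \<Rightarrow> nat" where
  "sidx z = (if z > 0 then nat z - 1 else m + nat (- z) - 1)"

abbreviation sval :: "int \<Rightarrow> bool" where "sval z \<equiv> 1 \<le> \<bar>z\<bar> \<and> \<bar>z\<bar> \<le> int m"

lemma sidx_less: "sval z \<Longrightarrow> sidx z < 2*m" "sval z \<Longrightarrow> sidx z < N"
  by (auto simp: sidx_def matdim_def)

lemma sidx_pr: "sval z \<Longrightarrow> sidx (- z) = pr (sidx z)"
  by (auto simp: sidx_def pr_def)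

lemma sidx_inj: "sval x \<Longrightarrow> sval y \<Longrightarrow> sidx x = sidx y \<longleftrightarrow> x = y"
  by (auto simp: sidx_def split: if_splits)

lemma sidx_neq:
  assumes "sval x" "sval y" "\<bar>x\<bar> \<noteq> \<bar>y\<bar>"
  shows "sidx x \<noteq> sidx y" "sidx x \<noteq> pr (sidx y)"
proof -
  show "sidx x \<noteq> sidx y" using assms sidx_inj by auto
  have "sidx x \<noteq> sidx (- y)" using assms sidx_inj[of x "- y"] by auto
  then show "sidx x \<noteq> pr (sidx y)" using sidx_pr[OF assms(2)] by simp
qed

lemma w0_sidx_mono:
  assumes "sval x" "sval y" "x < y"
  shows "w0 1 (sidx x) < w0 1 (sidx y)"
proof -
  have P: "w0 1 (sidx z) \<ge> 1" if "sval z" "z > 0" for z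
    using that by (auto simp: sidx_def w0_eps)
  have mono: "w0 1 (sidx x) < w0 1 (sidx y)" if "sval x" "sval y" "x < y" "x > 0" for x y
  proof -
    have "sidx x < sidx y" "sidx y < m" using that by (auto simp: sidx_def)
    then show ?thesis by (auto simp: w0_eps)
  qed
  have ng: "w0 1 (sidx (- z)) = - w0 1 (sidx z)" if "sval z" for z
    using that sidx_less by (simp add: sidx_pr w0_pr)
  consider "x > 0" | "x < 0" "y > 0" | "x < 0" "y < 0" using assms by linarith
  then show ?thesis
  proof cases
    case 2
    then show ?thesis using P[of y] P[of "- x"] ng[of x] assms by auto
  next
    case 3
    then show ?thesis using mono[of "- y" "- x"] ng[of x] ng[of y] assms by auto
  qed (use mono assms in auto)
qed

definition rt :: "int \<Rightarrow> int \<Rightarrow> hw" where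
  "rt x y = hw_add (hw_sc (of_int (sgn x)) (epsw (nat \<bar>x\<bar>))) (hw_sc (of_int (- sgn y)) (epsw (nat \<bar>y\<bar>)))"

lemma hw_ev_signed:
  assumes "sval x" "h \<in> hhat m n"
  shows "of_int (sgn x) * hw_ev m n (epsw (nat \<bar>x\<bar>)) h = hval h (sidx x)"
proof -
  have p: "hw_ev m n (epsw (nat z)) h = hval h (sidx z)" if "z > 0" "sval z" for z
    using that hw_ev_epsw[of "nat z" h] by (simp add: sidx_def)
  show ?thesis
  proof (cases "x > 0")
    case True
    then show ?thesis using p assms by simp
  next
    case False
    then have "hw_ev m n (epsw (nat (- x))) h = hval h (sidx (- x))" using p[of "- x"] assms by auto
    then show ?thesis using False assms sidx_pr[of x] hval_pr[OF assms(2)] sidx_less by simp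
  qed
qed

lemma rt_root:
  assumes "sval x" "sval y"
  shows "has_root (rt x y) 0 (sidx x) (sidx y)"
    and "has_root (hw_add (rt x y) (hw_sc (of_int r) deltaw)) r (sidx x) (sidx y)"
  using assms hw_ev_signed
  by (simp_all add: has_root_def rt_def hw_ev_add hw_ev_sc hw_ev_deltaw)

lemma has_root_neg: "has_root \<gamma> r a b \<Longrightarrow> has_root (hw_sc (-1) \<gamma>) (- r) b a"
  by (simp add: has_root_def hw_ev_sc)

lemma D0sharp_iff:
  "\<gamma> \<in> D0sharp m \<longleftrightarrow> (\<exists>x y. sval x \<and> sval y \<and> \<bar>x\<bar> \<noteq> \<bar>y\<bar> \<and> \<gamma> = rt x y)"
proof
  assume "\<gamma> \<in> D0sharp m"
  then obtain i j and a b :: complex where *: "\<gamma> = hw_add (hw_sc a (epsw i)) (hw_sc b (epsw j))"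
    "i \<in> {1..m}" "j \<in> {1..m}" "i \<noteq> j" "a \<in> {1, -1}" "b \<in> {1, -1}"
    unfolding D0sharp_def by blast
  define x y where "x = (if a = 1 then int i else - int i)" and "y = (if b = 1 then - int j else int j)"
  have "sval x" "sval y" "\<bar>x\<bar> \<noteq> \<bar>y\<bar>" using * by (auto simp: x_def y_def)
  moreover have "\<gamma> = rt x y" using * by (auto simp: rt_def x_def y_def)
  ultimately show "\<exists>x y. sval x \<and> sval y \<and> \<bar>x\<bar> \<noteq> \<bar>y\<bar> \<and> \<gamma> = rt x y" by blast
next
  assume "\<exists>x y. sval x \<and> sval y \<and> \<bar>x\<bar> \<noteq> \<bar>y\<bar> \<and> \<gamma> = rt x y"
  then obtain x y where *: "sval x" "sval y" "\<bar>x\<bar> \<noteq> \<bar>y\<bar>" "\<gamma> = rt x y" by blast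
  show "\<gamma> \<in> D0sharp m" unfolding D0sharp_def
  proof (intro CollectI exI conjI)
    show "\<gamma> = hw_add (hw_sc (of_int (sgn x)) (epsw (nat \<bar>x\<bar>))) (hw_sc (of_int (- sgn y)) (epsw (nat \<bar>y\<bar>)))"
      using * by (simp add: rt_def)
  qed (use * in \<open>auto simp: sgn_if\<close>)
qed

lemma rt_qplus:
  assumes x: "sval x" and y: "sval y" and xy: "\<bar>x\<bar> \<noteq> \<bar>y\<bar>"
  shows "rt x y \<in> qplus m n \<longleftrightarrow> y < x"
proof
  assume "rt x y \<in> qplus m n"
  then obtain k :: nat where "hw_ev m n (rt x y) (h0 (w0 1)) = of_nat k" using qplus_height by blast
  then have "of_int (w0 1 (sidx x) - w0 1 (sidx y)) = (of_int (int k) :: complex)"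
    using rt_root(1)[OF x y] h0_hhat[OF w0_lab[of 1]] sidx_less[OF x] sidx_less[OF y]
    by (simp add: has_root_def h0_sel)
  then have "w0 1 (sidx y) \<le> w0 1 (sidx x)" unfolding of_int_eq_iff by simp
  then show "y < x" using w0_sidx_mono[OF x y] xy by (cases "x < y") auto
next
  assume "y < x"
  have "QP (\<lambda>h. hval h (sidx x) - hval h (sidx y) + cd h * of_int 0)"
  proof (rule QP_root[where s = 1])
    show "\<not> (sidx x < 2*m \<and> sidx y = pr (sidx x))"
      using sidx_neq[OF y x] xy by auto
    show "dg (w0 1) 0 (sidx x) (sidx y) > 0"
      using w0_sidx_mono[OF y x \<open>y < x\<close>] by (simp add: dg_def)
  qed (use sidx_less x y in auto)
  then show "rt x y \<in> qplus m n" unfolding qplus_iff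
    by (rule QP_cong) (use rt_root(1)[OF x y] in \<open>simp add: has_root_def\<close>)
qed

section \<open>Values of a weight on coroots\<close>

lemma hw_ev_hx:
  "hw_ev m n \<Lambda> (hx f s t) = (\<Sum>i\<in>{1..m}. heps \<Lambda> i * f (i - 1)) + (\<Sum>j\<in>{1..n}. hdel \<Lambda> j * f (2*m + j - 1))
     + hLam0 \<Lambda> * s + hdelta \<Lambda> * t"
proof -
  have "i - 1 < N" if "i \<in> {1..m}" for i using that by (auto simp: matdim_def)
  moreover have "2*m + j - 1 < N" if "j \<in> {1..n}" for j using that by (auto simp: matdim_def)
  ultimately show ?thesis by (simp add: hw_ev_def hx_def)
qed

abbreviation delta_at :: "nat \<Rightarrow> nat \<Rightarrow> complex" where "delta_at a i \<equiv> if i = a then 1 else 0"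

lemma hw_ev_hx_add:
  "hw_ev m n \<Lambda> (hx (\<lambda>i. f i + g i) s t) = hw_ev m n \<Lambda> (hx f s t) + hw_ev m n \<Lambda> (hx g 0 0)"
  by (simp add: hw_ev_hx sum.distrib algebra_simps)

lemma hw_ev_hx_diff:
  "hw_ev m n \<Lambda> (hx (\<lambda>i. f i - g i) s t) = hw_ev m n \<Lambda> (hx f s t) - hw_ev m n \<Lambda> (hx g 0 0)"
  by (simp add: hw_ev_hx sum_subtractf algebra_simps)

lemma hw_ev_hx_delta:
  "hw_ev m n \<Lambda> (hx (delta_at a) s 0) = (if a < m then heps \<Lambda> (a + 1)
     else if 2*m \<le> a \<and> a < 2*m + n then hdel \<Lambda> (a - 2*m + 1) else 0) + hLam0 \<Lambda> * s"
proof -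
  have "(\<Sum>i\<in>{1..m}. heps \<Lambda> i * delta_at a (i - 1)) = (\<Sum>i\<in>{1..m}. delta_at (a + 1) i * heps \<Lambda> i)"
    by (rule sum.cong) auto
  moreover have "(\<Sum>j\<in>{1..n}. hdel \<Lambda> j * delta_at a (2*m + j - 1))
      = (\<Sum>j\<in>{1..n}. (if j = a - 2*m + 1 then 1 else 0) * (if 2*m \<le> a then hdel \<Lambda> j else 0))"
    by (rule sum.cong) auto
  ultimately show ?thesis by (auto simp: hw_ev_hx sum_unit)
qed

end

section \<open>Integrability in terms of root vectors\<close>

context osp_rep
begin

lemma gamma_integrable_iff:
  assumes "has_root \<gamma> r a b" "a < N" "b < N" "a \<noteq> b" "a \<noteq> pr b"
  shows "gamma_integrable m n \<rho> \<gamma> \<longleftrightarrow> LN (El (- r) b a)"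
proof -
  note \<gamma> = has_root_neg[OF assms(1)]
  have ne: "b \<noteq> a" "b \<noteq> pr a" using assms by (auto simp: pr_swap)
  have "LN x" if "LN (El (- r) b a)" "x \<in> groot m n (hw_sc (-1) \<gamma>)" for x
  proof -
    have "LN (gsc (lpart x (- r) b a) (El (- r) b a))"
      by (intro LN_gsc El_ghat that assms)
    then show ?thesis using groot_El[OF \<gamma> assms(3,2) ne that(2)] by simp
  qed
  then show ?thesis
    using El_groot[OF \<gamma> assms(3,2)] by (auto simp: gamma_integrable_def LN_def)
qed

lemma integrable_iff_all:
  "integrable m n \<rho> \<longleftrightarrow>
     (\<forall>x y. sval x \<and> sval y \<and> \<bar>x\<bar> \<noteq> \<bar>y\<bar> \<longrightarrow> (x < y \<longrightarrow> LN (El 0 (sidx x) (sidx y)))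
        \<and> (\<forall>k. LN (El (- int (Suc k)) (sidx x) (sidx y))))"
  (is "_ \<longleftrightarrow> ?R")
proof -
  have fin: "gamma_integrable m n \<rho> (rt x y) \<longleftrightarrow> LN (El 0 (sidx y) (sidx x))"
    if "sval x" "sval y" "\<bar>x\<bar> \<noteq> \<bar>y\<bar>" for x y
    using gamma_integrable_iff[OF rt_root(1)[OF that(1,2)]] sidx_neq[OF that] sidx_less that by simp
  have aff: "gamma_integrable m n \<rho> (hw_add (rt x y) (hw_sc (of_nat r) deltaw)) \<longleftrightarrow> LN (El (- int r) (sidx y) (sidx x))"
    if "sval x" "sval y" "\<bar>x\<bar> \<noteq> \<bar>y\<bar>" for x y r
    using gamma_integrable_iff[OF rt_root(2)[OF that(1,2), of "int r"]] sidx_neq[OF that] sidx_less that by simp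
  show ?thesis
  proof
    assume I: "integrable m n \<rho>"
    show ?R
    proof (intro allI impI conjI)
      fix x y assume xy: "sval x \<and> sval y \<and> \<bar>x\<bar> \<noteq> \<bar>y\<bar>"
      then have D: "rt y x \<in> D0sharp m" unfolding D0sharp_iff by (intro exI[of _ y] exI[of _ x]) auto
      show "LN (El 0 (sidx x) (sidx y))" if "x < y"
        using I D fin[of y x] rt_qplus[of y x] xy that by (auto simp: integrable_def)
      show "LN (El (- int (Suc k)) (sidx x) (sidx y))" for k
        using I D aff[of y x "Suc k"] xy unfolding integrable_def by (metis zero_less_Suc)
    qed
  next
    assume R: ?R
    show "integrable m n \<rho>" unfolding integrable_def
    proof (intro conjI ballI allI impI)
      fix \<gamma> assume g: "\<gamma> \<in> D0sharp m \<inter> qplus m n"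
      then obtain x y where xy: "sval x" "sval y" "\<bar>x\<bar> \<noteq> \<bar>y\<bar>" "\<gamma> = rt x y" by (auto simp: D0sharp_iff)
      then show "gamma_integrable m n \<rho> \<gamma>" using g fin[of x y] rt_qplus[of x y] R by auto
    next
      fix \<alpha> and r :: nat assume "\<alpha> \<in> D0sharp m" and r: "r > 0"
      then obtain x y where xy: "sval x" "sval y" "\<bar>x\<bar> \<noteq> \<bar>y\<bar>" "\<alpha> = rt x y" by (auto simp: D0sharp_iff)
      obtain k where "r = Suc k" using r by (cases r) auto
      then show "gamma_integrable m n \<rho> (hw_add \<alpha> (hw_sc (of_nat r) deltaw))"
        using aff[of x y r] xy R by auto
    qed
  qed
qed

lemma integrable_iff_simple:
  "integrable m n \<rho> \<longleftrightarrow> (\<forall>i. 1 \<le> i \<and> i < m \<longrightarrow> LN (El 0 (i - 1) i)) \<and> LN (El 0 m 1)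
     \<and> LN (El (- 1) (m - 2) (2*m - 1))"
  (is "_ \<longleftrightarrow> ?A \<and> ?B \<and> ?C")
proof -
  have idx: "sidx (int i) = i - 1" "sidx (int i + 1) = i" if "1 \<le> i" for i
    using that by (auto simp: sidx_def)
  have idx': "sidx (- 1) = m" "sidx 2 = 1" "sidx (int m - 1) = m - 2" "sidx (- int m) = 2*m - 1"
    using m_gt by (auto simp: sidx_def)
  show ?thesis
  proof
    assume "integrable m n \<rho>"
    note I = this[unfolded integrable_iff_all, rule_format]
    have ?A
    proof (intro allI impI)
      fix i assume i: "1 \<le> i \<and> i < m"
      then show "LN (El 0 (i - 1) i)" using I[of "int i" "int i + 1"] idx[of i] by auto
    qed
    moreover have ?B using I[of "- 1" 2] idx' m_gt by auto
    moreover have ?C using conjunct2[OF I[of "int m - 1" "- int m"], rule_format, of 0] idx' m_gt by auto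
    ultimately show "?A \<and> ?B \<and> ?C" by blast
  next
    assume A: "?A \<and> ?B \<and> ?C"
    define L where "L r x y = LN (El r (sidx x) (sidx y))" for r x y
    have sum: "L (r + s) x z" if "L r x y" "L s y z" "sval x" "sval y" "sval z"
        "\<bar>x\<bar> \<noteq> \<bar>y\<bar>" "\<bar>x\<bar> \<noteq> \<bar>z\<bar>" "\<bar>y\<bar> \<noteq> \<bar>z\<bar>" for r s x y z
      using that LN_sum[of "sidx x" "sidx y" "sidx z" r s] sidx_less sidx_neq[of x y] sidx_neq[of x z]
        sidx_neq[of y z] by (simp add: L_def)
    have dual: "L r (- y) (- x)" if "L r x y" "sval x" "sval y" for r x y
      using LN_dual[of "sidx x" "sidx y" r] that sidx_less by (simp add: L_def sidx_pr)
    have step: "L 0 i (i + 1)" if "1 \<le> i" "i < int m" for i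
    proof -
      have "1 \<le> nat i" "nat i < m" "int (nat i) = i" using that by auto
      then show ?thesis using A idx[of "nat i"] by (simp add: L_def)
    qed
    have "L 0 (- 1) 2" "L (- 1) (int m - 1) (- int m)" using A idx' by (simp_all add: L_def)
    note closure = affine_D_closure[of "int m" L, OF _ _ _ step this]
    have "4 \<le> int m" using m_gt n_ge by simp
    then have "x < y \<longrightarrow> L 0 x y" "L (- int (Suc k)) x y" if "sval x" "sval y" "\<bar>x\<bar> \<noteq> \<bar>y\<bar>" for x y k
      using closure[of x y] sum dual that by blast+
    then show "integrable m n \<rho>" unfolding integrable_iff_all L_def by blast
  qed
qed

end

section \<open>The integrability conditions in coordinates\<close>

context osp_irrep
begin

text \<open>Translates between the cone in \<open>is_L\<close> and degrees. Each root occurring in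
  \<open>x\<close> has positive degree, hence lies in the cone by \<open>QP_root\<close>, and it is
  nonzero because its degree is. Both signs of the label are allowed, as they have the same positive
  roots.\<close>

lemma highest_weight_sing:
  assumes hw: "\<forall>h \<in> hhat m n. \<rho> h v = sc (hw_ev m n \<Lambda> h) v"
    and kill: "\<forall>\<gamma> \<in> qplus m n. \<not> hw_eq m n \<gamma> hw_zero \<longrightarrow> (\<forall>x \<in> groot m n \<gamma>. \<rho> x v = 0)"
    and s: "s = 1 \<or> s = -1"
  shows "sing (w0 s) v (hw_ev m n \<Lambda>)"
  unfolding sing_def
proof (intro conjI ballI impI)
  fix x assume x: "x \<in> ghat m n" "posi (w0 s) x"
  note w = w0_lab[OF s]
  have El0: "\<rho> (El q a b) v = 0" if nz: "lpart x q a b \<noteq> 0" for q a b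
  proof -
    have ab: "a < N" "b < N" using ghat_range[OF x(1) nz] by auto
    have d: "dg (w0 s) q a b > 0" using gsupD'[OF x(2) nz] by simp
    define \<gamma> where "\<gamma> = hw_add (hw_sub (wt a) (wt b)) (hw_sc (of_int q) deltaw)"
    have \<gamma>: "has_root \<gamma> q a b" unfolding \<gamma>_def by (rule has_root_wt[OF ab])
    have "QP (\<lambda>h. hval h a - hval h b + cd h * of_int q)"
      by (rule QP_root[OF s ab ghat_not_dual[OF x(1) nz] d])
    then have "\<gamma> \<in> qplus m n"
      unfolding qplus_iff by (rule QP_cong) (use \<gamma> in \<open>simp add: has_root_def\<close>)
    moreover have "hw_ev m n \<gamma> (h0 (w0 s)) = of_int (dg (w0 s) q a b)"
      using \<gamma> h0_hhat[OF w] ab by (simp add: has_root_def h0_sel dg_def)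
    then have "\<not> hw_eq m n \<gamma> hw_zero"
      using d h0_hhat[OF w] unfolding hw_eq_def hw_ev_zero by (metis less_irrefl of_int_eq_0_iff)
    ultimately show ?thesis using kill El_groot[OF \<gamma> ab] by blast
  qed
  show "\<rho> x v = 0"
  proof (rule ghat_span_induct[OF x(1)])
    show "cK x = 0" "cd x = 0" using x(2) by (auto simp: gsup_def)
    show "\<rho> (gsc c (El q a b)) v = 0" if "lpart x q a b \<noteq> 0" for q a b c
      using El0[OF that] ghat_range[OF x(1) that] by (simp add: rho_gsc El_ghat)
  qed (simp_all add: rho_gadd)
qed (use hw in blast)

text \<open>The label of \<open>a'\<close> lies between those of \<open>b\<close> and
  \<open>a\<close>, so the reflection makes \<open>a\<close> and \<open>b\<close> adjacent. If it
  moves the vector, the weight loses the odd root, whose value on the coroot is 1; this is the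
  subtracted 1.\<close>

lemma LN_iff_nat_reflected:
  assumes w: "lab w" and a': "2*m \<le> a'" "a' < N" and b: "b < 2*m" "b \<noteq> m - 1" "b \<noteq> pr (m - 1)"
    and a: "a < 2*m" "a \<noteq> pr b" and wa: "w a' = w b + 1" "w a = w b + 2"
    and v: "sing w v \<Phi>" "v \<noteq> 0"
  shows "LN (El 0 b a) \<longleftrightarrow> (if \<Phi> (gbr m n (El 0 a' b) (El 0 b a')) = 0
     then \<Phi> (gbr m n (El 0 a b) (El 0 b a)) \<in> \<nat> else \<Phi> (gbr m n (El 0 a b) (El 0 b a)) - 1 \<in> \<nat>)"
proof -
  let ?w = "w \<circ> tau a' b"
  have N: "a < N" "b < N" using a b by (auto simp: matdim_def)
  note ne = odd_even_neq[OF a' b(1)] odd_even_neq[OF a' a(1)]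
  have ab: "a \<noteq> b" using wa by auto
  then have ba: "b \<noteq> pr a" "pr a \<noteq> pr b" using a N by (auto simp: pr_inj pr_swap)
  have w': "lab ?w" by (rule lab_tau[OF w a' b])
  have d: "dg ?w 0 a b = 1"
    using ne ab a wa by (simp add: dg_def tau_def)
  note refl = odd_reflection[OF w a' b wa(1) v]
  note LN = LN_iff_nat[OF w' a(1) b(1) ab a(2) d, simplified]
  define H where "H = gbr m n (El 0 a b) (El 0 b a)"
  have H: "hval H a' = 0" "hval H b = - 1"
    using gbr_El_even[OF a(1) b(1) ab a(2), of 0] ne ab ba N b unfolding H_def by auto
  show ?thesis
  proof (cases "\<Phi> (gbr m n (El 0 a' b) (El 0 b a')) = 0")
    case True
    then show ?thesis using LN[OF refl(1)[OF True] v(2)] by simp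
  next
    case False
    then show ?thesis using LN[OF refl(3)[OF False] refl(2)[OF False]] H by (simp add: H_def)
  qed
qed

lemma integrable_iff_coordinates:
  assumes v: "v \<noteq> 0" and s1: "sing (w0 1) v (hw_ev m n \<Lambda>)" and s2: "sing (w0 (-1)) v (hw_ev m n \<Lambda>)"
  shows "integrable m n \<rho> \<longleftrightarrow>
     (\<forall>i. n + 1 \<le> i \<and> i < m \<longrightarrow> heps \<Lambda> (i + 1) - heps \<Lambda> i \<in> \<nat>)
   \<and> (\<forall>i. 1 \<le> i \<and> i \<le> n \<longrightarrow> (if hdel \<Lambda> i + heps \<Lambda> i = 0 then heps \<Lambda> (i + 1) - heps \<Lambda> i \<in> \<nat>
         else heps \<Lambda> (i + 1) - heps \<Lambda> i - 1 \<in> \<nat>))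
   \<and> (if hdel \<Lambda> 1 - heps \<Lambda> 1 = 0 then heps \<Lambda> 2 + heps \<Lambda> 1 \<in> \<nat> else heps \<Lambda> 2 + heps \<Lambda> 1 - 1 \<in> \<nat>)
   \<and> hLam0 \<Lambda> - heps \<Lambda> m - heps \<Lambda> (m - 1) \<in> \<nat>"
proof -
  note l1 = w0_lab[of 1, simplified] and l2 = w0_lab[of "-1", simplified]
  note ev = hw_ev_hx_diff hw_ev_hx_add hw_ev_hx_delta
  have nm: "n + 2 < m" by (rule m_gt)
  have A: "LN (El 0 (i - 1) i) \<longleftrightarrow> heps \<Lambda> (i + 1) - heps \<Lambda> i \<in> \<nat>" if i: "n + 1 \<le> i" "i < m" for i
  proof -
    obtain j where j: "i = Suc j" "n \<le> j" using i by (cases i) auto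
    have p: "pr j = j + m" "pr (Suc j) = Suc j + m" using i j by (auto simp: pr_def)
    have *: "Suc j < 2*m" "j < 2*m" "Suc j \<noteq> j" "Suc j \<noteq> pr j"
      using i j p by auto
    have "dg (w0 1) 0 (Suc j) j = 1" using i j n_ge by (auto simp: dg_def w0_eps)
    from LN_iff_nat[OF l1 * this s1 v]
    show ?thesis unfolding gbr_El_even[OF *] ev using p i j by simp
  qed
  have B: "LN (El 0 (i - 1) i) \<longleftrightarrow> (if hdel \<Lambda> i + heps \<Lambda> i = 0 then heps \<Lambda> (i + 1) - heps \<Lambda> i \<in> \<nat>
         else heps \<Lambda> (i + 1) - heps \<Lambda> i - 1 \<in> \<nat>)" if i: "1 \<le> i" "i \<le> n" for i
  proof -
    obtain j where j: "i = Suc j" "j < n" using i by (cases i) auto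
    have a': "2*m \<le> 2*m + j" "2*m + j < N" using j by (auto simp: matdim_def)
    have p: "pr j = j + m" "pr (Suc j) = Suc j + m" "pr (2*m + j) = 2*m + j + n" "pr (m - 1) = 2*m - 1"
      using j nm by (auto simp: pr_def)
    have b: "j < 2*m" "j \<noteq> m - 1" "j \<noteq> pr (m - 1)" using j nm p by auto
    have a: "Suc j < 2*m" "Suc j \<noteq> pr j" "Suc j \<noteq> j" using j nm p by auto
    have w: "w0 1 (2*m + j) = w0 1 j + 1" "w0 1 (Suc j) = w0 1 j + 2"
      using j nm by (auto simp: w0_del w0_eps)
    from LN_iff_nat_reflected[OF l1 a' b a(1,2) w s1 v]
    show ?thesis unfolding gbr_El_even[OF a(1) b(1) a(3) a(2), of 0, unfolded minus_zero] gbr_El_odd[OF a' b(1)] ev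
      using p j nm by (simp add: algebra_simps)
  qed
  \<comment> \<open>Now -\<epsilon>_1, at index \<open>m\<close>, takes the place of \<epsilon>_1:
    under the label with sign -1 it has the value 1, just below \<delta>_1.\<close>
  have C: "LN (El 0 m 1) \<longleftrightarrow> (if hdel \<Lambda> 1 - heps \<Lambda> 1 = 0 then heps \<Lambda> 2 + heps \<Lambda> 1 \<in> \<nat>
     else heps \<Lambda> 2 + heps \<Lambda> 1 - 1 \<in> \<nat>)"
  proof -
    have a': "2*m \<le> 2*m" "2*m < N" using n_ge by (auto simp: matdim_def)
    have p: "pr m = 0" "pr 1 = 1 + m" "pr (2*m) = 2*m + n" "pr (m - 1) = 2*m - 1" "pr 0 = m"
      using n_ge nm by (auto simp: pr_def)
    have b: "m < 2*m" "m \<noteq> m - 1" "m \<noteq> pr (m - 1)" using nm p by auto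
    have a: "1 < 2*m" "1 \<noteq> pr m" "1 \<noteq> m" using nm p by auto
    have wm: "w0 (-1) m = 1" using w0_pr[of 0 "-1"] zero_lt p by (simp add: w0_zero)
    have w: "w0 (-1) (2*m) = w0 (-1) m + 1" "w0 (-1) 1 = w0 (-1) m + 2"
      using n_ge nm w0_del[of 0 "-1"] unfolding wm by (auto simp: w0_eps)
    from LN_iff_nat_reflected[OF l2 a' b a(1,2) w s2 v]
    show ?thesis unfolding gbr_El_even[OF a(1) b(1) a(3) a(2), of 0, unfolded minus_zero] gbr_El_odd[OF a' b(1)] ev
      using p n_ge nm by (simp add: algebra_simps numeral_2_eq_2)
  qed
  \<comment> \<open>Index \<open>2*m - 1\<close> carries -\<epsilon>_m, so the raising vector has
    root \<delta> - \<theta>; the level enters through the central part of its coroot.\<close>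
  have E: "LN (El (- 1) (m - 2) (2*m - 1)) \<longleftrightarrow> hLam0 \<Lambda> - heps \<Lambda> m - heps \<Lambda> (m - 1) \<in> \<nat>"
  proof -
    have p: "pr (m - 2) = 2*m - 2" "pr (2*m - 1) = m - 1" "pr (m - 1) = 2*m - 1"
      using nm by (auto simp: pr_def)
    have *: "2*m - 1 < 2*m" "m - 2 < 2*m" "2*m - 1 \<noteq> m - 2" "2*m - 1 \<noteq> pr (m - 2)"
      using nm p by auto
    have "w0 1 (2*m - 1) = - (int m + int n)"
      using w0_pr[OF m1_less(3), of 1] w0_top(1)[of 1] p by simp
    then have "dg (w0 1) 1 (2*m - 1) (m - 2) = 1"
      using w0_top(2)[of 1] by (simp add: dg_def)
    from LN_iff_nat[OF l1 * this s1 v]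
    have "LN (El (- 1) (m - 2) (2*m - 1)) \<longleftrightarrow> hw_ev m n \<Lambda> (gbr m n (El 1 (2*m - 1) (m - 2)) (El (- 1) (m - 2) (2*m - 1))) \<in> \<nat>" .
    also have "hw_ev m n \<Lambda> (gbr m n (El 1 (2*m - 1) (m - 2)) (El (- 1) (m - 2) (2*m - 1)))
       = hLam0 \<Lambda> - heps \<Lambda> m - heps \<Lambda> (m - 1)"
    proof -
      have "m - 2 + 1 = m - 1" "m - 1 + 1 = m" "\<not> 2*m - 1 < m" "\<not> 2*m - 2 < m"
         "m - 2 < m" "m - 1 < m" "\<not> 2*m \<le> 2*m - 1" "\<not> 2*m \<le> 2*m - 2" using nm by auto
      then show ?thesis unfolding gbr_El_even[OF *] ev p by simp
    qed
    finally show ?thesis .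
  qed
  have "(\<forall>i. 1 \<le> i \<and> i < m \<longrightarrow> LN (El 0 (i - 1) i)) \<longleftrightarrow>
     (\<forall>i. n + 1 \<le> i \<and> i < m \<longrightarrow> LN (El 0 (i - 1) i)) \<and> (\<forall>i. 1 \<le> i \<and> i \<le> n \<longrightarrow> LN (El 0 (i - 1) i))"
  proof -
    have "1 \<le> i \<and> i < m \<longleftrightarrow> (n + 1 \<le> i \<and> i < m) \<or> (1 \<le> i \<and> i \<le> n)" for i
      using nm by auto
    then show ?thesis by blast
  qed
  then show ?thesis unfolding integrable_iff_simple using A B C E by auto
qed

end

text \<open>The odd reflection in the isotropic root \<open>\<delta>\<^sub>1 \<plusminus> \<epsilon>\<^sub>1\<close> outside \<open>T\<close> moves the highest weight exactly
  when \<open>y 1 \<noteq> 0\<close>, which accounts for the shift by 1.\<close>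
lemma dominance_iff_kconds:
  fixes y :: "nat \<Rightarrow> complex" and k :: complex
  assumes m: "m \<ge> 4" and k0: "k \<noteq> 0"
  shows "(\<forall>i. 2 \<le> i \<and> i < m \<longrightarrow> y (i + 1) - y i \<in> \<nat>) \<and> y 2 - y 1 \<in> \<nat>
      \<and> (if y 1 = 0 then y 2 + y 1 \<in> \<nat> else y 2 + y 1 - 1 \<in> \<nat>) \<and> k - y m - y (m - 1) \<in> \<nat>
    \<longleftrightarrow> (\<exists>ks. kconds m k ks \<and> (\<forall>i\<in>{1..m}. y i = of_real (ks i)))"
  (is "?L \<longleftrightarrow> ?R")
proof
  assume L: ?L
  define \<epsilon> :: nat where "\<epsilon> = (if y 1 = 0 then 0 else 1)"
  obtain p q :: nat where p: "y 2 - y 1 = of_nat p" and q: "y 2 + y 1 = of_nat q + of_nat \<epsilon>"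
  proof -
    have "y 2 - y 1 \<in> \<nat>" "y 2 + y 1 - of_nat \<epsilon> \<in> \<nat>" using L by (auto simp: \<epsilon>_def split: if_splits)
    then show thesis using that by (auto elim!: Nats_cases simp: algebra_simps)
  qed
  \<comment> \<open>The candidate for k_1, a half-integer: \<open>y 1\<close> is half the difference
    of \<open>y 2 + y 1\<close> and \<open>y 2 - y 1\<close>.\<close>
  define a where "a = (real q + real \<epsilon> - real p) / 2"
  have d: "2 * y 1 = of_nat q + of_nat \<epsilon> - of_nat p" using p q by (simp add: algebra_simps)
  have "y 1 = (2 * y 1) / 2" by simp
  then have y1: "y 1 = of_real a" unfolding d by (simp add: a_def)
  have "\<exists>j::nat. y i = of_real (a + real j) \<and> p \<le> j" if "2 \<le> i" "i \<le> m" for i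
    using that
  proof (induction i rule: dec_induct)
    case base
    have "y 2 = y 1 + of_nat p" using p by (simp add: algebra_simps)
    then show ?case using y1 by (intro exI[of _ p]) simp
  next
    case (step i)
    then obtain j where j: "y i = of_real (a + real j)" "p \<le> j" by auto
    obtain l :: nat where "y (i + 1) - y i = of_nat l" using L step by (auto elim!: Nats_cases)
    then have "y (Suc i) = y i + of_nat l" by (simp add: algebra_simps)
    then show ?case using j by (intro exI[of _ "j + l"]) simp
  qed
  then obtain J :: "nat \<Rightarrow> nat" where J: "\<And>i. 2 \<le> i \<Longrightarrow> i \<le> m \<Longrightarrow> y i = of_real (a + real (J i)) \<and> p \<le> J i"
    by metis
  define ks where "ks i = (if i = 1 then a else a + real (J i))" for i
  have yk: "y i = of_real (ks i)" if "i \<in> {1..m}" for i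
    using that y1 J[of i] by (cases "i = 1") (auto simp: ks_def)
  have J2: "J 2 = p"
  proof -
    have "y 2 = y 1 + of_nat p" using p by (simp add: algebra_simps)
    then have "of_real (a + real (J 2)) = (of_real (a + real p) :: complex)" using y1 J[of 2] m by simp
    then show ?thesis unfolding of_real_eq_iff by simp
  qed
  have ap: "2 * a + real p = real q + real \<epsilon>" by (simp add: a_def field_simps)
  obtain l :: nat where l: "k - y m - y (m - 1) = of_nat l" using L by (auto elim!: Nats_cases)
  have ym: "y m = of_real (a + real (J m))" "y (m - 1) = of_real (a + real (J (m - 1)))" "p \<le> J m"
    "p \<le> J (m - 1)"
    using J[of m] J[of "m - 1"] m by auto
  \<comment> \<open>The term \<open>2 * a\<close> contributes \<open>- p\<close>, which
    \<open>J m\<close> absorbs because it is at least \<open>p\<close>; so the level is natural even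
    for negative k_1.\<close>
  define kn where "kn = l + q + \<epsilon> + (J m - p) + J (m - 1)"
  have kr: "real kn = real l + (a + real (J m)) + (a + real (J (m - 1)))"
    using ap ym(3) by (simp add: kn_def of_nat_diff)
  have k: "k = of_nat kn"
  proof -
    have "k = of_nat l + y m + y (m - 1)" using l by (simp add: algebra_simps)
    also have "\<dots> = of_real (real l + (a + real (J m)) + (a + real (J (m - 1))))" using ym by simp
    also have "\<dots> = of_nat kn" unfolding kr[symmetric] by simp
    finally show ?thesis .
  qed
  have "kconds m k ks" unfolding kconds_def
  proof (intro conjI ballI)
    \<comment> \<open>The dominance conditions yield a natural number; that it is positive is the
      hypothesis on the level.\<close>
    show "\<exists>K::nat. K > 0 \<and> k = of_nat K" using k k0 by (intro exI[of _ kn]) (cases kn, auto)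
    have "2 * ks 1 = of_int (int q + int \<epsilon> - int p)" by (simp add: ks_def a_def)
    then show "2 * ks 1 \<in> \<int>" by (metis Ints_of_int)
    show "ks i - ks 1 \<in> \<int>" if "i \<in> {2..m}" for i using that by (simp add: ks_def)
    show "ks i \<le> ks (i + 1)" if i: "i \<in> {2..m - 1}" for i
    proof -
      have "y (i + 1) - y i \<in> \<nat>" using L i m by auto
      then obtain l :: nat where "y (i + 1) - y i = of_nat l" by (auto elim: Nats_cases)
      then have "of_real (ks (i + 1) - ks i) = (of_real (real l) :: complex)"
        using yk[of i] yk[of "i + 1"] i m by auto
      then have "ks (i + 1) - ks i = real l" unfolding of_real_eq_iff .
      then show ?thesis by simp
    qed
    show "\<bar>ks 1\<bar> \<le> ks 2" using ap J2 by (auto simp: ks_def abs_le_iff)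
    show "ks m + ks (m - 1) \<le> Re k" using kr k m by (simp add: ks_def)
    show "Im k = 0" using k by simp
    show "ks 2 = - ks 1 \<longrightarrow> ks 1 = 0 \<and> ks 2 = 0"
    proof
      assume "ks 2 = - ks 1"
      then have z: "real q + real \<epsilon> = 0" using ap J2 by (simp add: ks_def)
      then have "\<epsilon> = 0" by simp
      then have "y 1 = 0" by (simp add: \<epsilon>_def split: if_splits)
      then have "a = 0" using y1 by simp
      then show "ks 1 = 0 \<and> ks 2 = 0" using \<open>ks 2 = - ks 1\<close> by (simp add: ks_def)
    qed
  qed
  then show ?R using yk by blast
next
  assume ?R
  then obtain ks where ks: "kconds m k ks" and y: "\<And>i. i \<in> {1..m} \<Longrightarrow> y i = of_real (ks i)" by blast
  note c = ks[unfolded kconds_def]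
  obtain K :: nat where K: "k = of_nat K" using c by blast
  have nat: "of_real x \<in> (\<nat> :: complex set)" if "x \<in> \<int>" "x \<ge> 0" for x :: real
  proof -
    obtain z where z: "x = of_int z" using \<open>x \<in> \<int>\<close> by (auto elim: Ints_cases)
    then have "x = of_nat (nat z)" using that(2) by simp
    then show ?thesis by (metis of_nat_in_Nats of_real_of_nat_eq)
  qed
  have int1: "ks i - ks 1 \<in> \<int>" if "i \<in> {1..m}" for i
    using c that by (cases "i = 1") auto
  have dif: "ks i - ks j \<in> \<int>" if "i \<in> {1..m}" "j \<in> {1..m}" for i j
    using Ints_diff[OF int1[OF that(1)] int1[OF that(2)]] by simp
  have add: "ks i + ks j \<in> \<int>" if "i \<in> {1..m}" "j \<in> {1..m}" for i j
  proof -
    have "(ks i - ks 1) + (ks j - ks 1) + 2 * ks 1 \<in> \<int>"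
      using int1[OF that(1)] int1[OF that(2)] c by (intro Ints_add) auto
    then show ?thesis by simp
  qed
  have "y (i + 1) - y i \<in> \<nat>" if i: "2 \<le> i" "i < m" for i
  proof -
    have "of_real (ks (i + 1) - ks i) \<in> (\<nat> :: complex set)"
      using dif[of "i + 1" i] c i by (intro nat) auto
    then show ?thesis using y[of i] y[of "i + 1"] i by simp
  qed
  moreover have "y 2 - y 1 \<in> \<nat>"
  proof -
    have "of_real (ks 2 - ks 1) \<in> (\<nat> :: complex set)"
      using dif[of 2 1] c m by (intro nat) auto
    then show ?thesis using y[of 1] y[of 2] m by simp
  qed
  moreover have "if y 1 = 0 then y 2 + y 1 \<in> \<nat> else y 2 + y 1 - 1 \<in> \<nat>"
  proof -
    have i: "ks 2 + ks 1 \<in> \<int>" using add[of 2 1] m by auto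
    have ge: "ks 2 + ks 1 \<ge> 0" using c by auto
    show ?thesis
    proof (cases "y 1 = 0")
      case True
      have "of_real (ks 2 + ks 1) \<in> (\<nat> :: complex set)" by (rule nat[OF i ge])
      then show ?thesis using y[of 1] y[of 2] m True by simp
    next
      case False
      \<comment> \<open>The clause on \<open>ks 2 = - ks 1\<close> supplies the missing unit: a
        nonnegative integer other than 0 is at least 1.\<close>
      then have "ks 2 + ks 1 \<noteq> 0" using c y[of 1] m by (auto simp: add_eq_0_iff)
      then have "ks 2 + ks 1 \<ge> 1" using i ge by (auto elim!: Ints_cases)
      then have "of_real (ks 2 + ks 1 - 1) \<in> (\<nat> :: complex set)" using i by (intro nat) auto
      then show ?thesis using y[of 1] y[of 2] m False by simp
    qed
  qed
  moreover have "k - y m - y (m - 1) \<in> \<nat>"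
  proof -
    have "real K - (ks m + ks (m - 1)) \<in> \<int>" using add[of m "m - 1"] m by (intro Ints_diff) auto
    moreover have "real K - (ks m + ks (m - 1)) \<ge> 0" using c K by simp
    ultimately have "of_real (real K - (ks m + ks (m - 1))) \<in> (\<nat> :: complex set)" by (rule nat)
    then show ?thesis using y[of m] y[of "m - 1"] m K by (simp add: algebra_simps)
  qed
  ultimately show ?L by blast
qed

text \<open>The sign \<open>s\<close> treats T and T' together: -1 replaces \<beta>_1 by \<beta>_1'.
  Orthogonality ties the \<delta>_j-coordinates to the \<epsilon>_j-coordinates and \<open>c\<close>
  absorbs the coefficient of \<delta>, so only the coordinates along the \<epsilon>_i remain to be
  compared.\<close>

lemma (in osp_setting) cartan_coordinates:
  assumes s: "s = 1 \<or> s = (-1::complex)" and \<Lambda>: "\<And>i. i \<in> {1..n} \<Longrightarrow> hdel \<Lambda> i = - (if i = 1 then s else 1) * heps \<Lambda> i"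
    and b: "\<And>i h. i \<in> {1..n} \<Longrightarrow> hw_ev m n (b i) h = hw_ev m n (delw i) h - (if i = 1 then s else 1) * hw_ev m n (epsw i) h"
  shows "(\<exists>c. \<forall>h \<in> hhat m n. hw_ev m n \<Lambda> h = hLam0 \<Lambda> * hw_ev m n Lam0w h
          - (\<Sum>i\<in>{1..n}. of_real (ks i) * hw_ev m n (b i) h)
          + (\<Sum>i\<in>{n+1..m}. of_real (ks i) * hw_ev m n (epsw i) h) + c * hw_ev m n deltaw h)
     \<longleftrightarrow> (\<forall>i\<in>{1..m}. (if i = 1 then s else 1) * heps \<Lambda> i = of_real (ks i))"
proof -
  define t where "t i = (if i = 1 then s else 1)" for i :: nat
  have tt: "t i * t i = 1" for i using s by (auto simp: t_def)
  have split: "{1..m} = {1..n} \<union> {n+1..m}" "{1..n} \<inter> {n+1..m} = {}" using m_gt by auto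
  have RHS: "hLam0 \<Lambda> * hw_ev m n Lam0w h
          - (\<Sum>i\<in>{1..n}. of_real (ks i) * hw_ev m n (b i) h)
          + (\<Sum>i\<in>{n+1..m}. of_real (ks i) * hw_ev m n (epsw i) h) + c * hw_ev m n deltaw h
     = (\<Sum>i\<in>{1..m}. t i * of_real (ks i) * hval h (i - 1))
       - (\<Sum>i\<in>{1..n}. of_real (ks i) * hval h (2*m + i - 1)) + hLam0 \<Lambda> * cK h + c * cd h" for c h
  proof -
    have "(\<Sum>i\<in>{1..n}. of_real (ks i) * hw_ev m n (b i) h)
       = (\<Sum>i\<in>{1..n}. of_real (ks i) * hval h (2*m + i - 1)) - (\<Sum>i\<in>{1..n}. t i * of_real (ks i) * hval h (i - 1))"
      unfolding sum_subtractf[symmetric]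
      by (rule sum.cong) (use m_gt in \<open>auto simp: b hw_ev_epsw hw_ev_delw t_def algebra_simps\<close>)
    moreover have "(\<Sum>i\<in>{n+1..m}. of_real (ks i) * hw_ev m n (epsw i) h)
       = (\<Sum>i\<in>{n+1..m}. t i * of_real (ks i) * hval h (i - 1))"
      by (rule sum.cong) (use n_ge in \<open>auto simp: hw_ev_epsw t_def\<close>)
    ultimately show ?thesis
      unfolding split(1) by (subst sum.union_disjoint) (use split(2) in \<open>auto simp: hw_ev_Lam0w hw_ev_deltaw\<close>)
  qed
  have LHS: "hw_ev m n \<Lambda> h = (\<Sum>i\<in>{1..m}. heps \<Lambda> i * hval h (i - 1)) - (\<Sum>i\<in>{1..n}. t i * heps \<Lambda> i * hval h (2*m + i - 1))
      + hLam0 \<Lambda> * cK h + hdelta \<Lambda> * cd h" for h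
    unfolding hw_ev_def using \<Lambda> by (simp add: split_beta t_def sum_negf[symmetric])
  show ?thesis unfolding t_def[symmetric]
  proof
    assume "\<exists>c. \<forall>h \<in> hhat m n. hw_ev m n \<Lambda> h = hLam0 \<Lambda> * hw_ev m n Lam0w h
          - (\<Sum>i\<in>{1..n}. of_real (ks i) * hw_ev m n (b i) h)
          + (\<Sum>i\<in>{n+1..m}. of_real (ks i) * hw_ev m n (epsw i) h) + c * hw_ev m n deltaw h"
    then obtain c where c: "\<And>h. h \<in> hhat m n \<Longrightarrow> hw_ev m n \<Lambda> h = 
        (\<Sum>i\<in>{1..m}. t i * of_real (ks i) * hval h (i - 1))
       - (\<Sum>i\<in>{1..n}. of_real (ks i) * hval h (2*m + i - 1)) + hLam0 \<Lambda> * cK h + c * cd h"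
      unfolding RHS by blast
    show "\<forall>i\<in>{1..m}. t i * heps \<Lambda> i = of_real (ks i)"
    proof
      fix i assume i: "i \<in> {1..m}"
      define k where "k = i - 1"
      have k: "k < m" "k < N" "pr k = k + m" "i = Suc k" using i by (auto simp: k_def matdim_def pr_def)
      define h where "h = hx (\<lambda>j. delta_at k j - delta_at (pr k) j) 0 0"
      have hh: "h \<in> hhat m n" unfolding h_def by (rule hx_hhat) (use k(2) in \<open>auto simp: pr_inj pr_swap\<close>)
      have hv: "hval h (j - 1) = (if j = i then 1 else 0)" if "j \<in> {1..m}" for j
        using that k by (auto simp: h_def matdim_def)
      have hd: "hval h (2*m + j - 1) = 0" if "j \<in> {1..n}" for j
        using that k by (auto simp: h_def)
      have S: "(\<Sum>j\<in>{1..m}. f j * hval h (j - 1)) = f i" for f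
      proof -
        have "(\<Sum>j\<in>{1..m}. f j * hval h (j - 1)) = (\<Sum>j\<in>{1..m}. if j = i then f i else 0)"
        proof (rule sum.cong)
          show "f j * hval h (j - 1) = (if j = i then f i else 0)" if "j \<in> {1..m}" for j
            unfolding hv[OF that] by simp
        qed simp
        then show ?thesis using i by simp
      qed
      have S0: "(\<Sum>j\<in>{1..n}. f j * hval h (2*m + j - 1)) = 0" for f
      proof (rule sum.neutral, rule ballI)
        show "f j * hval h (2*m + j - 1) = 0" if "j \<in> {1..n}" for j
          unfolding hd[OF that] by simp
      qed
      have "cK h = 0" "cd h = 0" by (simp_all add: h_def)
      then have "heps \<Lambda> i = t i * of_real (ks i)"
        using c[OF hh] unfolding LHS S S0 by simp
      then have "t i * heps \<Lambda> i = t i * t i * of_real (ks i)" by simp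
      then show "t i * heps \<Lambda> i = of_real (ks i)" by (simp add: tt)
    qed
  next
    assume *: "\<forall>i\<in>{1..m}. t i * heps \<Lambda> i = of_real (ks i)"
    have e: "heps \<Lambda> i = t i * of_real (ks i)" if "i \<in> {1..m}" for i
    proof -
      have "t i * of_real (ks i) = (t i * t i) * heps \<Lambda> i" using * that by simp
      then show ?thesis by (simp add: tt)
    qed
    have S: "(\<Sum>i\<in>{1..m}. heps \<Lambda> i * hval h (i - 1)) = (\<Sum>i\<in>{1..m}. t i * of_real (ks i) * hval h (i - 1))"
      "(\<Sum>i\<in>{1..n}. t i * heps \<Lambda> i * hval h (2*m + i - 1)) = (\<Sum>i\<in>{1..n}. of_real (ks i) * hval h (2*m + i - 1))"
      for h
      by (rule sum.cong[OF refl], simp only: e) (rule sum.cong[OF refl], use * m_gt in simp)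
    show "\<exists>c. \<forall>h \<in> hhat m n. hw_ev m n \<Lambda> h = hLam0 \<Lambda> * hw_ev m n Lam0w h
          - (\<Sum>i\<in>{1..n}. of_real (ks i) * hw_ev m n (b i) h)
          + (\<Sum>i\<in>{n+1..m}. of_real (ks i) * hw_ev m n (epsw i) h) + c * hw_ev m n deltaw h"
      unfolding RHS LHS S by blast
  qed
qed

theorem theorem6p1:
  fixes m n :: nat and \<Lambda> :: hw
    and sc :: "complex \<Rightarrow> 'v::ab_group_add \<Rightarrow> 'v" and \<rho> :: "ghat \<Rightarrow> 'v \<Rightarrow> 'v"
  assumes "m > n + 2" and "n \<ge> 1"
    and "is_L m n sc \<rho> \<Lambda>"
    and "level m n \<Lambda> \<noteq> 0"
  shows "((\<forall>i\<in>{1..n}. hw_form m n \<Lambda> (beta i) = 0) \<longrightarrow>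
           (integrable m n \<rho> \<longleftrightarrow>
             (\<exists>(c::complex) (ks::nat \<Rightarrow> real). kconds m (level m n \<Lambda>) ks \<and>
               (\<forall>h \<in> hhat m n. hw_ev m n \<Lambda> h =
                   level m n \<Lambda> * hw_ev m n Lam0w h
                 - (\<Sum>i\<in>{1..n}. of_real (ks i) * hw_ev m n (beta i) h)
                 + (\<Sum>i\<in>{n+1..m}. of_real (ks i) * hw_ev m n (epsw i) h)
                 + c * hw_ev m n deltaw h))))
       \<and> ((\<forall>i\<in>{1..n}. hw_form m n \<Lambda> (beta' i) = 0) \<longrightarrow>
           (integrable m n \<rho> \<longleftrightarrow>
             (\<exists>(c::complex) (ks::nat \<Rightarrow> real). kconds m (level m n \<Lambda>) ks \<and>
               (\<forall>h \<in> hhat m n. hw_ev m n \<Lambda> h =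
                   level m n \<Lambda> * hw_ev m n Lam0w h
                 - (\<Sum>i\<in>{1..n}. of_real (ks i) * hw_ev m n (beta' i) h)
                 + (\<Sum>i\<in>{n+1..m}. of_real (ks i) * hw_ev m n (epsw i) h)
                 + c * hw_ev m n deltaw h))))"
proof -
  have irr: "\<forall>W. 0 \<in> W \<and> (\<forall>u\<in>W. \<forall>w\<in>W. u + w \<in> W) \<and> (\<forall>c. \<forall>u\<in>W. sc c u \<in> W)
           \<and> (\<forall>x \<in> ghat m n. \<forall>u\<in>W. \<rho> x u \<in> W) \<longrightarrow> W = {0} \<or> W = UNIV"
    and rep: "is_rep m n sc \<rho>"
    using assms(3) unfolding is_L_def by blast+
  obtain v where v: "v \<noteq> 0" "\<forall>h \<in> hhat m n. \<rho> h v = sc (hw_ev m n \<Lambda> h) v"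
    "\<forall>\<gamma> \<in> qplus m n. \<not> hw_eq m n \<gamma> hw_zero \<longrightarrow> (\<forall>x \<in> groot m n \<gamma>. \<rho> x v = 0)"
    using assms(3) unfolding is_L_def by blast
  interpret osp_irrep m n sc \<rho>
  proof (unfold_locales, goal_cases)
    case 1 show ?case by (rule assms(1))
    case 2 show ?case by (rule assms(2))
    case 3 show ?case by (rule rep)
    case (4 W)
    show ?case by (rule irr[rule_format]) (intro conjI ballI allI 4)
  qed
  note sing = highest_weight_sing[OF v(2,3)]
  note I = integrable_iff_coordinates[OF v(1) sing[of 1, simplified] sing[of "-1", simplified]]
  have lev: "level m n \<Lambda> = hLam0 \<Lambda>"
    by (simp add: level_def K_el_def hw_ev_def mzero_def)
  have k0: "hLam0 \<Lambda> \<noteq> 0" using assms(4) lev by simp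
  have m4: "m \<ge> 4" using m_gt n_ge by simp
  have form: "hw_form m n \<Lambda> (beta i) = - heps \<Lambda> i - hdel \<Lambda> i"
    "hw_form m n \<Lambda> (hw_add (delw i) (epsw i)) = heps \<Lambda> i - hdel \<Lambda> i" if "i \<in> {1..n}" for i
  proof -
    have "i \<in> {1..m}" using that m_gt by simp
    then have e: "(\<Sum>j\<in>{1..m}. heps \<Lambda> j * (if j = i then 1 else 0)) = heps \<Lambda> i"
      using sum_unit[of "{1..m}" i "heps \<Lambda>"] by (simp add: mult.commute)
    have d: "(\<Sum>j\<in>{1..n}. hdel \<Lambda> j * (if j = i then 1 else 0)) = hdel \<Lambda> i"
      using sum_unit[of "{1..n}" i "hdel \<Lambda>"] that by (simp add: mult.commute)
    show "hw_form m n \<Lambda> (beta i) = - heps \<Lambda> i - hdel \<Lambda> i"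
      using e d by (simp add: hw_form_def beta_def hw_sub_def hw_add_def hw_sc_def delw_def epsw_def
          hw_zero_def sum_negf)
    show "hw_form m n \<Lambda> (hw_add (delw i) (epsw i)) = heps \<Lambda> i - hdel \<Lambda> i"
      using e d by (simp add: hw_form_def hw_add_def delw_def epsw_def hw_zero_def)
  qed
  have main: "integrable m n \<rho> \<longleftrightarrow>
       (\<exists>(c::complex) (ks::nat \<Rightarrow> real). kconds m (level m n \<Lambda>) ks \<and>
         (\<forall>h \<in> hhat m n. hw_ev m n \<Lambda> h = level m n \<Lambda> * hw_ev m n Lam0w h
                 - (\<Sum>i\<in>{1..n}. of_real (ks i) * hw_ev m n (b i) h)
                 + (\<Sum>i\<in>{n+1..m}. of_real (ks i) * hw_ev m n (epsw i) h)
                 + c * hw_ev m n deltaw h))"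
    if s: "s = 1 \<or> s = (-1::complex)" and \<Lambda>: "\<And>i. i \<in> {1..n} \<Longrightarrow> hdel \<Lambda> i = - (if i = 1 then s else 1) * heps \<Lambda> i"
      and b: "\<And>i h. i \<in> {1..n} \<Longrightarrow> hw_ev m n (b i) h = hw_ev m n (delw i) h - (if i = 1 then s else 1) * hw_ev m n (epsw i) h"
    for s b
  proof -
    \<comment> \<open>The values that the k_i must take; for T' the first coordinate changes
      sign.\<close>
    define y where "y i = (if i = 1 then s else 1) * heps \<Lambda> i" for i
    have y1: "y 1 = s * heps \<Lambda> 1" and y2: "\<And>i. i \<ge> 2 \<Longrightarrow> y i = heps \<Lambda> i" by (simp_all add: y_def)
    have "(\<forall>i. n + 1 \<le> i \<and> i < m \<longrightarrow> heps \<Lambda> (i + 1) - heps \<Lambda> i \<in> \<nat>)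
        \<and> (\<forall>i. 1 \<le> i \<and> i \<le> n \<longrightarrow> (if hdel \<Lambda> i + heps \<Lambda> i = 0 then heps \<Lambda> (i + 1) - heps \<Lambda> i \<in> \<nat>
              else heps \<Lambda> (i + 1) - heps \<Lambda> i - 1 \<in> \<nat>))
        \<and> (if hdel \<Lambda> 1 - heps \<Lambda> 1 = 0 then heps \<Lambda> 2 + heps \<Lambda> 1 \<in> \<nat> else heps \<Lambda> 2 + heps \<Lambda> 1 - 1 \<in> \<nat>)
      \<longleftrightarrow> (\<forall>i. 2 \<le> i \<and> i < m \<longrightarrow> y (i + 1) - y i \<in> \<nat>) \<and> y 2 - y 1 \<in> \<nat>
        \<and> (if y 1 = 0 then y 2 + y 1 \<in> \<nat> else y 2 + y 1 - 1 \<in> \<nat>)"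
      (is "?A \<and> ?B \<and> ?C \<longleftrightarrow> ?A' \<and> ?B' \<and> ?C'")
    proof -
      have "?A \<and> ?B \<longleftrightarrow> (\<forall>i. 2 \<le> i \<and> i < m \<longrightarrow> y (i + 1) - y i \<in> \<nat>)
         \<and> (if hdel \<Lambda> 1 + heps \<Lambda> 1 = 0 then heps \<Lambda> 2 - heps \<Lambda> 1 \<in> \<nat> else heps \<Lambda> 2 - heps \<Lambda> 1 - 1 \<in> \<nat>)"
        (is "_ \<longleftrightarrow> _ \<and> ?B1")
      proof -
        have r: "2 \<le> i \<and> i < m \<longleftrightarrow> (n + 1 \<le> i \<and> i < m) \<or> (2 \<le> i \<and> i \<le> n)"
          "1 \<le> i \<and> i \<le> n \<longleftrightarrow> i = 1 \<or> (2 \<le> i \<and> i \<le> n)" for i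
          using m_gt n_ge by auto
        \<comment> \<open>For i between 2 and n orthogonality to \<beta>_i makes the odd reflection
          trivial, which selects the unshifted alternative.\<close>
        have t: "(if hdel \<Lambda> i + heps \<Lambda> i = 0 then heps \<Lambda> (i + 1) - heps \<Lambda> i \<in> \<nat>
              else heps \<Lambda> (i + 1) - heps \<Lambda> i - 1 \<in> \<nat>) \<longleftrightarrow> y (i + 1) - y i \<in> \<nat>" if "2 \<le> i \<and> i \<le> n" for i
          using that \<Lambda>[of i] by (simp add: y2)
        have u: "heps \<Lambda> (i + 1) - heps \<Lambda> i = y (i + 1) - y i" if "n + 1 \<le> i \<and> i < m" for i
          using that n_ge by (simp add: y2)
        have B: "?B \<longleftrightarrow> (\<forall>i. 2 \<le> i \<and> i \<le> n \<longrightarrow> y (i + 1) - y i \<in> \<nat>) \<and> ?B1"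
          unfolding r(2) using t by (auto simp: numeral_2_eq_2)
        show ?thesis unfolding B r(1) using u by auto
      qed
      \<comment> \<open>For s = 1 the conditions from \<delta>_1 - \<epsilon>_1 and \<delta>_1 +
        \<epsilon>_1 match in this order, for s = -1 they change places; the one whose odd root is
        orthogonal to \<Lambda> by hypothesis carries no shift.\<close>
      moreover have "?B1 \<and> ?C \<longleftrightarrow> ?B' \<and> ?C'"
        using s \<Lambda>[of 1] n_ge unfolding y1 y2[of 2, simplified]
        by (auto simp: algebra_simps)
      ultimately show ?thesis by blast
    qed
    note conds = this
    have top: "hLam0 \<Lambda> - heps \<Lambda> m - heps \<Lambda> (m - 1) = hLam0 \<Lambda> - y m - y (m - 1)"
      using m4 y2[of m] y2[of "m - 1"] by simp
    have cong: "(A \<and> B \<and> C \<and> E) = (A' \<and> B' \<and> C' \<and> E)" if "(A \<and> B \<and> C) = (A' \<and> B' \<and> C')"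
      for A B C A' B' C' E using that by blast
    have "integrable m n \<rho> \<longleftrightarrow> (\<exists>ks. kconds m (hLam0 \<Lambda>) ks \<and> (\<forall>i\<in>{1..m}. y i = of_real (ks i)))"
      unfolding I top dominance_iff_kconds[OF m4 k0, of y, symmetric] by (rule cong[OF conds])
    moreover have "(\<forall>i\<in>{1..m}. y i = of_real (ks i)) \<longleftrightarrow>
       (\<exists>c. \<forall>h \<in> hhat m n. hw_ev m n \<Lambda> h = hLam0 \<Lambda> * hw_ev m n Lam0w h
          - (\<Sum>i\<in>{1..n}. of_real (ks i) * hw_ev m n (b i) h)
          + (\<Sum>i\<in>{n+1..m}. of_real (ks i) * hw_ev m n (epsw i) h) + c * hw_ev m n deltaw h)" for ks
      unfolding y_def by (rule cartan_coordinates[symmetric]) (assumption | rule s \<Lambda> b)+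
    ultimately show ?thesis
      unfolding lev by (simp only:) blast
  qed
  show ?thesis
  proof (intro conjI impI)
    assume "\<forall>i\<in>{1..n}. hw_form m n \<Lambda> (beta i) = 0"
    then have "hdel \<Lambda> i = - heps \<Lambda> i" if "i \<in> {1..n}" for i
      using form(1)[OF that] that by (simp add: algebra_simps add_eq_0_iff)
    then show "integrable m n \<rho> \<longleftrightarrow>
       (\<exists>(c::complex) (ks::nat \<Rightarrow> real). kconds m (level m n \<Lambda>) ks \<and>
         (\<forall>h \<in> hhat m n. hw_ev m n \<Lambda> h = level m n \<Lambda> * hw_ev m n Lam0w h
                 - (\<Sum>i\<in>{1..n}. of_real (ks i) * hw_ev m n (beta i) h)
                 + (\<Sum>i\<in>{n+1..m}. of_real (ks i) * hw_ev m n (epsw i) h)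
                 + c * hw_ev m n deltaw h))"
      by (intro main[of 1]) (simp_all add: beta_def hw_ev_sub)
  next
    assume f: "\<forall>i\<in>{1..n}. hw_form m n \<Lambda> (beta' i) = 0"
    have "hdel \<Lambda> i = - (if i = 1 then - 1 else 1) * heps \<Lambda> i" if "i \<in> {1..n}" for i
      using form[OF that] bspec[OF f that]
      by (cases "i = 1") (simp_all add: beta'_def add_eq_0_iff)
    then show "integrable m n \<rho> \<longleftrightarrow>
       (\<exists>(c::complex) (ks::nat \<Rightarrow> real). kconds m (level m n \<Lambda>) ks \<and>
         (\<forall>h \<in> hhat m n. hw_ev m n \<Lambda> h = level m n \<Lambda> * hw_ev m n Lam0w h
                 - (\<Sum>i\<in>{1..n}. of_real (ks i) * hw_ev m n (beta' i) h)
                 + (\<Sum>i\<in>{n+1..m}. of_real (ks i) * hw_ev m n (epsw i) h)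
                 + c * hw_ev m n deltaw h))"
      by (intro main[of "-1"]) (simp_all add: beta'_def beta_def hw_ev_sub hw_ev_add)
  qed
qed

end
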